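(* Let $\alpha,\beta\ge-1/2$ and $1\le p<\infty$. Then \[ \lim_{r\to1^-}\|\mathcal{T}_rf-f\|_{\ell^p(\mathbb{N})}=0\quad\text{for every } f\in\ell^p(\mathbb{N}) \] holds if and only if $1<p<\infty$.
   Context: $\mathbb{N}=\{0,1,2,\dots\}$. For $\alpha,\beta>-1$, $d\mu_{\alpha,\beta}(x)=(1-x)^\alpha(1+x)^\beta\,dx$ on $[-1,1]$, and $p_n^{(\alpha,\beta)}$ are the orthonormal Jacobi polynomials (classical Jacobi polynomials $P_n^{(\alpha,\beta)}$ normalized in $L^2([-1,1],d\mu_{\alpha,\beta})$). For a sequence $f$, $\mathcal{F}_{\alpha,\beta}f(x)=\sum_{k\ge0}f(k)p_k^{(\alpha,\beta)}(x)$ and $\mathcal{F}^{-1}_{\alpha,\beta}F(n)=\int_{-1}^1F\,p_n^{(\alpha,\beta)}\,d\mu_{\alpha,\beta}$. For $[a,b]\subset[-1,1]$, $T_{[a,b]}f=\mathcal{F}^{-1}_{\alpha,\beta}(\chi_{[a,b]}\mathcal{F}_{\alpha,\beta}f)$, given on $\ell^p(\mathbb{N})$ by $T_{[a,b]}f(n)=\sum_{m\ge0}f(m)\int_a^b p_m^{(\alpha,\beta)}p_n^{(\alpha,\beta)}\,d\mu_{\alpha,\beta}$; for $0<r<1$, $\mathcal{T}_r=T_{[-r,r]}$. *)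

theory Defs
  imports "HOL-Analysis.Analysis"
begin

definition jacobi_weight :: "real \<Rightarrow> real \<Rightarrow> real \<Rightarrow> real" where
  "jacobi_weight a b x = (1 - x) powr a * (1 + x) powr b"

definition jacobiP :: "real \<Rightarrow> real \<Rightarrow> nat \<Rightarrow> real \<Rightarrow> real" where
  "jacobiP a b n x =
     (\<Sum>k\<le>n. ((real n + a) gchoose (n - k)) * ((real n + b) gchoose k)
              * ((x - 1) / 2) ^ k * ((x + 1) / 2) ^ (n - k))"

definition jacobi_p :: "real \<Rightarrow> real \<Rightarrow> nat \<Rightarrow> real \<Rightarrow> real" where
  "jacobi_p a b n x = jacobiP a b n x /
     sqrt (LINT y:{-1..1}|lborel. (jacobiP a b n y)\<^sup>2 * jacobi_weight a b y)"

definition jacobi_kernel :: "real \<Rightarrow> real \<Rightarrow> real \<Rightarrow> real \<Rightarrow> nat \<Rightarrow> nat \<Rightarrow> real" where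
  "jacobi_kernel a b c d m n =
     (LINT x:{c..d}|lborel. jacobi_p a b m x * jacobi_p a b n x * jacobi_weight a b x)"

definition T_interval :: "real \<Rightarrow> real \<Rightarrow> real \<Rightarrow> real \<Rightarrow> (nat \<Rightarrow> real) \<Rightarrow> nat \<Rightarrow> real" where
  "T_interval a b c d f n = (\<Sum>m. f m * jacobi_kernel a b c d m n)"

definition T_r :: "real \<Rightarrow> real \<Rightarrow> real \<Rightarrow> (nat \<Rightarrow> real) \<Rightarrow> nat \<Rightarrow> real" where
  "T_r a b r f = T_interval a b (-r) r f"

definition in_lp :: "real \<Rightarrow> (nat \<Rightarrow> real) \<Rightarrow> bool" where
  "in_lp p f \<longleftrightarrow> summable (\<lambda>n. \<bar>f n\<bar> powr p)"

definition lp_norm :: "real \<Rightarrow> (nat \<Rightarrow> real) \<Rightarrow> real" where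
  "lp_norm p f = (\<Sum>n. \<bar>f n\<bar> powr p) powr (1 / p)"

end

theory Submission
  imports Defs "HOL-Complex_Analysis.Cauchy_Integral_Theorem"
begin

text \<open>Put \<open>x = cos t\<close>, \<open>N\<^sub>n = n + (\<alpha> + \<beta> + 1)/2\<close> and \<open>u\<^sub>n(t) = \<rho>(t) p\<^sub>n(cos t)\<close> with
  \<open>\<rho>\<^sup>2 = (1 - x)\<^bsup>\<alpha>+1/2\<^esup> (1 + x)\<^bsup>\<beta>+1/2\<^esup>\<close>. The Jacobi equation becomes \<open>u\<^sub>n'' + q\<^sub>n u\<^sub>n = 0\<close> with
  \<open>q\<^sub>n - N\<^sub>n\<^sup>2 = O(1/sin\<^sup>2 t)\<close>, so the energy \<open>u\<^sub>n\<^sup>2 + (u\<^sub>n'/N\<^sub>n)\<^sup>2\<close> changes by a bounded factor outside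
  the caps \<open>sin t < c/N\<^sub>n\<close>, where the self-adjoint form of the equation takes over. With the
  normalisation in \<open>L\<^sup>2\<close> this bounds \<open>u\<^sub>n\<close> and \<open>v\<^sub>n/N\<^sub>n\<close>, \<open>v\<^sub>n = \<rho> (p\<^sub>n(cos t))'\<close>, uniformly in \<open>n\<close> and \<open>t\<close>.
  By the Wronskian identity the kernel of \<open>T\<^sub>r\<close> off the diagonal is a combination of boundary terms
  \<open>(u\<^sub>n v\<^sub>m - u\<^sub>m v\<^sub>n)/(N\<^sub>n\<^sup>2 - N\<^sub>m\<^sup>2)\<close>, that is, of the kernels \<open>1/(n - m)\<close> and \<open>1/(N\<^sub>n + N\<^sub>m)\<close> multiplied by
  bounded sequences, and the discrete M. Riesz theorem gives boundedness on \<open>l\<^sup>p\<close> uniformly in \<open>r\<close> for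
  \<open>p > 1\<close>; convergence on finitely supported sequences then suffices.

  For \<open>p = 1\<close>, convergence on the first two unit vectors would make \<open>\<Sum>\<^sub>n \<bar>v\<^sub>n(t)\<bar>/n\<^sup>2\<close> finite for all small
  \<open>t\<close>. The logarithmic means of \<open>\<bar>v\<^sub>n(t)\<bar>/n\<close> would then tend to \<open>0\<close> boundedly, but the integral of \<open>\<bar>v\<^sub>n\<bar>\<close>
  over any interval is at least \<open>c n\<close>.\<close>

section \<open>The discrete Hilbert transform\<close>

text \<open>The discrete Riesz theorem comes from complex analysis. For finitely supported
  \<open>f \<ge> 0\<close> the function \<open>\<i> * (\<Sum>m. f m / (z - m))\<close> maps the
  upper half-plane into the right half-plane, so it has a holomorphic \<open>p\<close>-th power,
  whose integral over \<open>Im z = 1\<close> vanishes. For \<open>1 < p \<le> 2\<close> a pointwise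
  inequality turns this into a bound of the imaginary part, close to the Hilbert sum, by the real
  part, a sum of Poisson kernels that is easy to estimate. Antisymmetry of the kernel gives
  \<open>p > 2\<close> by duality. The assumption \<open>\<alpha>, \<beta> \<ge> -1/2\<close> makes
  the exponents of \<open>\<rho>\<close> nonnegative; with a negative exponent \<open>u_n\<close>
  would be unbounded near that endpoint. For \<open>p = 1\<close> the series is known to converge
  only separately at each \<open>t\<close>, with no uniform bound, so it cannot be integrated term
  by term. Dividing its partial sums by harmonic numbers supplies the bound that dominated
  convergence requires. As \<open>v_n\<close> oscillates, it is bounded below through its integral
  and not pointwise.\<close>

lemma Holder_sum:
  fixes f g :: "'a \<Rightarrow> real"
  assumes pq: "p > 1" "q > 1" "1/p + 1/q = 1"
  shows "(\<Sum>i\<in>I. \<bar>f i * g i\<bar>)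
         \<le> (\<Sum>i\<in>I. \<bar>f i\<bar> powr p) powr (1/p) * (\<Sum>i\<in>I. \<bar>g i\<bar> powr q) powr (1/q)"
proof (cases "finite I")
  case fin: True
  define F where "F = (\<Sum>i\<in>I. \<bar>f i\<bar> powr p)"
  define G where "G = (\<Sum>i\<in>I. \<bar>g i\<bar> powr q)"
  have nn: "F \<ge> 0" "G \<ge> 0" unfolding F_def G_def by (auto intro!: sum_nonneg)
  show ?thesis
  proof (cases "F = 0 \<or> G = 0")
    case True
    have "f i * g i = 0" if "i \<in> I" for i
      using True that fin unfolding F_def G_def by (auto simp: sum_nonneg_eq_0_iff)
    then have "(\<Sum>i\<in>I. \<bar>f i * g i\<bar>) = 0" by (intro sum.neutral) auto
    then show ?thesis by simp
  next
    case False
    then have pos: "F > 0" "G > 0" using nn by auto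
    define a where "a = F powr (1/p)"
    define b where "b = G powr (1/q)"
    have ab: "a > 0" "b > 0" "a powr p = F" "b powr q = G"
      using pos pq by (auto simp: a_def b_def powr_powr)
    have "\<bar>f i * g i\<bar> / (a * b) \<le> \<bar>f i\<bar> powr p / F / p + \<bar>g i\<bar> powr q / G / q" for i
    proof -
      have "(\<bar>f i\<bar>/a) * (\<bar>g i\<bar>/b) \<le> (\<bar>f i\<bar>/a) powr p / p + (\<bar>g i\<bar>/b) powr q / q"
        using pq ab by (intro Youngs_inequality) auto
      then show ?thesis using ab by (simp add: powr_divide abs_mult)
    qed
    then have "(\<Sum>i\<in>I. \<bar>f i * g i\<bar> / (a * b)) \<le> (\<Sum>i\<in>I. \<bar>f i\<bar> powr p / F / p + \<bar>g i\<bar> powr q / G / q)"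
      by (intro sum_mono)
    also have "\<dots> = F / F / p + G / G / q"
      unfolding sum.distrib sum_divide_distrib[symmetric] F_def G_def by simp
    also have "\<dots> = 1" using pos pq by simp
    finally have "(\<Sum>i\<in>I. \<bar>f i * g i\<bar>) / (a * b) \<le> 1" by (simp add: sum_divide_distrib)
    then show ?thesis using ab by (simp add: a_def b_def F_def G_def)
  qed
qed simp

text \<open>Jensen's inequality for weights that are not normalised: split \<open>k\<close> as
  \<open>k powr (1/p) * k powr (1/q)\<close> and apply Hoelder. With the kernel
  \<open>1 / ((x - m)^2 + 1)\<close> as \<open>k\<close> it drives
  \<open>integral_poisson_powr_le\<close>.\<close>

lemma powr_sum_weighted:
  fixes k f :: "'a \<Rightarrow> real"
  assumes p: "p > 1" and k: "\<And>i. i \<in> I \<Longrightarrow> k i \<ge> 0" and f: "\<And>i. i \<in> I \<Longrightarrow> f i \<ge> 0"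
  shows "(\<Sum>i\<in>I. k i * f i) powr p \<le> (\<Sum>i\<in>I. k i) powr (p - 1) * (\<Sum>i\<in>I. k i * f i powr p)"
proof -
  define q where "q = p / (p - 1)"
  have q: "q > 1" "1/p + 1/q = 1" "p / q = p - 1" using p by (auto simp: q_def field_simps)
  have "(\<Sum>i\<in>I. k i * f i) = (\<Sum>i\<in>I. \<bar>(k i powr (1/p) * f i) * k i powr (1/q)\<bar>)"
  proof (rule sum.cong)
    fix i assume i: "i \<in> I"
    have "k i powr (1/p) * k i powr (1/q) = k i"
      using q k[OF i] by (simp flip: powr_add)
    then show "k i * f i = \<bar>(k i powr (1/p) * f i) * k i powr (1/q)\<bar>"
      using f[OF i] k[OF i] by (simp add: abs_mult mult.commute mult.left_commute)
  qed simp
  also have "\<dots> \<le> (\<Sum>i\<in>I. \<bar>k i powr (1/p) * f i\<bar> powr p) powr (1/p) * (\<Sum>i\<in>I. \<bar>k i powr (1/q)\<bar> powr q) powr (1/q)"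
    by (intro Holder_sum p q)
  also have "\<dots> = (\<Sum>i\<in>I. k i * f i powr p) powr (1/p) * (\<Sum>i\<in>I. k i) powr (1/q)"
    using p q k f by (intro arg_cong2[where f="\<lambda>x y. x powr (1/p) * y powr (1/q)"] sum.cong) (auto simp: powr_mult powr_powr)
  finally have "(\<Sum>i\<in>I. k i * f i) powr p \<le> ((\<Sum>i\<in>I. k i * f i powr p) powr (1/p) * (\<Sum>i\<in>I. k i) powr (1/q)) powr p"
    using p k f by (intro powr_mono2) (auto intro!: sum_nonneg)
  also have "\<dots> = (\<Sum>i\<in>I. k i * f i powr p) * (\<Sum>i\<in>I. k i) powr (p - 1)"
    using p q k f by (simp add: powr_mult powr_powr sum_nonneg)
  finally show ?thesis by (simp add: mult.commute)
qed

text \<open>Near \<open>arg z = \<plusminus>\<pi>/2\<close> the real part of \<open>z powr p\<close> is negative because \<open>1 < p \<le> 2\<close>; elsewhere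
  \<open>\<bar>z\<bar>\<close> is controlled by \<open>Re z\<close>.\<close>
lemma riesz_pointwise:
  assumes p: "1 < p" "p \<le> 2"
  obtains A B :: real where "A \<ge> 0" "B \<ge> 0"
    "\<And>z. Re z > 0 \<Longrightarrow> (\<bar>Im z\<bar> + 3 * Re z) powr p \<le> A * Re z powr p - B * Re (z powr of_real p)"
proof -
  \<comment> \<open>The midpoint of \<open>pi / (2 * p)\<close> and \<open>pi / 2\<close>: then
    \<open>p * t = pi/4 * (p + 1)\<close> lies strictly between \<open>pi / 2\<close> and
    \<open>pi\<close>, where the cosine is negative, while \<open>cos t\<close> is still
    positive.\<close>
  define t where "t = pi/4 * (1 + 1/p)"
  have t: "0 < t" "t < pi/2" "pi/2 < p * t" "p * t < pi"
  proof -
    have "1/p < 1" using p by simp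
    then show "0 < t" "t < pi/2" using p by (auto simp: t_def add_pos_pos)
    have "p * t = pi/4 * (p + 1)" using p by (simp add: t_def field_simps)
    moreover have "pi * 1 < pi * p" "pi * p \<le> pi * 2" using p by (intro mult_strict_left_mono mult_left_mono; simp)+
    ultimately show "pi/2 < p * t" "p * t < pi" using pi_gt_zero by (simp_all add: distrib_left, linarith+)
  qed
  define c where "c = - cos (p * t)"
  have c: "c > 0" using t cos_lt_zero_pi[of "p*t"] by (simp add: c_def)
  define d where "d = cos t"
  have d: "d > 0" using t by (auto simp: d_def intro!: cos_gt_zero)
  \<comment> \<open>With \<open>r = norm z\<close> the left side is at most
    \<open>(4 * r) powr p\<close>. For arguments \<open>s \<ge> t\<close> the term with
    \<open>B\<close> alone yields \<open>4 powr p\<close>; for \<open>s < t\<close> the term with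
    \<open>A\<close> yields \<open>4 powr p + B\<close>, which covers the worst sign of the other
    one. The 3 in the statement is the constant of \<open>hilbert_kernel_approx\<close>.\<close>
  define B where "B = 4 powr p / c"
  define A where "A = (4 powr p + B) / d powr p"
  have B: "B > 0" using c by (simp add: B_def)
  have A: "A > 0" using d B by (simp add: A_def add_pos_pos)
  have "(\<bar>Im z\<bar> + 3 * Re z) powr p \<le> A * Re z powr p - B * Re (z powr of_real p)" if z: "Re z > 0" for z
  proof -
    have z0: "z \<noteq> 0" using z by auto
    define r where "r = exp (Re (Ln z))"
    define s where "s = \<bar>Im (Ln z)\<bar>"
    have s: "0 \<le> s" "s < pi/2" using Re_Ln_pos_lt[OF z0] z by (auto simp: s_def)
    have r: "r > 0" by (simp add: r_def)
    have "cos (Im (Ln z)) = cos s" "cos (p * Im (Ln z)) = cos (p * s)"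
      using p by (auto simp: s_def abs_if)
    moreover have "z = exp (Ln z)" using z0 by simp
    then have "Re z = r * cos (Im (Ln z))" "Im z = r * sin (Im (Ln z))"
      by (metis Re_exp r_def, metis Im_exp r_def)
    ultimately have Rez: "Re z = r * cos s" and Imz: "\<bar>Im z\<bar> \<le> r"
      and "Re (z powr of_real p) = r powr p * cos (p * s)"
      using r z0 by (auto simp: abs_mult powr_def Re_exp powr_def r_def)
    note Rp = this(3)
    have cs: "0 < cos s" using z r Rez by (simp add: zero_less_mult_iff)
    have "(\<bar>Im z\<bar> + 3 * Re z) powr p \<le> (4 * r) powr p"
    proof (rule powr_mono2)
      have "Re z \<le> r" using Rez r by simp
      then show "\<bar>Im z\<bar> + 3 * Re z \<le> 4 * r" using Imz by simp
    qed (use p z in auto)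
    also have "\<dots> = r powr p * 4 powr p" using r by (simp add: powr_mult)
    also have "4 powr p \<le> A * cos s powr p - B * cos (p * s)"
    proof (cases "s \<ge> t")
      case True
      have "cos (p * s) \<le> cos (p * t)"
      proof (rule cos_monotone_0_pi_le)
        have "p * s \<le> 2 * s" using p s by (intro mult_right_mono) auto
        then show "p * s \<le> pi" using s by simp
      qed (use p t True in auto)
      then have "B * cos (p * s) \<le> B * (- c)" using B by (intro mult_left_mono) (auto simp: c_def)
      also have "\<dots> = - (4 powr p)" using c by (simp add: B_def)
      finally show ?thesis using A cs by (smt (verit) mult_nonneg_nonneg powr_ge_zero)
    next
      case False
      have "d \<le> cos s" unfolding d_def using False s t by (intro cos_monotone_0_pi_le) auto
      then have "A * d powr p \<le> A * cos s powr p" using A d p by (intro mult_left_mono powr_mono2) auto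
      moreover have "A * d powr p = 4 powr p + B" using d by (simp add: A_def)
      moreover have "B * cos (p * s) \<le> B" using B by simp
      ultimately show ?thesis by linarith
    qed
    then have "r powr p * 4 powr p \<le> r powr p * (A * cos s powr p - B * cos (p * s))"
      by (intro mult_left_mono) auto
    also have "\<dots> = A * Re z powr p - B * Re (z powr of_real p)"
      using Rp Rez r cs by (simp add: powr_mult algebra_simps)
    finally show ?thesis .
  qed
  then show ?thesis using A B that[of A B] by (simp add: less_imp_le)
qed

section \<open>Cauchy transforms of point masses on the integers\<close>

text \<open>The factor \<open>\<i>\<close> rotates the values into the right half-plane when
  \<open>f \<ge> 0\<close>, away from the branch cut of the power. Real and imaginary part are then
  sums of Poisson and conjugate Poisson kernels, up to the factor \<open>pi\<close>.\<close>

definition cauchy_sum :: "(int \<Rightarrow> real) \<Rightarrow> int set \<Rightarrow> complex \<Rightarrow> complex" where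
  "cauchy_sum f I z = \<i> * (\<Sum>m\<in>I. of_real (f m) / (z - of_int m))"

lemma Re_cauchy_sum: "Re (cauchy_sum f I (Complex x y)) = (\<Sum>m\<in>I. f m * (y / ((x - m)\<^sup>2 + y\<^sup>2)))"
  by (simp add: cauchy_sum_def Im_divide sum_negf[symmetric])

lemma Im_cauchy_sum: "Im (cauchy_sum f I (Complex x y)) = (\<Sum>m\<in>I. f m * ((x - m) / ((x - m)\<^sup>2 + y\<^sup>2)))"
  by (simp add: cauchy_sum_def Re_divide)

lemma cauchy_sum_holomorphic: "cauchy_sum f I holomorphic_on {z. Im z > 0}"
  unfolding cauchy_sum_def by (intro holomorphic_intros) auto

lemma Re_cauchy_sum_pos:
  assumes "finite I" "\<And>m. m \<in> I \<Longrightarrow> f m \<ge> 0" "m0 \<in> I" "f m0 > 0" "Im z > 0"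
  shows "Re (cauchy_sum f I z) > 0"
proof -
  obtain x y where z: "z = Complex x y" by (cases z)
  then have y: "y > 0" using assms by simp
  have pos: "(x - m)\<^sup>2 + y\<^sup>2 > 0" for m using y by (simp add: add_nonneg_pos)
  show ?thesis unfolding z Re_cauchy_sum
  proof (rule sum_pos2[OF assms(1,3)])
    show "0 < f m0 * (y / ((x - m0)\<^sup>2 + y\<^sup>2))" using assms y pos by simp
    show "0 \<le> f m * (y / ((x - m)\<^sup>2 + y\<^sup>2))" if "m \<in> I" for m
      using assms(2)[OF that] y pos[of m] by (intro mult_nonneg_nonneg divide_nonneg_nonneg) auto
  qed
qed

text \<open>The contour from \<open>-R + i\<close> to \<open>R + i\<close> is moved to the other three sides of a square of
  side \<open>2R\<close>, where the integrand is \<open>O(R powr -p)\<close>.\<close>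
lemma cauchy_sum_powr_integral_tendsto:
  assumes fin: "finite I" and f: "\<And>m. m \<in> I \<Longrightarrow> f m \<ge> 0" "m0 \<in> I" "f m0 > 0" and p: "p > 1"
  shows "((\<lambda>R. integral {-R..R} (\<lambda>x. Re (cauchy_sum f I (Complex x 1) powr of_real p))) \<longlongrightarrow> 0) at_top"
proof -
  define U where "U = {z. Im z > 0}"
  define F where "F = (\<lambda>z. cauchy_sum f I z powr of_real p)"
  have pos: "Re (cauchy_sum f I z) > 0" if "z \<in> U" for z
    using Re_cauchy_sum_pos[of I f m0 z] assms that by (auto simp: U_def)
  have U: "convex U" "open U"
    unfolding U_def by (auto intro: convex_halfspace_Im_gt open_halfspace_Im_gt)
  have "F holomorphic_on U" unfolding F_def
    by (intro holomorphic_intros cauchy_sum_holomorphic[folded U_def]) (use pos in \<open>force simp: complex_nonpos_Reals_iff\<close>)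
  \<comment> \<open>A primitive on the convex half-plane replaces Cauchy's theorem: the integral
    over the bottom side is a difference of \<open>G\<close> at two corners, and this is estimated
    along the other three sides by the mean value bound.\<close>
  then obtain G where G0: "\<And>z. z \<in> U \<Longrightarrow> (G has_field_derivative F z) (at z within U)"
    using holomorphic_convex_primitive'[of U F] U by metis
  then have G: "(G has_field_derivative F z) (at z)" if "z \<in> U" for z
    using that U by (simp add: at_within_open[of _ U])
  have int: "integral {-R..R} (\<lambda>x. Re (F (Complex x 1))) = Re (G (Complex R 1) - G (Complex (-R) 1))" if "R > 0" for R
  proof -
    have "((\<lambda>x. Re (F (Complex x 1))) has_integral (Re (G (Complex R 1)) - Re (G (Complex (-R) 1)))) {-R..R}"
    proof (rule fundamental_theorem_of_calculus)
      fix x assume "x \<in> {-R..R}"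
      have "((\<lambda>x. Complex x 1) has_vector_derivative 1) (at x within {-R..R})"
        by (auto intro!: derivative_eq_intros simp: Complex_eq)
      then have "((G \<circ> (\<lambda>x. Complex x 1)) has_vector_derivative 1 * F (Complex x 1)) (at x within {-R..R})"
        by (rule field_vector_diff_chain_within)
           (auto intro!: has_field_derivative_at_within[OF G] simp: U_def)
      then have "((\<lambda>x. G (Complex x 1)) has_vector_derivative F (Complex x 1)) (at x within {-R..R})"
        by (simp add: o_def)
      then show "((\<lambda>x. Re (G (Complex x 1))) has_vector_derivative Re (F (Complex x 1))) (at x within {-R..R})"
        by (simp add: has_real_derivative_iff_has_vector_derivative[symmetric] has_vector_derivative_complex_iff)
    qed (use that in auto)
    then show ?thesis by (simp add: integral_unique)
  qed
  obtain L where L: "L > 0" "\<And>m. m \<in> I \<Longrightarrow> \<bar>real_of_int m\<bar> \<le> L"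
  proof
    show "(\<Sum>m\<in>I. \<bar>real_of_int m\<bar>) + 1 > 0" by (smt (verit) sum_nonneg abs_ge_zero)
    show "\<bar>real_of_int m\<bar> \<le> (\<Sum>m\<in>I. \<bar>real_of_int m\<bar>) + 1" if "m \<in> I" for m
      using member_le_sum[of m I "\<lambda>m. \<bar>real_of_int m\<bar>"] fin that by auto
  qed
  define S where "S = (\<Sum>m\<in>I. f m)"
  have S: "S > 0" unfolding S_def using sum_pos2[of I m0 f] fin f by auto
  \<comment> \<open>For \<open>R \<ge> 2 * L\<close> every point of the three sides has distance at
    least \<open>R / 2\<close> from all nodes, so the transform is at most \<open>2 * S / R\<close>
    there. The sides have total length at most \<open>4 * R\<close>, which leaves
    \<open>R powr (1 - p)\<close>.\<close>
  define K where "K = (\<lambda>R. (2 * S / R) powr p)"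
  have Fb: "norm (F z) \<le> K R" if z: "z \<in> U" "\<bar>Re z\<bar> \<ge> R \<or> Im z \<ge> R" "R \<ge> 2 * L" for z R
  proof -
    have R: "R > 0" using that L by linarith
    have "norm (cauchy_sum f I z) \<le> (\<Sum>m\<in>I. norm (complex_of_real (f m) / (z - of_int m)))"
      unfolding cauchy_sum_def by (simp add: norm_mult norm_sum)
    also have "\<dots> \<le> (\<Sum>m\<in>I. f m * (2 / R))"
    proof (rule sum_mono)
      fix m assume m: "m \<in> I"
      have "norm (z - of_int m) \<ge> R / 2"
      proof (cases "\<bar>Re z\<bar> \<ge> R")
        case True
        have "\<bar>Re z - m\<bar> \<ge> R / 2" using True L(2)[OF m] z(3) R by linarith
        then show ?thesis using abs_Re_le_cmod[of "z - of_int m"] by simp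
      next
        case False
        then have "\<bar>Im z\<bar> \<ge> R / 2" using z R by auto
        then show ?thesis using abs_Im_le_cmod[of "z - of_int m"] by simp
      qed
      then have "f m / norm (z - of_int m) \<le> f m / (R / 2)"
        using f(1)[OF m] R by (intro divide_left_mono) (auto intro!: mult_pos_pos)
      then show "norm (complex_of_real (f m) / (z - of_int m)) \<le> f m * (2 / R)"
        using f(1)[OF m] by (simp add: norm_divide)
    qed
    also have "\<dots> = 2 * S / R" by (simp add: S_def sum_distrib_right sum_divide_distrib sum_distrib_left mult.commute)
    finally have le: "norm (cauchy_sum f I z) \<le> 2 * S / R" .
    have "norm (F z) = norm (cauchy_sum f I z) powr p"
      using pos[OF z(1)] unfolding F_def by (simp add: norm_powr_real_powr')
    also have "\<dots> \<le> K R" unfolding K_def using le p by (intro powr_mono2) auto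
    finally show ?thesis .
  qed
  have seg: "norm (G w - G z) \<le> K R * norm (w - z)"
    if "\<And>x. x \<in> closed_segment z w \<Longrightarrow> x \<in> U \<and> (\<bar>Re x\<bar> \<ge> R \<or> Im x \<ge> R)" "R \<ge> 2 * L" for z w R
    by (rule field_differentiable_bound[of "closed_segment z w" G F])
       (use that in \<open>auto intro!: Fb has_field_derivative_at_within[OF G]\<close>)
  have bound: "norm (integral {-R..R} (\<lambda>x. Re (F (Complex x 1)))) \<le> 4 * (2 * S) powr p * R powr (1 - p)"
    if R: "R \<ge> 2 * L" "R > 1" for R
  proof -
    have seg1: "norm (G (Complex (-R) R) - G (Complex (-R) 1)) \<le> K R * norm (Complex (-R) R - Complex (-R) 1)"
      by (rule seg) (use R in \<open>auto simp: U_def closed_segment_same_Re closed_segment_eq_real_ivl\<close>)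
    have seg2: "norm (G (Complex R R) - G (Complex (-R) R)) \<le> K R * norm (Complex R R - Complex (-R) R)"
      by (rule seg) (use R in \<open>auto simp: U_def closed_segment_same_Im closed_segment_eq_real_ivl\<close>)
    have seg3: "norm (G (Complex R 1) - G (Complex R R)) \<le> K R * norm (Complex R 1 - Complex R R)"
      by (rule seg) (use R in \<open>auto simp: U_def closed_segment_same_Re closed_segment_eq_real_ivl\<close>)
    have n1: "norm (Complex (-R) R - Complex (-R) 1) \<le> R" "norm (Complex R R - Complex (-R) R) \<le> 2*R"
      "norm (Complex R 1 - Complex R R) \<le> R"
      using R by (auto simp: cmod_def real_sqrt_mult)
    have K0: "K R \<ge> 0" by (simp add: K_def)
    have "norm (G (Complex R 1) - G (Complex (-R) 1)) \<le>
       norm (G (Complex (-R) R) - G (Complex (-R) 1)) + norm (G (Complex R R) - G (Complex (-R) R)) + norm (G (Complex R 1) - G (Complex R R))"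
      by (smt (verit) norm_triangle_ineq diff_add_cancel add_diff_eq add.commute)
    also have "\<dots> \<le> K R * R + K R * (2 * R) + K R * R"
      using seg1 seg2 seg3 mult_left_mono[OF n1(1) K0] mult_left_mono[OF n1(2) K0] mult_left_mono[OF n1(3) K0] by linarith
    also have "\<dots> = 4 * (2 * S) powr p * R powr (1 - p)"
      using R S L by (simp add: K_def powr_divide powr_diff)
    finally have "norm (G (Complex R 1) - G (Complex (-R) 1)) \<le> 4 * (2 * S) powr p * R powr (1 - p)" .
    then show ?thesis using int[of R] R abs_Re_le_cmod[of "G (Complex R 1) - G (Complex (-R) 1)"] by simp
  qed
  have "((\<lambda>R. 4 * (2 * S) powr p * R powr (1 - p)) \<longlongrightarrow> 4 * (2 * S) powr p * 0) at_top"
    using p by (intro tendsto_intros tendsto_neg_powr filterlim_ident) auto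
  then have "((\<lambda>R. 4 * (2 * S) powr p * R powr (1 - p)) \<longlongrightarrow> 0) at_top" by simp
  moreover have "\<forall>\<^sub>F R in at_top. norm (integral {-R..R} (\<lambda>x. Re (F (Complex x 1)))) \<le> 4 * (2 * S) powr p * R powr (1 - p)"
    using eventually_gt_at_top[of "max (2*L) 1"] by eventually_elim (rule bound; simp)
  ultimately show ?thesis
    unfolding F_def by (rule Lim_null_comparison[rotated])
qed

section \<open>From sums over integers to integrals at height 1\<close>

lemma integral_sum_unit_intervals:
  fixes h :: "real \<Rightarrow> real"
  assumes "continuous_on UNIV h"
  shows "integral {a..a + real N} h = (\<Sum>k<N. integral {a + real k..a + real k + 1} h)"
proof (induction N)
  case (Suc N)
  have "h integrable_on {a..a + real (Suc N)}"
    by (intro integrable_continuous_interval continuous_on_subset[OF assms]) auto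
  then have "integral {a..a + real N} h + integral {a + real N..a + real (Suc N)} h = integral {a..a + real (Suc N)} h"
    by (intro Henstock_Kurzweil_Integration.integral_combine) auto
  then show ?case using Suc by (simp add: add_ac)
qed simp

text \<open>Each term is at most three times the increment of \<open>arctan\<close> over the unit
  interval starting at \<open>m - x\<close>, and the increments telescope. The 3 pays for moving the
  argument inside that interval: \<open>1 + z^2 \<le> 3 * (1 + d^2)\<close> if \<open>z\<close> and
  \<open>- d\<close> differ by at most 1.\<close>

lemma sum_square_kernel_le:
  fixes x :: real
  assumes fin: "finite I"
  shows "(\<Sum>m\<in>I. 1 / ((x - of_int m)\<^sup>2 + 1)) \<le> 3 * pi"
proof -
  obtain L :: nat where L: "I \<subseteq> {- int L..<int L}"
  proof -
    have "bdd_above (abs ` I)" using fin by simp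
    then obtain B where "\<And>m. m \<in> I \<Longrightarrow> \<bar>m\<bar> \<le> B" by (auto simp: bdd_above_def)
    then have "I \<subseteq> {- int (nat B + 1)..<int (nat B + 1)}" by force
    then show ?thesis using that by blast
  qed
  have step: "1 / ((x - m)\<^sup>2 + 1) \<le> 3 * (arctan (m + 1 - x) - arctan (m - x))" for m :: real
  proof -
    have "\<exists>z. m - x < z \<and> z < m + 1 - x \<and> arctan (m + 1 - x) - arctan (m - x) = ((m + 1 - x) - (m - x)) * inverse (1 + z\<^sup>2)"
      by (rule MVT2) (auto intro!: derivative_eq_intros)
    then obtain z where z: "m - x < z" "z < m + 1 - x"
      and eq: "arctan (m + 1 - x) - arctan (m - x) = inverse (1 + z\<^sup>2)" by auto
    define d where "d = x - m"
    define e where "e = z + d"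
    have e1: "e\<^sup>2 \<le> 1" using z by (simp add: abs_square_le_1 e_def d_def)
    have "z\<^sup>2 = (e - d)\<^sup>2" by (simp add: e_def)
    also have "\<dots> \<le> 2 * e\<^sup>2 + 2 * d\<^sup>2" using zero_le_power2[of "e + d"] by (simp add: power2_eq_square algebra_simps)
    finally have "1 + z\<^sup>2 \<le> 3 * (d\<^sup>2 + 1)" using zero_le_power2[of d] e1 unfolding distrib_left by linarith
    then have "1 / (3 * (d\<^sup>2 + 1)) \<le> 1 / (1 + z\<^sup>2)" by (intro divide_left_mono mult_pos_pos) (auto simp: add_pos_nonneg add_nonneg_pos)
    then have "3 * (1 / (3 * (d\<^sup>2 + 1))) \<le> 3 * (1 / (1 + z\<^sup>2))" by (rule mult_left_mono) simp
    then show ?thesis by (simp add: eq d_def[symmetric] inverse_eq_divide del: distrib_left_numeral)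
  qed
  have "(\<Sum>m\<in>I. 1 / ((x - of_int m)\<^sup>2 + 1)) \<le> (\<Sum>m\<in>{- int L..<int L}. 1 / ((x - of_int m)\<^sup>2 + 1))"
    using L by (intro sum_mono2) auto
  also have "{- int L..<int L} = (\<lambda>k. int k - int L) ` {..<2 * L}"
  proof safe
    fix m assume "m \<in> {- int L..<int L}"
    then show "m \<in> (\<lambda>k. int k - int L) ` {..<2 * L}" by (intro image_eqI[of _ _ "nat (m + int L)"]) auto
  qed auto
  also have "(\<Sum>m\<in>(\<lambda>k. int k - int L) ` {..<2 * L}. 1 / ((x - of_int m)\<^sup>2 + 1))
      = (\<Sum>k<2*L. 1 / ((x - (real k - real L))\<^sup>2 + 1))"
    by (subst sum.reindex) (auto simp: inj_on_def)
  also have "\<dots> \<le> (\<Sum>k<2*L. 3 * (arctan (real (Suc k) - real L - x) - arctan (real k - real L - x)))"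
  proof (rule sum_mono)
    fix k
    show "1 / ((x - (real k - real L))\<^sup>2 + 1) \<le> 3 * (arctan (real (Suc k) - real L - x) - arctan (real k - real L - x))"
      using step[of "real k - real L"] by (simp add: algebra_simps)
  qed
  also have "\<dots> = 3 * (arctan (real (2*L) - real L - x) - arctan (real 0 - real L - x))"
    unfolding sum_distrib_left[symmetric] by (subst sum_lessThan_telescope) simp
  also have "\<dots> \<le> 3 * pi" using arctan_ubound[of "real (2*L) - real L - x"] arctan_lbound[of "real 0 - real L - x"]
    by simp
  finally show ?thesis .
qed

text \<open>For \<open>j = 0\<close> the first fraction is \<open>1 / 0 = 0\<close>, which is the convention for the diagonal of the
  Hilbert kernel throughout.\<close>
lemma hilbert_kernel_approx:
  fixes j :: int and t :: real
  assumes t: "0 \<le> t" "t \<le> 1"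
  shows "\<bar>1 / of_int j - (of_int j + t) / ((of_int j + t)\<^sup>2 + 1)\<bar> \<le> 3 / ((of_int j + t)\<^sup>2 + 1)"
proof (cases "j = 0")
  case True
  then show ?thesis using t by (auto simp: divide_simps add_nonneg_pos power2_eq_square)
next
  case False
  define D where "D = (of_int j + t)\<^sup>2 + (1::real)"
  have D: "D > 0" by (simp add: D_def add_nonneg_pos)
  have j1: "\<bar>of_int j :: real\<bar> \<ge> 1" using False by linarith
  have "1 / of_int j - (of_int j + t) / D = (D - of_int j * (of_int j + t)) / (of_int j * D)"
    using False D by (simp add: diff_frac_eq)
  also have "D - of_int j * (of_int j + t) = t * of_int j + t * t + 1"
    by (simp add: D_def power2_eq_square algebra_simps)
  finally have "\<bar>1 / of_int j - (of_int j + t) / D\<bar> = \<bar>t * of_int j + t * t + 1\<bar> / (\<bar>of_int j\<bar> * D)"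
    using D by (simp add: abs_mult)
  also have "\<bar>t * of_int j + t * t + 1\<bar> \<le> 3 * \<bar>of_int j :: real\<bar>"
  proof -
    have "\<bar>t * of_int j\<bar> \<le> \<bar>of_int j\<bar>" using t by (simp add: abs_mult mult_left_le_one_le)
    moreover have "t * t \<le> 1" "0 \<le> t * t" using t by (auto simp: mult_le_one)
    ultimately show ?thesis using j1 by linarith
  qed
  then have "\<bar>t * of_int j + t * t + 1\<bar> / (\<bar>of_int j\<bar> * D) \<le> 3 * \<bar>of_int j\<bar> / (\<bar>of_int j\<bar> * D)"
    using D by (intro divide_right_mono) auto
  also have "\<dots> = 3 / D" using j1 by simp
  finally show ?thesis by (simp add: D_def)
qed

text \<open>The kernel \<open>1 / (n - m)\<close> differs from the conjugate Poisson kernel at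
  height 1 by at most three Poisson kernels. As this holds at every \<open>x\<close> of a unit
  interval, a sum over \<open>n\<close> of powers of the left side is bounded by an integral over
  \<open>x\<close>.\<close>

lemma hilbert_sum_le_cauchy_sum:
  fixes n :: int
  assumes f: "\<And>m. m \<in> I \<Longrightarrow> f m \<ge> 0" and x: "of_int n \<le> x" "x \<le> of_int n + 1"
  shows "\<bar>\<Sum>m\<in>I. f m / of_int (n - m)\<bar>
         \<le> \<bar>Im (cauchy_sum f I (Complex x 1))\<bar> + 3 * Re (cauchy_sum f I (Complex x 1))"
proof -
  have "\<bar>(\<Sum>m\<in>I. f m / of_int (n - m)) - Im (cauchy_sum f I (Complex x 1))\<bar>
      = \<bar>\<Sum>m\<in>I. f m * (1 / of_int (n - m) - (x - m) / ((x - m)\<^sup>2 + 1))\<bar>"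
    by (simp add: Im_cauchy_sum sum_subtractf right_diff_distrib)
  also have "\<dots> \<le> (\<Sum>m\<in>I. f m * (3 / ((x - m)\<^sup>2 + 1)))"
  proof (rule order.trans[OF sum_abs sum_mono])
    fix m assume m: "m \<in> I"
    have "\<bar>1 / of_int (n - m) - (x - m) / ((x - m)\<^sup>2 + 1)\<bar> \<le> 3 / ((x - m)\<^sup>2 + 1)"
      using hilbert_kernel_approx[of "x - n" "n - m"] x by simp
    then show "\<bar>f m * (1 / of_int (n - m) - (x - m) / ((x - m)\<^sup>2 + 1))\<bar> \<le> f m * (3 / ((x - m)\<^sup>2 + 1))"
      unfolding abs_mult abs_of_nonneg[OF f[OF m]] by (rule mult_left_mono[OF _ f[OF m]])
  qed
  also have "\<dots> = 3 * Re (cauchy_sum f I (Complex x 1))"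
    by (simp add: Re_cauchy_sum sum_distrib_left mult_ac)
  finally show ?thesis by linarith
qed

lemma integral_square_kernel_le:
  fixes R c :: real
  assumes "R \<ge> 0"
  shows "integral {-R..R} (\<lambda>x. 1 / ((x - c)\<^sup>2 + 1)) \<le> pi"
proof -
  have "((\<lambda>x. 1 / ((x - c)\<^sup>2 + 1)) has_integral (arctan (R - c) - arctan (-R - c))) {-R..R}"
    using assms by (intro fundamental_theorem_of_calculus)
      (auto intro!: derivative_eq_intros simp: has_real_derivative_iff_has_vector_derivative[symmetric] divide_simps add_ac)
  then show ?thesis using arctan_ubound[of "R - c"] arctan_lbound[of "-R - c"] by (simp add: integral_unique)
qed

text \<open>Schur's test: the kernel is positive, its sums over \<open>m\<close> are at most
  \<open>3 * pi\<close> and its integrals over \<open>x\<close> at most \<open>pi\<close>. The bound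
  does not depend on \<open>R\<close>, so it survives the limit taken afterwards.\<close>

lemma integral_poisson_powr_le:
  assumes fin: "finite I" and f: "\<And>m. m \<in> I \<Longrightarrow> f m \<ge> 0" and p: "p > 1" and R: "R \<ge> (0::real)"
  shows "integral {-R..R} (\<lambda>x. Re (cauchy_sum f I (Complex x 1)) powr p)
         \<le> (3 * pi) powr (p - 1) * pi * (\<Sum>m\<in>I. f m powr p)"
proof -
  have cont: "continuous_on S (\<lambda>x. 1 / ((x - c)\<^sup>2 + 1))" for S and c :: real
    by (intro continuous_intros) (simp add: add_nonneg_eq_0_iff)
  have nn: "Re (cauchy_sum f I (Complex x 1)) \<ge> 0" for x
    unfolding Re_cauchy_sum using f by (intro sum_nonneg mult_nonneg_nonneg) (auto simp: add_nonneg_pos)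
  have "integral {-R..R} (\<lambda>x. Re (cauchy_sum f I (Complex x 1)) powr p)
      \<le> integral {-R..R} (\<lambda>x. \<Sum>m\<in>I. ((3 * pi) powr (p - 1) * f m powr p) * (1 / ((x - m)\<^sup>2 + 1)))"
  proof (rule integral_le)
    show "(\<lambda>x. Re (cauchy_sum f I (Complex x 1)) powr p) integrable_on {-R..R}"
    proof (rule integrable_continuous_interval, rule continuous_on_powr'[OF _ continuous_on_const])
      show "continuous_on {-R..R} (\<lambda>x. Re (cauchy_sum f I (Complex x 1)))"
        unfolding Re_cauchy_sum by (intro continuous_intros) (auto simp: add_nonneg_eq_0_iff)
    qed (use nn p in auto)
    show "(\<lambda>x. \<Sum>m\<in>I. ((3 * pi) powr (p - 1) * f m powr p) * (1 / ((x - m)\<^sup>2 + 1))) integrable_on {-R..R}"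
      by (intro integrable_continuous_interval continuous_on_sum continuous_on_mult cont continuous_on_const)
    fix x :: real
    have "Re (cauchy_sum f I (Complex x 1)) powr p = (\<Sum>m\<in>I. 1 / ((x - m)\<^sup>2 + 1) * f m) powr p"
      by (simp add: Re_cauchy_sum mult.commute)
    also have "\<dots> \<le> (\<Sum>m\<in>I. 1 / ((x - m)\<^sup>2 + 1)) powr (p - 1) * (\<Sum>m\<in>I. 1 / ((x - m)\<^sup>2 + 1) * f m powr p)"
      by (intro powr_sum_weighted p f) auto
    also have "\<dots> \<le> (3 * pi) powr (p - 1) * (\<Sum>m\<in>I. 1 / ((x - m)\<^sup>2 + 1) * f m powr p)"
      using p by (intro mult_right_mono powr_mono2 sum_square_kernel_le fin sum_nonneg) auto
    finally show "Re (cauchy_sum f I (Complex x 1)) powr p \<le> (\<Sum>m\<in>I. ((3 * pi) powr (p - 1) * f m powr p) * (1 / ((x - m)\<^sup>2 + 1)))"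
      by (simp add: sum_distrib_left mult_ac)
  qed
  also have "\<dots> = (\<Sum>m\<in>I. ((3 * pi) powr (p - 1) * f m powr p) * integral {-R..R} (\<lambda>x. 1 / ((x - m)\<^sup>2 + 1)))"
  proof -
    have "integral {-R..R} (\<lambda>x. ((3 * pi) powr (p - 1) * f m powr p) * (1 / ((x - m)\<^sup>2 + 1)))
        = ((3 * pi) powr (p - 1) * f m powr p) * integral {-R..R} (\<lambda>x. 1 / ((x - m)\<^sup>2 + 1))" for m
      by (rule integral_mult_right)
    then show ?thesis
      by (subst integral_sum[OF fin]) (auto intro!: integrable_continuous_interval continuous_intros simp: add_nonneg_eq_0_iff)
  qed
  also have "\<dots> \<le> (\<Sum>m\<in>I. ((3 * pi) powr (p - 1) * f m powr p) * pi)"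
    by (intro sum_mono mult_left_mono integral_square_kernel_le R) auto
  also have "\<dots> = (3 * pi) powr (p - 1) * pi * (\<Sum>m\<in>I. f m powr p)"
    by (simp add: sum_distrib_left sum_distrib_right mult_ac)
  finally show ?thesis .
qed

text \<open>Integrate \<open>riesz_pointwise\<close>, applied to the Cauchy transform at height 1,
  over \<open>[-R, R]\<close>. The term with \<open>A\<close> is controlled by the Poisson estimate,
  and the term with \<open>B\<close> disappears as \<open>R\<close> tends to infinity by
  \<open>cauchy_sum_powr_integral_tendsto\<close>.\<close>

lemma hilbert_sum_nonneg_bound:
  assumes p: "1 < p" "p \<le> 2"
  obtains C :: real where "C \<ge> 0" "\<And>I J f. finite I \<Longrightarrow> finite J \<Longrightarrow> (\<And>m. m \<in> I \<Longrightarrow> f m \<ge> 0) \<Longrightarrow>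
    (\<Sum>n\<in>J. \<bar>\<Sum>m\<in>I. f m / of_int (n - m)\<bar> powr p) \<le> C * (\<Sum>m\<in>I. f m powr p)"
proof -
  obtain A B where AB: "A \<ge> 0" "B \<ge> 0"
    "\<And>z. Re z > 0 \<Longrightarrow> (\<bar>Im z\<bar> + 3 * Re z) powr p \<le> A * Re z powr p - B * Re (z powr of_real p)"
    using riesz_pointwise[OF p] by blast
  define C where "C = A * ((3 * pi) powr (p - 1) * pi)"
  have C: "C \<ge> 0" using AB by (simp add: C_def)
  have "(\<Sum>n\<in>J. \<bar>\<Sum>m\<in>I. f m / of_int (n - m)\<bar> powr p) \<le> C * (\<Sum>m\<in>I. f m powr p)"
    if fin: "finite I" "finite J" and f: "\<And>m. m \<in> I \<Longrightarrow> f m \<ge> 0" for I J :: "int set" and f :: "int \<Rightarrow> real"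
  proof (cases "\<exists>m0\<in>I. f m0 > 0")
    case False
    then have "f m = 0" if "m \<in> I" for m using f[OF that] that by force
    then show ?thesis using p by simp
  next
    case True
    then obtain m0 where m0: "m0 \<in> I" "f m0 > 0" by auto
    let ?z = "\<lambda>x. cauchy_sum f I (Complex x 1)"
    have pos: "Re (?z x) > 0" for x using Re_cauchy_sum_pos[of I f m0 "Complex x 1"] fin f m0 by auto
    define h where "h = (\<lambda>x. A * Re (?z x) powr p - B * Re (?z x powr of_real p))"
    have contz: "continuous_on S ?z" for S
    proof -
      have "continuous_on S (cauchy_sum f I \<circ> (\<lambda>x. Complex x 1))"
      proof (rule continuous_on_compose)
        show "continuous_on S (\<lambda>x. Complex x 1)" by (auto simp: Complex_eq intro!: continuous_intros)
        show "continuous_on ((\<lambda>x. Complex x 1) ` S) (cauchy_sum f I)"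
          by (rule continuous_on_subset[OF holomorphic_on_imp_continuous_on[OF cauchy_sum_holomorphic]]) auto
      qed
      then show ?thesis by (simp add: o_def)
    qed
    have contp: "continuous_on S (\<lambda>x. Re (?z x powr of_real p))" for S
    proof -
      have "continuous_on S (\<lambda>x. ?z x powr of_real p)"
      proof (rule continuous_on_powr_complex[OF _ _ contz continuous_on_const])
        show "S \<subseteq> {x. Re (?z x) \<ge> 0 \<or> Im (?z x) \<noteq> 0}" using pos by (auto simp: less_imp_le)
        show "\<And>x. x \<in> S \<Longrightarrow> ?z x = 0 \<Longrightarrow> Re (complex_of_real p) > 0" using p by simp
      qed
      then show ?thesis by (rule continuous_on_Re)
    qed
    have contR: "continuous_on S (\<lambda>x. Re (?z x) powr p)" for S
    proof (rule continuous_on_powr'[OF _ continuous_on_const])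
      show "continuous_on S (\<lambda>x. Re (?z x))" by (intro continuous_intros contz)
    qed (simp add: less_imp_le[OF pos] p(1) order.strict_trans[OF zero_less_one p(1)])
    have conth: "continuous_on S h" for S
      unfolding h_def by (intro continuous_intros contp contR)
    have h: "(\<bar>Im (?z x)\<bar> + 3 * Re (?z x)) powr p \<le> h x" for x unfolding h_def by (intro AB pos)
    have h0: "0 \<le> h x" for x using h[of x] by (rule order.trans[rotated]) simp
    have Hn: "\<bar>\<Sum>m\<in>I. f m / of_int (n - m)\<bar> powr p \<le> integral {of_int n..of_int n + 1} h" for n
    proof -
      have "\<bar>\<Sum>m\<in>I. f m / of_int (n - m)\<bar> powr p \<le> h x" if "x \<in> {of_int n..of_int n + 1}" for x
      proof -
        have "\<bar>\<Sum>m\<in>I. f m / of_int (n - m)\<bar> powr p \<le> (\<bar>Im (?z x)\<bar> + 3 * Re (?z x)) powr p"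
          using that p by (intro powr_mono2 hilbert_sum_le_cauchy_sum f) auto
        then show ?thesis using h[of x] by linarith
      qed
      then have "integral {of_int n..of_int n + 1} (\<lambda>x::real. \<bar>\<Sum>m\<in>I. f m / of_int (n - m)\<bar> powr p) \<le> integral {of_int n..of_int n + 1} h"
        by (intro integral_le integrable_continuous_interval conth continuous_on_const)
      then show ?thesis by simp
    qed
    have "\<forall>\<^sub>F R in at_top. (\<Sum>n\<in>J. \<bar>\<Sum>m\<in>I. f m / of_int (n - m)\<bar> powr p) \<le> 
       C * (\<Sum>m\<in>I. f m powr p) - B * integral {-real R..real R} (\<lambda>x. Re (?z x powr of_real p))"
    proof -
      have "bdd_above (abs ` J)" using fin by simp
      then obtain N where N: "\<And>m. m \<in> J \<Longrightarrow> \<bar>m\<bar> \<le> N" by (auto simp: bdd_above_def)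
      show ?thesis
      proof (rule eventually_mono[OF eventually_gt_at_top[of "nat N"]])
        fix R assume R: "nat N < R"
        let ?g = "\<lambda>n::int. integral {of_int n..of_int n + 1} h"
        have "(\<Sum>n\<in>J. \<bar>\<Sum>m\<in>I. f m / of_int (n - m)\<bar> powr p) \<le> (\<Sum>n\<in>J. ?g n)"
          by (intro sum_mono Hn)
        also have "\<dots> \<le> (\<Sum>n\<in>(\<lambda>k. int k - int R) ` {..<2 * R}. ?g n)"
        proof (rule sum_mono2)
          show "J \<subseteq> (\<lambda>k. int k - int R) ` {..<2 * R}"
          proof
            fix m assume "m \<in> J"
            then show "m \<in> (\<lambda>k. int k - int R) ` {..<2 * R}"
              using N[of m] R by (intro image_eqI[of _ _ "nat (m + int R)"]) auto
          qed
        qed (auto intro: integral_nonneg integrable_continuous_interval[OF conth] simp: h0)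
        also have "\<dots> = (\<Sum>k<2 * R. integral {- real R + real k..- real R + real k + 1} h)"
          by (subst sum.reindex) (auto simp: inj_on_def algebra_simps)
        also have "\<dots> = integral {- real R..- real R + real (2 * R)} h"
          by (rule integral_sum_unit_intervals[symmetric, OF conth])
        also have "\<dots> = A * integral {- real R..real R} (\<lambda>x. Re (?z x) powr p)
            - B * integral {-real R..real R} (\<lambda>x. Re (?z x powr of_real p))"
        proof -
          have "integral {- real R..real R} h = integral {- real R..real R} (\<lambda>x. A * Re (?z x) powr p)
            - integral {-real R..real R} (\<lambda>x. B * Re (?z x powr of_real p))"
            unfolding h_def
            by (intro integral_diff integrable_continuous_interval continuous_on_mult continuous_on_const contR contp)
          then show ?thesis by simp
        qed
        also have "A * integral {- real R..real R} (\<lambda>x. Re (?z x) powr p) \<le> A * ((3 * pi) powr (p - 1) * pi * (\<Sum>m\<in>I. f m powr p))"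
          using AB fin f p by (intro mult_left_mono integral_poisson_powr_le) auto
        finally show "(\<Sum>n\<in>J. \<bar>\<Sum>m\<in>I. f m / of_int (n - m)\<bar> powr p) \<le> 
            C * (\<Sum>m\<in>I. f m powr p) - B * integral {-real R..real R} (\<lambda>x. Re (?z x powr of_real p))"
          by (simp add: C_def mult_ac)
      qed
    qed
    moreover have "(\<lambda>R. C * (\<Sum>m\<in>I. f m powr p) - B * integral {-real R..real R} (\<lambda>x. Re (?z x powr of_real p)))
       \<longlonglongrightarrow> C * (\<Sum>m\<in>I. f m powr p) - B * 0"
      using filterlim_compose[OF cauchy_sum_powr_integral_tendsto[of I f m0 p, OF fin(1) f m0 p(1)] filterlim_real_sequentially]
      by (intro tendsto_intros)
    ultimately show ?thesis using tendsto_lowerbound[of _ _ sequentially "(\<Sum>n\<in>J. \<bar>\<Sum>m\<in>I. f m / of_int (n - m)\<bar> powr p)"] by simp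
  qed
  then show ?thesis using C that[of C] by blast
qed

section \<open>Arbitrary signs and all exponents above 1\<close>

lemma abs_add_powr_le:
  fixes a b p :: real
  assumes "p \<ge> 0"
  shows "\<bar>a + b\<bar> powr p \<le> 2 powr p * (\<bar>a\<bar> powr p + \<bar>b\<bar> powr p)"
proof -
  have "\<bar>a + b\<bar> powr p \<le> (2 * max \<bar>a\<bar> \<bar>b\<bar>) powr p" using assms by (intro powr_mono2) auto
  also have "\<dots> = 2 powr p * max \<bar>a\<bar> \<bar>b\<bar> powr p" by (simp add: powr_mult)
  also have "\<dots> \<le> 2 powr p * (\<bar>a\<bar> powr p + \<bar>b\<bar> powr p)" by (intro mult_left_mono) (auto simp: max_def)
  finally show ?thesis .
qed

text \<open>Signs are removed by splitting \<open>f\<close> into positive and negative part, both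
  dominated by its absolute value. The bilinear form is the version in which \<open>p\<close> and
  \<open>q\<close> can be exchanged.\<close>

lemma hilbert_bilinear_bound_le2:
  assumes p: "1 < p" "p \<le> 2" and q: "q > 1" "1/p + 1/q = 1"
  obtains C :: real where "C \<ge> 0" "\<And>I J f g. finite I \<Longrightarrow> finite J \<Longrightarrow>
    \<bar>\<Sum>n\<in>J. \<Sum>m\<in>I. f m * g n / of_int (n - m)\<bar>
    \<le> C * (\<Sum>m\<in>I. \<bar>f m\<bar> powr p) powr (1/p) * (\<Sum>n\<in>J. \<bar>g n\<bar> powr q) powr (1/q)"
proof -
  obtain C :: real where C: "C \<ge> 0" "\<And>I J f. finite I \<Longrightarrow> finite J \<Longrightarrow> (\<And>m. m \<in> I \<Longrightarrow> f m \<ge> 0) \<Longrightarrow>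
    (\<Sum>n\<in>J. \<bar>\<Sum>m\<in>I. f m / of_int (n - m)\<bar> powr p) \<le> C * (\<Sum>m\<in>I. f m powr p)"
    using hilbert_sum_nonneg_bound[OF p] by blast
  define D where "D = 2 powr p * (2 * C)"
  have D: "D \<ge> 0" using C by (simp add: D_def)
  have op: "(\<Sum>n\<in>J. \<bar>\<Sum>m\<in>I. f m / of_int (n - m)\<bar> powr p) \<le> D * (\<Sum>m\<in>I. \<bar>f m\<bar> powr p)"
    if fin: "finite I" "finite J" for I J :: "int set" and f
  proof -
    let ?H = "\<lambda>f n. \<Sum>m\<in>I. f m / of_int (n - m)"
    define u v where "u = (\<lambda>m. max (f m) 0)" and "v = (\<lambda>m. max (- f m) 0)"
    have uv: "f m = u m - v m" "u m \<ge> 0" "v m \<ge> 0" "u m powr p \<le> \<bar>f m\<bar> powr p" "v m powr p \<le> \<bar>f m\<bar> powr p" for m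
      using p by (auto simp: u_def v_def max_def intro!: powr_mono2)
    have "\<bar>?H f n\<bar> powr p \<le> 2 powr p * (\<bar>?H u n\<bar> powr p + \<bar>?H v n\<bar> powr p)" for n
    proof -
      have "?H f n = ?H u n + - ?H v n" by (simp add: uv(1) diff_divide_distrib sum_subtractf)
      then show ?thesis using abs_add_powr_le[of p "?H u n" "- ?H v n"] p by simp
    qed
    then have "(\<Sum>n\<in>J. \<bar>?H f n\<bar> powr p) \<le> (\<Sum>n\<in>J. 2 powr p * (\<bar>?H u n\<bar> powr p + \<bar>?H v n\<bar> powr p))"
      by (rule sum_mono)
    also have "\<dots> = 2 powr p * ((\<Sum>n\<in>J. \<bar>?H u n\<bar> powr p) + (\<Sum>n\<in>J. \<bar>?H v n\<bar> powr p))"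
      by (simp add: sum_distrib_left sum.distrib distrib_left)
    also have "\<dots> \<le> 2 powr p * (C * (\<Sum>m\<in>I. u m powr p) + C * (\<Sum>m\<in>I. v m powr p))"
      using C(2)[OF fin] uv by (intro mult_left_mono add_mono) auto
    also have "\<dots> \<le> 2 powr p * (C * (\<Sum>m\<in>I. \<bar>f m\<bar> powr p) + C * (\<Sum>m\<in>I. \<bar>f m\<bar> powr p))"
      using C uv by (intro mult_left_mono add_mono sum_mono) auto
    also have "\<dots> = D * (\<Sum>m\<in>I. \<bar>f m\<bar> powr p)" by (simp add: D_def)
    finally show ?thesis .
  qed
  have "\<bar>\<Sum>n\<in>J. \<Sum>m\<in>I. f m * g n / of_int (n - m)\<bar>
    \<le> D powr (1/p) * (\<Sum>m\<in>I. \<bar>f m\<bar> powr p) powr (1/p) * (\<Sum>n\<in>J. \<bar>g n\<bar> powr q) powr (1/q)"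
    if fin: "finite I" "finite J" for I J :: "int set" and f g
  proof -
    have "\<bar>\<Sum>n\<in>J. \<Sum>m\<in>I. f m * g n / of_int (n - m)\<bar> = \<bar>\<Sum>n\<in>J. (\<Sum>m\<in>I. f m / of_int (n - m)) * g n\<bar>"
      by (simp add: sum_distrib_right)
    also have "\<dots> \<le> (\<Sum>n\<in>J. \<bar>(\<Sum>m\<in>I. f m / of_int (n - m)) * g n\<bar>)" by (rule sum_abs)
    also have "\<dots> \<le> (\<Sum>n\<in>J. \<bar>\<Sum>m\<in>I. f m / of_int (n - m)\<bar> powr p) powr (1/p) * (\<Sum>n\<in>J. \<bar>g n\<bar> powr q) powr (1/q)"
      using p q by (intro Holder_sum) auto
    also have "\<dots> \<le> (D * (\<Sum>m\<in>I. \<bar>f m\<bar> powr p)) powr (1/p) * (\<Sum>n\<in>J. \<bar>g n\<bar> powr q) powr (1/q)"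
      using op[OF fin, of f] p by (intro mult_right_mono powr_mono2) (auto intro!: sum_nonneg)
    finally show ?thesis using D by (simp add: powr_mult sum_nonneg)
  qed
  then show ?thesis using that[of "D powr (1/p)"] by auto
qed

text \<open>The kernel is antisymmetric: exchanging \<open>f\<close> and \<open>g\<close> only
  changes the sign of the form and replaces \<open>p\<close> by its conjugate, and of two conjugate
  exponents one is at most 2.\<close>

lemma hilbert_bilinear_bound:
  assumes p: "1 < p" and q: "q > 1" "1/p + 1/q = 1"
  obtains C :: real where "C \<ge> 0" "\<And>I J f g. finite I \<Longrightarrow> finite J \<Longrightarrow>
    \<bar>\<Sum>n\<in>J. \<Sum>m\<in>I. f m * g n / of_int (n - m)\<bar>
    \<le> C * (\<Sum>m\<in>I. \<bar>f m\<bar> powr p) powr (1/p) * (\<Sum>n\<in>J. \<bar>g n\<bar> powr q) powr (1/q)"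
proof (cases "p \<le> 2")
  case True
  then show ?thesis using hilbert_bilinear_bound_le2[of p q] p q that by blast
next
  case False
  then have "1/p < 1/2" using p by (simp add: field_simps)
  then have "1/q > 1/2" using q by linarith
  then have q2: "q \<le> 2" using q by (simp add: field_simps)
  have qp: "1/q + 1/p = 1" using q by simp
  obtain C where C: "C \<ge> 0" "\<And>I J f g. finite I \<Longrightarrow> finite J \<Longrightarrow>
    \<bar>\<Sum>n\<in>J. \<Sum>m\<in>I. f m * g n / of_int (n - m)\<bar>
    \<le> C * (\<Sum>m\<in>I. \<bar>f m\<bar> powr q) powr (1/q) * (\<Sum>n\<in>J. \<bar>g n\<bar> powr p) powr (1/p)"
    using hilbert_bilinear_bound_le2[OF q(1) q2 p qp] by blast
  have "\<bar>\<Sum>n\<in>J. \<Sum>m\<in>I. f m * g n / of_int (n - m)\<bar>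
    \<le> C * (\<Sum>m\<in>I. \<bar>f m\<bar> powr p) powr (1/p) * (\<Sum>n\<in>J. \<bar>g n\<bar> powr q) powr (1/q)"
    if fin: "finite I" "finite J" for I J :: "int set" and f g
  proof -
    have "(\<Sum>n\<in>J. \<Sum>m\<in>I. f m * g n / of_int (n - m)) = (\<Sum>m\<in>I. \<Sum>n\<in>J. f m * g n / of_int (n - m))"
      by (rule sum.swap)
    also have "\<dots> = - (\<Sum>m\<in>I. \<Sum>n\<in>J. g n * f m / of_int (m - n))"
      unfolding sum_negf[symmetric]
    proof (intro sum.cong refl)
      fix m n :: int
      have "(of_int (n - m) :: real) = - of_int (m - n)" by simp
      then show "f m * g n / of_int (n - m) = - (g n * f m / of_int (m - n))"
        by (simp only: divide_minus_right) simp
    qed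
    finally show ?thesis using C(2)[OF fin(2,1), of g f] by (simp add: mult_ac)
  qed
  then show ?thesis using that[of C] C(1) by auto
qed

lemma hilbert_operator_bound:
  assumes p: "1 < p"
  obtains C :: real where "C \<ge> 0" "\<And>I J f. finite I \<Longrightarrow> finite J \<Longrightarrow>
    (\<Sum>n\<in>J. \<bar>\<Sum>m\<in>I. f m / of_int (n - m)\<bar> powr p) \<le> C * (\<Sum>m\<in>I. \<bar>f m\<bar> powr p)"
proof -
  define q where "q = p / (p - 1)"
  have q: "q > 1" "1/p + 1/q = 1" "(p - 1) * q = p" using p by (auto simp: q_def field_simps)
  obtain C where C: "C \<ge> 0" "\<And>I J f g. finite I \<Longrightarrow> finite J \<Longrightarrow>
    \<bar>\<Sum>n\<in>J. \<Sum>m\<in>I. f m * g n / of_int (n - m)\<bar>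
    \<le> C * (\<Sum>m\<in>I. \<bar>f m\<bar> powr p) powr (1/p) * (\<Sum>n\<in>J. \<bar>g n\<bar> powr q) powr (1/q)"
    using hilbert_bilinear_bound[OF p q(1,2)] by blast
  have "(\<Sum>n\<in>J. \<bar>\<Sum>m\<in>I. f m / of_int (n - m)\<bar> powr p) \<le> C powr p * (\<Sum>m\<in>I. \<bar>f m\<bar> powr p)"
    if fin: "finite I" "finite J" for I J :: "int set" and f
  proof -
    define h where "h = (\<lambda>n. \<Sum>m\<in>I. f m / of_int (n - m))"
    \<comment> \<open>The extremal function of Hoelder's inequality: \<open>h * g\<close> and
      \<open>\<bar>g\<bar> powr q\<close> both equal \<open>\<bar>h\<bar> powr p\<close>, so the
      form returns the quantity to be bounded.\<close>
    define g where "g = (\<lambda>n. sgn (h n) * \<bar>h n\<bar> powr (p - 1))"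
    define X where "X = (\<Sum>n\<in>J. \<bar>h n\<bar> powr p)"
    define F where "F = (\<Sum>m\<in>I. \<bar>f m\<bar> powr p)"
    have X0: "X \<ge> 0" and F0: "F \<ge> 0" unfolding X_def F_def by (auto intro!: sum_nonneg)
    have hg: "h n * g n = \<bar>h n\<bar> powr p" for n
    proof -
      have "h n * g n = \<bar>h n\<bar> powr 1 * \<bar>h n\<bar> powr (p - 1)"
        by (cases "h n" "0::real" rule: linorder_cases) (simp_all add: g_def)
      also have "\<dots> = \<bar>h n\<bar> powr p" by (simp add: powr_mult_base)
      finally show ?thesis .
    qed
    have gq: "\<bar>g n\<bar> powr q = \<bar>h n\<bar> powr p" for n
      using p q by (cases "h n = 0") (auto simp: g_def abs_mult abs_sgn_eq powr_powr)
    have "X = (\<Sum>n\<in>J. \<Sum>m\<in>I. f m * g n / of_int (n - m))"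
      unfolding X_def hg[symmetric] by (simp add: h_def sum_distrib_right)
    also have "\<dots> \<le> C * F powr (1/p) * X powr (1/q)"
      unfolding X_def F_def gq[symmetric] by (rule order.trans[OF abs_ge_self C(2)[OF fin]])
    finally have le: "X \<le> C * F powr (1/p) * X powr (1/q)" .
    have "X \<le> C powr p * F"
    proof (cases "X = 0")
      case False
      \<comment> \<open>\<open>X\<close> is a finite sum, so dividing by \<open>X powr (1/q)\<close>
        is legitimate and leaves \<open>X powr (1/p)\<close>.\<close>
      then have X: "X > 0" using X0 by simp
      have "1/p = 1 - 1/q" using q by linarith
      then have "X powr (1/p) = X / X powr (1/q)" using X by (simp add: powr_diff)
      also have "\<dots> \<le> C * F powr (1/p)" using le X by (simp add: field_simps)
      finally have "(X powr (1/p)) powr p \<le> (C * F powr (1/p)) powr p" using p by (intro powr_mono2) auto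
      moreover have "(X powr (1/p)) powr p = X" using p X0 by (simp add: powr_powr)
      moreover have "(C * F powr (1/p)) powr p = C powr p * F" using p F0 by (simp add: powr_mult powr_powr)
      ultimately show ?thesis by linarith
    qed (use F0 in simp)
    then show ?thesis by (simp add: X_def F_def h_def)
  qed
  then show ?thesis using that[of "C powr p"] by auto
qed

section \<open>Kernels bounded on finite sections\<close>

text \<open>Only finite sections occur, so no question of convergence arises until
  \<open>lp_bounded_in_lp\<close>. In \<open>k m n\<close> the index \<open>m\<close> is the one
  summed over, and \<open>C\<close> is the \<open>p\<close>-th power of an operator bound.\<close>

definition lp_bounded :: "real \<Rightarrow> real \<Rightarrow> (nat \<Rightarrow> nat \<Rightarrow> real) \<Rightarrow> bool" where
  "lp_bounded p C k \<longleftrightarrow> (\<forall>f L M. (\<Sum>n<L. \<bar>\<Sum>m<M. f m * k m n\<bar> powr p) \<le> C * (\<Sum>m<M. \<bar>f m\<bar> powr p))"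

lemma lp_boundedD: "lp_bounded p C k \<Longrightarrow> (\<Sum>n<L. \<bar>\<Sum>m<M. f m * k m n\<bar> powr p) \<le> C * (\<Sum>m<M. \<bar>f m\<bar> powr p)"
  by (simp add: lp_bounded_def)

lemma lp_bounded_add:
  assumes "lp_bounded p C k" "lp_bounded p D l" "p \<ge> 0"
  shows "lp_bounded p (2 powr p * (C + D)) (\<lambda>m n. k m n + l m n)"
  unfolding lp_bounded_def
proof safe
  fix f :: "nat \<Rightarrow> real" and L M
  have "(\<Sum>n<L. \<bar>\<Sum>m<M. f m * (k m n + l m n)\<bar> powr p) \<le>
     (\<Sum>n<L. 2 powr p * (\<bar>\<Sum>m<M. f m * k m n\<bar> powr p + \<bar>\<Sum>m<M. f m * l m n\<bar> powr p))"
  proof (rule sum_mono)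
    fix n
    have "(\<Sum>m<M. f m * (k m n + l m n)) = (\<Sum>m<M. f m * k m n) + (\<Sum>m<M. f m * l m n)"
      by (simp add: distrib_left sum.distrib)
    then show "\<bar>\<Sum>m<M. f m * (k m n + l m n)\<bar> powr p
        \<le> 2 powr p * (\<bar>\<Sum>m<M. f m * k m n\<bar> powr p + \<bar>\<Sum>m<M. f m * l m n\<bar> powr p)"
      by (simp only: abs_add_powr_le[OF assms(3)])
  qed
  also have "\<dots> = 2 powr p * ((\<Sum>n<L. \<bar>\<Sum>m<M. f m * k m n\<bar> powr p) + (\<Sum>n<L. \<bar>\<Sum>m<M. f m * l m n\<bar> powr p))"
    by (simp add: sum_distrib_left sum.distrib distrib_left)
  also have "\<dots> \<le> 2 powr p * (C * (\<Sum>m<M. \<bar>f m\<bar> powr p) + D * (\<Sum>m<M. \<bar>f m\<bar> powr p))"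
    by (intro mult_left_mono add_mono lp_boundedD assms) auto
  finally show "(\<Sum>n<L. \<bar>\<Sum>m<M. f m * (k m n + l m n)\<bar> powr p) \<le> 2 powr p * (C + D) * (\<Sum>m<M. \<bar>f m\<bar> powr p)"
    by (simp add: algebra_simps)
qed

lemma lp_bounded_mult:
  assumes k: "lp_bounded p C k" and C: "C \<ge> 0" and p: "p \<ge> 0"
    and u: "\<And>m. \<bar>u m\<bar> \<le> A" and v: "\<And>n. \<bar>v n\<bar> \<le> B"
  shows "lp_bounded p (A powr p * B powr p * C) (\<lambda>m n. u m * v n * k m n)"
  unfolding lp_bounded_def
proof safe
  fix f :: "nat \<Rightarrow> real" and L M
  have "(\<Sum>n<L. \<bar>\<Sum>m<M. f m * (u m * v n * k m n)\<bar> powr p) = (\<Sum>n<L. \<bar>v n\<bar> powr p * \<bar>\<Sum>m<M. (f m * u m) * k m n\<bar> powr p)"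
  proof (rule sum.cong)
    fix n
    have "(\<Sum>m<M. f m * (u m * v n * k m n)) = v n * (\<Sum>m<M. (f m * u m) * k m n)"
      by (simp add: sum_distrib_left mult_ac)
    then show "\<bar>\<Sum>m<M. f m * (u m * v n * k m n)\<bar> powr p = \<bar>v n\<bar> powr p * \<bar>\<Sum>m<M. (f m * u m) * k m n\<bar> powr p"
      by (simp only: abs_mult powr_mult)
  qed simp
  also have "\<dots> \<le> (\<Sum>n<L. B powr p * \<bar>\<Sum>m<M. (f m * u m) * k m n\<bar> powr p)"
    using p v by (intro sum_mono mult_right_mono powr_mono2) auto
  also have "\<dots> = B powr p * (\<Sum>n<L. \<bar>\<Sum>m<M. (f m * u m) * k m n\<bar> powr p)" by (simp add: sum_distrib_left)
  also have "\<dots> \<le> B powr p * (C * (\<Sum>m<M. \<bar>f m * u m\<bar> powr p))"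
    by (intro mult_left_mono lp_boundedD k) auto
  also have "\<dots> \<le> B powr p * (C * (\<Sum>m<M. \<bar>f m\<bar> powr p * A powr p))"
    using C p u by (intro mult_left_mono sum_mono) (auto simp: abs_mult powr_mult intro!: mult_left_mono powr_mono2)
  finally show "(\<Sum>n<L. \<bar>\<Sum>m<M. f m * (u m * v n * k m n)\<bar> powr p) \<le> A powr p * B powr p * C * (\<Sum>m<M. \<bar>f m\<bar> powr p)"
    by (simp add: sum_distrib_left mult_ac)
qed

lemma lp_bounded_diag:
  assumes k: "\<And>n. \<bar>k n\<bar> \<le> A" and p: "p \<ge> 0"
  shows "lp_bounded p (A powr p) (\<lambda>m n. if m = n then k n else 0)"
  unfolding lp_bounded_def
proof safe
  fix f :: "nat \<Rightarrow> real" and L M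
  have eq: "(\<Sum>m<M. f m * (if m = n then k n else 0)) = (if n < M then f n * k n else 0)" for n
    by (simp add: if_distrib[of "\<lambda>x. f _ * x"] sum.delta cong: if_cong)
  have "(\<Sum>n<L. \<bar>\<Sum>m<M. f m * (if m = n then k n else 0)\<bar> powr p) \<le> (\<Sum>n<L. if n < M then \<bar>f n\<bar> powr p * A powr p else 0)"
    unfolding eq using k p by (intro sum_mono) (auto simp: abs_mult powr_mult intro!: mult_left_mono powr_mono2)
  also have "\<dots> = (\<Sum>n\<in>{..<L} \<inter> {..<M}. \<bar>f n\<bar> powr p * A powr p)"
    by (subst sum.inter_restrict) auto
  also have "\<dots> \<le> (\<Sum>n<M. \<bar>f n\<bar> powr p * A powr p)" by (intro sum_mono2) auto
  finally show "(\<Sum>n<L. \<bar>\<Sum>m<M. f m * (if m = n then k n else 0)\<bar> powr p) \<le> A powr p * (\<Sum>m<M. \<bar>f m\<bar> powr p)"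
    by (simp add: sum_distrib_left mult.commute)
qed

text \<open>The second kernel is positive and dominated by \<open>1 / (n + m)\<close>, which is the
  Hilbert kernel with the input placed at the nodes \<open>- m\<close>. Hence one constant serves
  both kernels and every \<open>s\<close>. The diagonal is cut out, where \<open>m = n = 0\<close>,
  \<open>s = 0\<close> would be singular.\<close>

lemma lp_bounded_hilbert:
  assumes "1 < p"
  obtains C where "C \<ge> 0" "lp_bounded p C (\<lambda>m n. 1 / (real n - real m))"
    "\<And>s. s \<ge> 0 \<Longrightarrow> lp_bounded p C (\<lambda>m n. if m = n then 0 else 1 / (real n + real m + s))"
proof -
  obtain C where C: "C \<ge> 0" "\<And>I J f. finite I \<Longrightarrow> finite J \<Longrightarrow>
    (\<Sum>n\<in>J. \<bar>\<Sum>m\<in>I. f m / of_int (n - m)\<bar> powr p) \<le> C * (\<Sum>m\<in>I. \<bar>f m\<bar> powr p)"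
    using hilbert_operator_bound[OF assms] by blast
  have "lp_bounded p C (\<lambda>m n. 1 / (real n - real m))"
    unfolding lp_bounded_def
  proof safe
    fix f :: "nat \<Rightarrow> real" and L M
    show "(\<Sum>n<L. \<bar>\<Sum>m<M. f m * (1 / (real n - real m))\<bar> powr p) \<le> C * (\<Sum>m<M. \<bar>f m\<bar> powr p)"
      using C(2)[of "int ` {..<M}" "int ` {..<L}" "\<lambda>m. f (nat m)"] by (simp add: sum.reindex)
  qed
  moreover have "lp_bounded p C (\<lambda>m n. if m = n then 0 else 1 / (real n + real m + s))" if s: "s \<ge> 0" for s
    unfolding lp_bounded_def
  proof safe
    fix f :: "nat \<Rightarrow> real" and L M
    have "(\<Sum>n<L. \<bar>\<Sum>m<M. f m * (if m = n then 0 else 1 / (real n + real m + s))\<bar> powr p)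
        \<le> (\<Sum>n<L. \<bar>\<Sum>m<M. \<bar>f m\<bar> / (real n + real m)\<bar> powr p)"
    proof (intro sum_mono powr_mono2)
      fix n
      have "\<bar>f m * (if m = n then 0 else 1 / (real n + real m + s))\<bar> \<le> \<bar>f m\<bar> / (real n + real m)" for m
        using s by (cases "m = n"; cases "m = 0") (auto simp: abs_mult intro!: divide_left_mono mult_pos_pos)
      then have "\<bar>\<Sum>m<M. f m * (if m = n then 0 else 1 / (real n + real m + s))\<bar> \<le> (\<Sum>m<M. \<bar>f m\<bar> / (real n + real m))"
        by (intro order.trans[OF sum_abs sum_mono])
      then show "\<bar>\<Sum>m<M. f m * (if m = n then 0 else 1 / (real n + real m + s))\<bar> \<le> \<bar>\<Sum>m<M. \<bar>f m\<bar> / (real n + real m)\<bar>"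
        by linarith
    qed (use assms in auto)
    also have "\<dots> \<le> C * (\<Sum>m<M. \<bar>f m\<bar> powr p)"
      using C(2)[of "(\<lambda>m. - int m) ` {..<M}" "int ` {..<L}" "\<lambda>m. \<bar>f (nat (- m))\<bar>"]
      by (simp add: sum.reindex inj_on_def)
    finally show "(\<Sum>n<L. \<bar>\<Sum>m<M. f m * (if m = n then 0 else 1 / (real n + real m + s))\<bar> powr p) \<le> C * (\<Sum>m<M. \<bar>f m\<bar> powr p)" .
  qed
  ultimately show ?thesis using C(1) that by blast
qed

section \<open>Jacobi polynomials\<close>

text \<open>The second derivative stays existential because only the value dictated by the equation
  is ever used. As a predicate on arbitrary solutions it is stable under scaling and under
  \<open>x \<mapsto> - x\<close>, which exchanges \<open>a\<close> and \<open>b\<close> and so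
  reduces estimates at \<open>-1\<close> to estimates at \<open>1\<close>.\<close>

definition jacobi_ode :: "real \<Rightarrow> real \<Rightarrow> real \<Rightarrow> (real \<Rightarrow> real) \<Rightarrow> (real \<Rightarrow> real) \<Rightarrow> bool" where
  "jacobi_ode a b l P P' \<longleftrightarrow> (\<forall>x. (P has_real_derivative P' x) (at x)) \<and>
     (\<forall>x. \<exists>D. (P' has_real_derivative D) (at x) \<and>
        (1 - x\<^sup>2) * D + (b - a - (a + b + 2) * x) * P' x + l * P x = 0)"

lemma jacobi_ode_scale:
  assumes "jacobi_ode a b l P P'"
  shows "jacobi_ode a b l (\<lambda>x. c * P x) (\<lambda>x. c * P' x)"
  unfolding jacobi_ode_def
proof safe
  fix x
  show "((\<lambda>x. c * P x) has_real_derivative c * P' x) (at x)"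
    using assms by (auto simp: jacobi_ode_def intro!: DERIV_cmult)
  obtain D where "(P' has_real_derivative D) (at x)"
    "(1 - x\<^sup>2) * D + (b - a - (a + b + 2) * x) * P' x + l * P x = 0"
    using assms by (auto simp: jacobi_ode_def)
  then have "((\<lambda>x. c * P' x) has_real_derivative c * D) (at x)"
     "(1 - x\<^sup>2) * (c * D) + (b - a - (a + b + 2) * x) * (c * P' x) + l * (c * P x) = 0"
    by (auto intro!: DERIV_cmult) (metis (no_types, lifting) mult.left_commute distrib_left mult_zero_right)
  then show "\<exists>D. ((\<lambda>x. c * P' x) has_real_derivative D) (at x) \<and>
     (1 - x\<^sup>2) * D + (b - a - (a + b + 2) * x) * (c * P' x) + l * (c * P x) = 0" by blast
qed

lemma jacobi_ode_reflect:
  assumes "jacobi_ode a b l P P'"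
  shows "jacobi_ode b a l (\<lambda>x. P (- x)) (\<lambda>x. - P' (- x))"
  unfolding jacobi_ode_def
proof safe
  fix x
  have "(P has_real_derivative P' (- x)) (at (- x))"
    using assms by (auto simp: jacobi_ode_def)
  then show "((\<lambda>x. P (- x)) has_real_derivative - P' (- x)) (at x)"
    by (rule DERIV_chain2[THEN DERIV_cong]) (auto intro!: derivative_eq_intros)
  obtain D where D: "(P' has_real_derivative D) (at (- x))"
    "(1 - (- x)\<^sup>2) * D + (b - a - (a + b + 2) * (- x)) * P' (- x) + l * P (- x) = 0"
    using assms unfolding jacobi_ode_def by blast
  have "((\<lambda>x. P' (- x)) has_real_derivative - D) (at x)"
    using D(1) by (rule DERIV_chain2[THEN DERIV_cong]) (auto intro!: derivative_eq_intros)
  then have "((\<lambda>x. - P' (- x)) has_real_derivative D) (at x)"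
    by (rule DERIV_minus[THEN DERIV_cong]) auto
  moreover have "(1 - x\<^sup>2) * D + (a - b - (b + a + 2) * x) * (- P' (- x)) + l * P (- x) = 0"
    using D(2) by (simp add: algebra_simps)
  ultimately show "\<exists>D. ((\<lambda>x. - P' (- x)) has_real_derivative D) (at x) \<and>
     (1 - x\<^sup>2) * D + (a - b - (b + a + 2) * x) * (- P' (- x)) + l * P (- x) = 0" by blast
qed

definition jmonom :: "nat \<Rightarrow> nat \<Rightarrow> real \<Rightarrow> real" where
  "jmonom k l x = ((x - 1) / 2) ^ k * ((x + 1) / 2) ^ l"

lemma jmonom_deriv:
  "(jmonom k l has_real_derivative (real k * jmonom (k - 1) l x + real l * jmonom k (l - 1) x) / 2) (at x)"
  unfolding jmonom_def by (rule derivative_eq_intros refl | simp)+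

text \<open>With \<open>s = (x - 1) / 2\<close> and \<open>t = (x + 1) / 2\<close> one has \<open>1 - x\<^sup>2 = - 4 s t\<close> and
  \<open>b - a - (a + b + 2) x = - 2 ((a + 1) t + (b + 1) s)\<close>.\<close>
lemma jmonom_ode:
  fixes a b :: real and k l :: nat
  defines "n \<equiv> k + l"
  shows "(1 - x\<^sup>2) * ((real k * ((real (k - 1) * jmonom (k - 1 - 1) l x + real l * jmonom (k - 1) (l - 1) x) / 2)
        + real l * ((real k * jmonom (k - 1) (l - 1) x + real (l - 1) * jmonom k (l - 1 - 1) x) / 2)) / 2)
     + (b - a - (a + b + 2) * x) * ((real k * jmonom (k - 1) l x + real l * jmonom k (l - 1) x) / 2)
     + real n * (real n + a + b + 1) * jmonom k l x
   = - (real k * (real k + a) * jmonom (k - 1) (l + 1) x) + real l * (real l + b) * jmonom k l x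
     + real k * (real k + a) * jmonom k l x - real l * (real l + b) * jmonom (k + 1) (l - 1) x"
proof -
  define s t where "s = (x - 1) / 2" and "t = (x + 1) / 2"
  have st: "1 - x\<^sup>2 = - 4 * s * t" "b - a - (a + b + 2) * x = - 2 * ((a + 1) * t + (b + 1) * s)"
    by (auto simp: s_def t_def power2_eq_square field_simps)
  define x0 x1 x2 y0 y1 y2 where "x0 = s ^ k" and "x1 = real k * s ^ (k - 1)" and "x2 = real k * real (k - 1) * s ^ (k - 1 - 1)"
    and "y0 = t ^ l" and "y1 = real l * t ^ (l - 1)" and "y2 = real l * real (l - 1) * t ^ (l - 1 - 1)"
  note defs = x0_def x1_def x2_def y0_def y1_def y2_def
  have x: "s * x1 = real k * x0" "s * x2 = (real k - 1) * x1"
    unfolding defs by (cases k; simp; cases "k - 1"; simp)+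
  have y: "t * y1 = real l * y0" "t * y2 = (real l - 1) * y1"
    unfolding defs by (cases l; simp; cases "l - 1"; simp)+
  have jmonom: "jmonom i j x = s ^ i * t ^ j" for i j by (simp add: jmonom_def s_def t_def)
  have "(- 4 * s * t) * (((x2 * y0 + x1 * y1) / 2 + (x1 * y1 + x0 * y2) / 2) / 2)
     + (- 2 * ((a + 1) * t + (b + 1) * s)) * ((x1 * y0 + x0 * y1) / 2)
     + real n * (real n + a + b + 1) * (x0 * y0)
     = - (t * (s * x2) * y0) - 2 * (s * x1) * (t * y1) - s * x0 * (t * y2)
       - (a + 1) * (t * x1 * y0) - (a + 1) * (x0 * (t * y1)) - (b + 1) * ((s * x1) * y0) - (b + 1) * (s * x0 * y1)
       + real n * (real n + a + b + 1) * (x0 * y0)"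
    by (simp add: algebra_simps add_divide_distrib diff_divide_distrib)
  also have "\<dots> = - ((real k + a) * (x1 * t * y0)) + real l * (real l + b) * (x0 * y0)
     + real k * (real k + a) * (x0 * y0) - (real l + b) * (s * x0 * y1)"
    unfolding x y n_def by (simp add: algebra_simps)
  finally have eq: "(- 4 * s * t) * (((x2 * y0 + x1 * y1) / 2 + (x1 * y1 + x0 * y2) / 2) / 2)
     + (- 2 * ((a + 1) * t + (b + 1) * s)) * ((x1 * y0 + x0 * y1) / 2)
     + real n * (real n + a + b + 1) * (x0 * y0)
     = - ((real k + a) * (x1 * t * y0)) + real l * (real l + b) * (x0 * y0)
     + real k * (real k + a) * (x0 * y0) - (real l + b) * (s * x0 * y1)" .
  have "real k * ((real (k - 1) * jmonom (k - 1 - 1) l x + real l * jmonom (k - 1) (l - 1) x) / 2) = (x2 * y0 + x1 * y1) / 2"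
    and "real l * ((real k * jmonom (k - 1) (l - 1) x + real (l - 1) * jmonom k (l - 1 - 1) x) / 2) = (x1 * y1 + x0 * y2) / 2"
    and "real k * jmonom (k - 1) l x + real l * jmonom k (l - 1) x = x1 * y0 + x0 * y1"
    and "jmonom k l x = x0 * y0"
    and "real k * (real k + a) * jmonom (k - 1) (l + 1) x = (real k + a) * (x1 * t * y0)"
    and "real l * (real l + b) * jmonom (k + 1) (l - 1) x = (real l + b) * (s * x0 * y1)"
    unfolding jmonom defs by (simp_all add: algebra_simps)
  then show ?thesis unfolding st using eq by (simp only:)
qed

definition jacobi_coeff :: "real \<Rightarrow> real \<Rightarrow> nat \<Rightarrow> nat \<Rightarrow> real" where
  "jacobi_coeff a b n k = ((real n + a) gchoose (n - k)) * ((real n + b) gchoose k)"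

text \<open>This relation between neighbouring coefficients is what makes the shifted terms of
  \<open>jmonom_ode\<close> telescope.\<close>

lemma jacobi_coeff_Suc:
  assumes "k < n"
  shows "jacobi_coeff a b n (Suc k) * (real (Suc k) * (real (Suc k) + a))
       = jacobi_coeff a b n k * (real (n - k) * (real (n - k) + b))"
proof -
  obtain j where j: "n - k = Suc j" "n - Suc k = j" "real n = real k + real j + 1"
  proof
    show "n - k = Suc (n - Suc k)" using assms by simp
    show "real n = real k + real (n - Suc k) + 1" using assms by simp
  qed simp
  define u v where "u = (real n + a) gchoose j" and "v = (real n + b) gchoose k"
  have "((real n + b) gchoose Suc k) * real (Suc k) = v * (real n + b - real k)"
    using gbinomial_mult_1[of "real n + b" k] by (simp add: algebra_simps v_def)
  then have 1: "((real n + b) gchoose Suc k) * real (Suc k) = v * (real (Suc j) + b)"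
    using j by (simp add: algebra_simps)
  have "((real n + a) gchoose Suc j) * real (Suc j) = u * (real n + a - real j)"
    using gbinomial_mult_1[of "real n + a" j] by (simp add: algebra_simps u_def)
  then have 2: "((real n + a) gchoose Suc j) * real (Suc j) = u * (real (Suc k) + a)"
    using j by (simp add: algebra_simps)
  have "u * ((real n + b) gchoose Suc k) * (real (Suc k) * (real (Suc k) + a))
     = (u * (real (Suc k) + a)) * (((real n + b) gchoose Suc k) * real (Suc k))" by simp
  also have "\<dots> = ((real n + a) gchoose Suc j) * v * (real (Suc j) * (real (Suc j) + b))"
    unfolding 1 2[symmetric] by simp
  finally show ?thesis
    unfolding jacobi_coeff_def j(1,2) u_def v_def .
qed

lemma jacobiP_jmonom: "jacobiP a b n x = (\<Sum>k\<le>n. jacobi_coeff a b n k * jmonom k (n - k) x)"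
  by (simp add: jacobiP_def jacobi_coeff_def jmonom_def mult_ac)

text \<open>The operator sends the monomial of index \<open>k\<close> to multiples of itself and of
  its neighbours of index \<open>k - 1\<close> and \<open>k + 1\<close>. By
  \<open>jacobi_coeff_Suc\<close> the four resulting terms pair up into two differences of
  consecutive terms.\<close>

lemma jacobiP_ode:
  obtains P' where "jacobi_ode a b (real n * (real n + a + b + 1)) (jacobiP a b n) P'"
proof -
  let ?c = "jacobi_coeff a b n"
  define P' where "P' = (\<lambda>x. \<Sum>k\<le>n. ?c k * ((real k * jmonom (k - 1) (n - k) x + real (n - k) * jmonom k (n - k - 1) x) / 2))"
  define P'' where "P'' = (\<lambda>x. \<Sum>k\<le>n. ?c k * ((real k * ((real (k - 1) * jmonom (k - 1 - 1) (n - k) x + real (n - k) * jmonom (k - 1) (n - k - 1) x) / 2)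
        + real (n - k) * ((real k * jmonom (k - 1) (n - k - 1) x + real (n - k - 1) * jmonom k (n - k - 1 - 1) x) / 2)) / 2))"
  have d1: "(jacobiP a b n has_real_derivative P' x) (at x)" for x
    unfolding P'_def jacobiP_jmonom[abs_def] by (intro DERIV_sum DERIV_cmult jmonom_deriv)
  have d2: "(P' has_real_derivative P'' x) (at x)" for x
    unfolding P'_def P''_def
    by (intro DERIV_sum DERIV_cmult DERIV_add DERIV_cdivide jmonom_deriv)
  have "(1 - x\<^sup>2) * P'' x + (b - a - (a + b + 2) * x) * P' x + real n * (real n + a + b + 1) * jacobiP a b n x = 0" for x
  proof -
    \<comment> \<open>Both sequences vanish at the two ends of the telescoping sum: at
      \<open>0\<close> through the factor \<open>real k\<close>, at \<open>Suc n\<close> through the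
      cut-off.\<close>
    define A where "A = (\<lambda>k. if n < k then 0 else ?c k * (real k * (real k + a)) * jmonom (k - 1) (Suc n - k) x)"
    define F where "F = (\<lambda>k. if n < k then 0 else ?c k * (real k * (real k + a)) * jmonom k (n - k) x)"
    have fac: "u * (c * X) + v * (c * Y) + w * (c * Z) = c * (u * X + v * Y + w * Z)" for u v w c X Y Z :: real
      by (simp add: algebra_simps)
    have "(1 - x\<^sup>2) * P'' x + (b - a - (a + b + 2) * x) * P' x + real n * (real n + a + b + 1) * jacobiP a b n x
       = (\<Sum>k\<le>n. ?c k * (- (real k * (real k + a) * jmonom (k - 1) (n - k + 1) x) + real (n - k) * (real (n - k) + b) * jmonom k (n - k) x
     + real k * (real k + a) * jmonom k (n - k) x - real (n - k) * (real (n - k) + b) * jmonom (k + 1) (n - k - 1) x))"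
      unfolding P''_def P'_def jacobiP_jmonom sum_distrib_left sum.distrib[symmetric]
    proof (rule sum.cong)
      fix k assume "k \<in> {..n}"
      then have k: "k + (n - k) = n" by simp
      show "(1 - x\<^sup>2) * (?c k * ((real k * ((real (k - 1) * jmonom (k - 1 - 1) (n - k) x + real (n - k) * jmonom (k - 1) (n - k - 1) x) / 2)
        + real (n - k) * ((real k * jmonom (k - 1) (n - k - 1) x + real (n - k - 1) * jmonom k (n - k - 1 - 1) x) / 2)) / 2))
        + (b - a - (a + b + 2) * x) * (?c k * ((real k * jmonom (k - 1) (n - k) x + real (n - k) * jmonom k (n - k - 1) x) / 2))
        + real n * (real n + a + b + 1) * (?c k * jmonom k (n - k) x)
        = ?c k * (- (real k * (real k + a) * jmonom (k - 1) (n - k + 1) x) + real (n - k) * (real (n - k) + b) * jmonom k (n - k) x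
     + real k * (real k + a) * jmonom k (n - k) x - real (n - k) * (real (n - k) + b) * jmonom (k + 1) (n - k - 1) x)"
        unfolding fac by (simp only: jmonom_ode[of x k "n - k" b a, unfolded k])
    qed simp
    also have "\<dots> = (\<Sum>k\<le>n. (A (Suc k) - A k) - (F (Suc k) - F k))"
    proof (rule sum.cong)
      fix k assume "k \<in> {..n}"
      then have k: "k \<le> n" by simp
      have s: "Suc n - k = n - k + 1" "n - Suc k = n - k - 1" using k by auto
      have c: "?c (Suc k) * (real (Suc k) * (real (Suc k) + a)) * y = ?c k * (real (n - k) * (real (n - k) + b)) * y" if "k < n" for y
        using jacobi_coeff_Suc[OF that, of a b] by simp
      show "?c k * (- (real k * (real k + a) * jmonom (k - 1) (n - k + 1) x) + real (n - k) * (real (n - k) + b) * jmonom k (n - k) x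
     + real k * (real k + a) * jmonom k (n - k) x - real (n - k) * (real (n - k) + b) * jmonom (k + 1) (n - k - 1) x)
       = (A (Suc k) - A k) - (F (Suc k) - F k)"
      proof -
        have Ak: "A k = ?c k * (real k * (real k + a)) * jmonom (k - 1) (n - k + 1) x"
          and Fk: "F k = ?c k * (real k * (real k + a)) * jmonom k (n - k) x"
          using k by (auto simp: A_def F_def s)
        have AS: "A (Suc k) = ?c k * (real (n - k) * (real (n - k) + b)) * jmonom k (n - k) x"
          and FS: "F (Suc k) = ?c k * (real (n - k) * (real (n - k) + b)) * jmonom (k + 1) (n - k - 1) x"
        proof -
          have "A (Suc k) = ?c (Suc k) * (real (Suc k) * (real (Suc k) + a)) * jmonom k (n - k) x"
            "F (Suc k) = ?c (Suc k) * (real (Suc k) * (real (Suc k) + a)) * jmonom (k + 1) (n - k - 1) x" if "k < n"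
            using that unfolding A_def F_def s by (simp_all del: of_nat_Suc)
          moreover have "A (Suc k) = 0" "F (Suc k) = 0" "real (n - k) = 0" if "\<not> k < n"
            using that unfolding A_def F_def by simp_all
          ultimately show "A (Suc k) = ?c k * (real (n - k) * (real (n - k) + b)) * jmonom k (n - k) x"
            "F (Suc k) = ?c k * (real (n - k) * (real (n - k) + b)) * jmonom (k + 1) (n - k - 1) x"
            by (metis c mult_zero_left mult_zero_right)+
        qed
        have "d * (- (u * X) + v * Y + u * Z - v * W) = (d * v * Y - d * u * X) - (d * v * W - d * u * Z)" for d u v X Y Z W :: real
          by (simp add: algebra_simps)
        then show ?thesis unfolding Ak Fk AS FS .
      qed
    qed simp
    also have "\<dots> = (A (Suc n) - A 0) - (F (Suc n) - F 0)"
      unfolding sum_subtractf[of "\<lambda>k. A (Suc k) - A k"] lessThan_Suc_atMost[symmetric]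
      by (simp only: sum_lessThan_telescope)
    also have "\<dots> = 0" by (simp add: A_def F_def)
    finally show ?thesis .
  qed
  then have "jacobi_ode a b (real n * (real n + a + b + 1)) (jacobiP a b n) P'"
    unfolding jacobi_ode_def using d1 d2 by blast
  then show ?thesis using that by blast
qed

lemma jacobiP_1_pos:
  assumes "a > -1"
  shows "jacobiP a b n 1 > 0"
proof -
  have "jacobiP a b n 1 = (\<Sum>k\<le>n. if k = 0 then (real n + a) gchoose n else 0)"
    unfolding jacobiP_def by (intro sum.cong) (auto simp: power_0_left)
  also have "\<dots> = (real n + a) gchoose n" by simp
  also have "\<dots> = pochhammer (a + 1) n / fact n" by (simp add: gbinomial_pochhammer' algebra_simps)
  also have "\<dots> > 0" using assms by (intro divide_pos_pos pochhammer_pos) auto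
  finally show ?thesis .
qed

section \<open>The weight and the normalisation\<close>

lemma jacobi_weight_measurable [measurable]: "jacobi_weight a b \<in> borel_measurable borel"
  unfolding jacobi_weight_def[abs_def] by measurable

lemma jacobi_weight_nonneg: "jacobi_weight a b x \<ge> 0"
  by (simp add: jacobi_weight_def)

text \<open>An affine substitution turns the weight into a Beta density. Since it is nonnegative,
  the gauge integral of that density yields Lebesgue integrability.\<close>

lemma jacobi_weight_set_integrable:
  assumes "a > -1" "b > -1"
  shows "set_integrable lborel {-1..1} (jacobi_weight a b)"
proof -
  have "((\<lambda>t. t powr b * (1 - t) powr a) has_integral Beta (b+1) (a+1)) (cbox 0 1)"
    using has_integral_Beta_real[of "b+1" "a+1"] assms by simp
  from has_integral_affinity'[OF this, of "1/2" "1/2"]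
  have "((\<lambda>x. (x/2 + 1/2) powr b * (1 - (x/2 + 1/2)) powr a) has_integral (2 * Beta (b+1) (a+1))) {-1..1}"
    by simp
  then have "((\<lambda>x. (2 powr b * 2 powr a) * ((x/2 + 1/2) powr b * (1 - (x/2 + 1/2)) powr a)) has_integral ((2 powr b * 2 powr a) * (2 * Beta (b+1) (a+1)))) {-1..1}"
    by (rule has_integral_mult_right)
  then have "(jacobi_weight a b has_integral ((2 powr b * 2 powr a) * (2 * Beta (b+1) (a+1)))) {-1..1}"
  proof (rule has_integral_eq[rotated])
    fix x :: real assume x: "x \<in> {-1..1}"
    have "2 powr b * (x/2 + 1/2) powr b = (1 + x) powr b" using x by (simp add: add.commute flip: powr_mult)
    moreover have "2 powr a * (1 - (x/2 + 1/2)) powr a = (1 - x) powr a" using x by (simp flip: powr_mult)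
    ultimately show "(2 powr b * 2 powr a) * ((x/2 + 1/2) powr b * (1 - (x/2 + 1/2)) powr a) = jacobi_weight a b x"
      unfolding jacobi_weight_def by (metis mult.commute mult.left_commute)
  qed
  then have "(\<lambda>x. if x \<in> {-1..1} then jacobi_weight a b x else 0) integrable_on UNIV"
    unfolding integrable_restrict_UNIV by blast
  then obtain I where I: "((\<lambda>x. if x \<in> {-1..1} then jacobi_weight a b x else 0) has_integral I) UNIV"
    by blast
  have "integral\<^sup>N lborel (\<lambda>x. if x \<in> {-1..1} then jacobi_weight a b x else 0) = I"
    using I by (intro nn_integral_has_integral_lborel) (auto simp: jacobi_weight_nonneg)
  then have "integrable lborel (\<lambda>x. if x \<in> {-1..1} then jacobi_weight a b x else 0)"
    by (intro integrableI_nonneg) (auto simp: jacobi_weight_nonneg)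
  moreover have "(\<lambda>x. if x \<in> {-1..1} then jacobi_weight a b x else 0) = (\<lambda>x. indicator {-1..1} x *\<^sub>R jacobi_weight a b x)"
    by (auto simp: indicator_def)
  ultimately show ?thesis unfolding set_integrable_def by simp
qed

lemma continuous_weight_set_integrable:
  assumes "a > -1" "b > -1" and f: "continuous_on UNIV f"
  shows "set_integrable lborel {-1..1} (\<lambda>x. f x * jacobi_weight a b x)"
proof -
  have "bounded (f ` {-1..1})"
    by (intro compact_imp_bounded compact_continuous_image continuous_on_subset[OF f]) auto
  then obtain B where B: "\<And>x. x \<in> {-1..1} \<Longrightarrow> \<bar>f x\<bar> \<le> B" unfolding bounded_iff by (metis image_eqI real_norm_def)
  have [measurable]: "f \<in> borel_measurable borel" by (rule borel_measurable_continuous_onI[OF f])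
  show ?thesis
  proof (rule set_integrable_bound[OF set_integrable_mult_right[OF jacobi_weight_set_integrable[OF assms(1,2)], of B]])
    show "set_borel_measurable lborel {-1..1} (\<lambda>x. f x * jacobi_weight a b x)"
      unfolding set_borel_measurable_def by measurable
    show "AE x in lborel. x \<in> {-1..1} \<longrightarrow> norm (f x * jacobi_weight a b x) \<le> norm (B * jacobi_weight a b x)"
      using B by (auto simp: abs_mult jacobi_weight_nonneg intro!: mult_right_mono order.trans[OF B abs_ge_self])
  qed
qed

lemma jacobiP_continuous: "continuous_on S (jacobiP a b n)"
  unfolding jacobiP_def[abs_def] by (intro continuous_intros) auto

text \<open>The polynomial is positive at \<open>1\<close>, hence on an interval to the left of
  \<open>1\<close>, where the weight is positive too. This makes the division in
  \<open>jacobi_p\<close> a genuine normalisation.\<close>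

lemma jacobiP_norm_pos:
  assumes "a > -1" "b > -1"
  shows "(LINT y:{-1..1}|lborel. (jacobiP a b n y)\<^sup>2 * jacobi_weight a b y) > 0"
proof -
  let ?f = "\<lambda>y. (jacobiP a b n y)\<^sup>2 * jacobi_weight a b y"
  have si: "set_integrable lborel {-1..1} ?f"
    by (intro continuous_weight_set_integrable assms continuous_intros jacobiP_continuous)
  have "isCont (jacobiP a b n) 1"
    using jacobiP_continuous[of UNIV a b n] by (simp add: continuous_on_eq_continuous_at)
  then have "\<forall>\<^sub>F x in at 1. jacobiP a b n x > 0"
    using jacobiP_1_pos[OF assms(1), of b n] by (intro order_tendstoD) (auto simp: isCont_def)
  then obtain d where d: "d > 0" "\<And>x. x \<noteq> 1 \<Longrightarrow> dist x 1 < d \<Longrightarrow> jacobiP a b n x > 0"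
    by (auto simp: eventually_at)
  define e where "e = min (d/2) 1"
  have e: "e > 0" "e < d" "e \<le> 1" using d by (auto simp: e_def)
  have pos: "?f x > 0" if "x \<in> {1 - e<..<1}" for x
    using that e d(2)[of x] by (auto simp: dist_real_def jacobi_weight_def)
  have "(LINT y:{-1..1}|lborel. ?f y) \<noteq> 0"
  proof
    assume 0: "(LINT y:{-1..1}|lborel. ?f y) = 0"
    have "AE y in lborel. indicator {-1..1} y *\<^sub>R ?f y = 0"
      using 0 si unfolding set_integrable_def set_lebesgue_integral_def
      by (subst (asm) integral_nonneg_eq_0_iff_AE) (auto simp: jacobi_weight_nonneg)
    then have "AE y in lborel. y \<notin> {1 - e<..<1}"
    proof (rule eventually_mono)
      fix y assume y: "indicator {-1..1} y *\<^sub>R ?f y = 0"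
      show "y \<notin> {1 - e<..<1}"
        using pos[of y] y e by (auto simp: indicator_def split: if_splits)
    qed
    then have "emeasure lborel {1 - e<..<1} = 0"
      by (subst (asm) AE_iff_measurable[of "{1 - e<..<1}"]) auto
    then show False using e by simp
  qed
  moreover have "(LINT y:{-1..1}|lborel. ?f y) \<ge> 0"
    unfolding set_lebesgue_integral_def by (intro Bochner_Integration.integral_nonneg) (auto simp: jacobi_weight_nonneg)
  ultimately show ?thesis by linarith
qed

lemma jacobi_p_continuous: "continuous_on S (jacobi_p a b n)"
  unfolding jacobi_p_def[abs_def] divide_inverse
  by (intro continuous_intros jacobiP_continuous)

lemma jacobi_p_ode:
  obtains P' where "jacobi_ode a b (real n * (real n + a + b + 1)) (jacobi_p a b n) P'"
proof -
  obtain P' where "jacobi_ode a b (real n * (real n + a + b + 1)) (jacobiP a b n) P'"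
    using jacobiP_ode by blast
  from jacobi_ode_scale[OF this, of "inverse (sqrt (LINT y:{-1..1}|lborel. (jacobiP a b n y)\<^sup>2 * jacobi_weight a b y))"]
  show ?thesis using that unfolding jacobi_p_def[abs_def] divide_inverse mult.commute[of "jacobiP _ _ _ _"] by blast
qed

lemma jacobi_p_normalized:
  assumes "a > -1" "b > -1"
  shows "(LINT y:{-1..1}|lborel. (jacobi_p a b n y)\<^sup>2 * jacobi_weight a b y) = 1"
proof -
  let ?I = "LINT y:{-1..1}|lborel. (jacobiP a b n y)\<^sup>2 * jacobi_weight a b y"
  have I: "?I > 0" by (rule jacobiP_norm_pos[OF assms])
  have "(jacobi_p a b n y)\<^sup>2 * jacobi_weight a b y = inverse ?I * ((jacobiP a b n y)\<^sup>2 * jacobi_weight a b y)" for y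
    unfolding jacobi_p_def power_divide real_sqrt_pow2[OF less_imp_le[OF I]] by (simp add: divide_inverse)
  then have "(LINT y:{-1..1}|lborel. (jacobi_p a b n y)\<^sup>2 * jacobi_weight a b y) = inverse ?I * ?I"
    by (simp only: set_integral_mult_right)
  also have "\<dots> = 1" using I by simp
  finally show ?thesis .
qed

lemma jacobi_p_0: 
  assumes "a > -1" "b > -1"
  obtains c where "c > 0" "\<And>x. jacobi_p a b 0 x = c"
proof
  show "1 / sqrt (LINT y:{-1..1}|lborel. (jacobiP a b 0 y)\<^sup>2 * jacobi_weight a b y) > 0"
    using jacobiP_norm_pos[OF assms, of 0] by simp
  show "jacobi_p a b 0 x = 1 / sqrt (LINT y:{-1..1}|lborel. (jacobiP a b 0 y)\<^sup>2 * jacobi_weight a b y)" for x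
    by (simp add: jacobi_p_def jacobiP_def)
qed

lemma jacobi_p_1_less:
  assumes "a > -1" "b > -1" "x < y"
  shows "jacobi_p a b 1 x < jacobi_p a b 1 y"
proof -
  have "jacobiP a b 1 z = (1 + a) * ((z + 1) / 2) + (1 + b) * ((z - 1) / 2)" for z
    by (simp add: jacobiP_def atMost_Suc)
  moreover have "(1 + a) * ((x + 1) / 2) + (1 + b) * ((x - 1) / 2) < (1 + a) * ((y + 1) / 2) + (1 + b) * ((y - 1) / 2)"
    using assms by (intro add_strict_mono mult_strict_left_mono) auto
  ultimately have "jacobiP a b 1 x < jacobiP a b 1 y" by simp
  then show ?thesis unfolding jacobi_p_def
    using jacobiP_norm_pos[OF assms(1,2), of 1] by (intro divide_strict_right_mono) auto
qed

section \<open>Uniform bounds\<close>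

text \<open>In the variable \<open>t\<close> with \<open>x = cos t\<close>: \<open>jg = \<rho>'/\<rho>\<close>, \<open>jv = \<rho> \<cdot> (P(cos t))'\<close> and \<open>jdu = u' = g u + v\<close>,
  and \<open>u'' + q u = 0\<close> with \<open>q = l - g' - g\<^sup>2\<close>.\<close>
definition jrho :: "real \<Rightarrow> real \<Rightarrow> real \<Rightarrow> real" where
  "jrho a b t = (1 - cos t) powr (a/2 + 1/4) * (1 + cos t) powr (b/2 + 1/4)"

definition jg :: "real \<Rightarrow> real \<Rightarrow> real \<Rightarrow> real" where
  "jg a b t = ((a + b + 1) * cos t + (a - b)) / (2 * sin t)"

definition jg' :: "real \<Rightarrow> real \<Rightarrow> real \<Rightarrow> real" where
  "jg' a b t = - ((a + b + 1) + (a - b) * cos t) / (2 * (sin t)\<^sup>2)"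

definition ju :: "real \<Rightarrow> real \<Rightarrow> (real \<Rightarrow> real) \<Rightarrow> real \<Rightarrow> real" where
  "ju a b P t = jrho a b t * P (cos t)"

definition jv :: "real \<Rightarrow> real \<Rightarrow> (real \<Rightarrow> real) \<Rightarrow> real \<Rightarrow> real" where
  "jv a b P' t = - (jrho a b t * sin t * P' (cos t))"

definition jdu :: "real \<Rightarrow> real \<Rightarrow> (real \<Rightarrow> real) \<Rightarrow> (real \<Rightarrow> real) \<Rightarrow> real \<Rightarrow> real" where
  "jdu a b P P' t = jg a b t * ju a b P t + jv a b P' t"

definition jq :: "real \<Rightarrow> real \<Rightarrow> real \<Rightarrow> real \<Rightarrow> real" where
  "jq a b l t = l - jg' a b t - (jg a b t)\<^sup>2"

lemma cos_bounds_0_pi: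
  assumes "0 < t" "t < pi"
  shows "1 - cos t > 0" "1 + cos t > 0" "sin t > 0"
  using assms cos_monotone_0_pi[of 0 t] cos_monotone_0_pi[of t pi] by (auto intro: sin_gt_zero)

lemma jrho_deriv:
  assumes "0 < t" "t < pi"
  shows "(jrho a b has_real_derivative jg a b t * jrho a b t) (at t)"
proof -
  note c = cos_bounds_0_pi[OF assms]
  have sq: "sin t * sin t = (1 - cos t) * (1 + cos t)"
    using sin_squared_eq[of t] by (simp add: power2_eq_square algebra_simps)
  have 1: "((\<lambda>t. (1 - cos t) powr e) has_real_derivative (e * sin t / (1 - cos t)) * (1 - cos t) powr e) (at t)" for e
    using c by (auto intro!: derivative_eq_intros simp: powr_diff)
  have 2: "((\<lambda>t. (1 + cos t) powr e) has_real_derivative (- (e * sin t / (1 + cos t))) * (1 + cos t) powr e) (at t)" for e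
    using c by (auto intro!: derivative_eq_intros simp: powr_diff)
  have s1: "sin t / (1 - cos t) = (1 + cos t) / sin t" "sin t / (1 + cos t) = (1 - cos t) / sin t"
    using c sq by (simp_all add: field_simps)
  have "(a/2 + 1/4) * sin t / (1 - cos t) - (b/2 + 1/4) * sin t / (1 + cos t)
     = (a/2 + 1/4) * (sin t / (1 - cos t)) - (b/2 + 1/4) * (sin t / (1 + cos t))" by simp
  also have "\<dots> = jg a b t" unfolding s1 jg_def using c by (simp add: field_simps)
  finally have g: "(a/2 + 1/4) * sin t / (1 - cos t) - (b/2 + 1/4) * sin t / (1 + cos t) = jg a b t" .
  show ?thesis
    unfolding jrho_def[abs_def]
    by (rule DERIV_cong[OF DERIV_mult[OF 1 2]]) (simp add: g[symmetric] algebra_simps)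
qed

lemma jg_deriv:
  assumes "0 < t" "t < pi"
  shows "(jg a b has_real_derivative jg' a b t) (at t)"
proof -
  note c = cos_bounds_0_pi[OF assms]
  have "((\<lambda>t. (a + b + 1) * cos t + (a - b)) has_real_derivative (- (a + b + 1) * sin t)) (at t)"
    by (auto intro!: derivative_eq_intros simp: algebra_simps)
  moreover have "((\<lambda>t. 2 * sin t) has_real_derivative 2 * cos t) (at t)"
    by (auto intro!: derivative_eq_intros)
  moreover have "2 * sin t \<noteq> 0" using c by simp
  ultimately have "(jg a b has_real_derivative ((- (a + b + 1) * sin t) * (2 * sin t) - ((a + b + 1) * cos t + (a - b)) * (2 * cos t)) / ((2 * sin t) * (2 * sin t))) (at t)"
    unfolding jg_def[abs_def] by (rule DERIV_divide)
  moreover have "(- (a + b + 1) * sin t) * (2 * sin t) - ((a + b + 1) * cos t + (a - b)) * (2 * cos t)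
     = 2 * - ((a + b + 1) * ((sin t)\<^sup>2 + (cos t)\<^sup>2) + (a - b) * cos t)"
  proof -
    have "(- (a + b + 1) * S) * (2 * S) - ((a + b + 1) * C + (a - b)) * (2 * C)
     = 2 * - ((a + b + 1) * (S\<^sup>2 + C\<^sup>2) + (a - b) * C)" for S C :: real
      by (simp add: power2_eq_square algebra_simps)
    then show ?thesis .
  qed
  then have "((- (a + b + 1) * sin t) * (2 * sin t) - ((a + b + 1) * cos t + (a - b)) * (2 * cos t)) / ((2 * sin t) * (2 * sin t))
     = (2 * - ((a + b + 1) + (a - b) * cos t)) / (2 * (2 * (sin t)\<^sup>2))"
    by (simp only: sin_cos_squared_add mult_1_right) (simp add: power2_eq_square mult_ac)
  then have "((- (a + b + 1) * sin t) * (2 * sin t) - ((a + b + 1) * cos t + (a - b)) * (2 * cos t)) / ((2 * sin t) * (2 * sin t)) = jg' a b t"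
    unfolding jg'_def by (simp only: mult_divide_mult_cancel_left_if) simp
  ultimately show ?thesis by simp
qed

lemma ju_deriv:
  assumes ode: "jacobi_ode a b l P P'" and t: "0 < t" "t < pi"
  shows "(ju a b P has_real_derivative jdu a b P P' t) (at t)"
proof -
  have "(P has_real_derivative P' (cos t)) (at (cos t))" using ode by (simp add: jacobi_ode_def)
  then have "((\<lambda>t. P (cos t)) has_real_derivative P' (cos t) * (- sin t)) (at t)"
    by (rule DERIV_chain2) (auto intro!: derivative_eq_intros)
  from DERIV_mult[OF jrho_deriv[OF t, of a b] this] show ?thesis
    unfolding ju_def[abs_def] by (rule DERIV_cong) (simp add: jdu_def ju_def jv_def algebra_simps)
qed

text \<open>Together with \<open>u' = g u + v\<close> this is a first-order system in which
  \<open>jg\<close> occurs with opposite signs, so it cancels in the Wronskian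
  \<open>u_Q v_P - u_P v_Q\<close>. That is the reason for working with \<open>jv\<close> beside
  \<open>jdu\<close>.\<close>

lemma jv_deriv:
  assumes ode: "jacobi_ode a b l P P'" and t: "0 < t" "t < pi"
  shows "(jv a b P' has_real_derivative - jg a b t * jv a b P' t - l * ju a b P t) (at t)"
proof -
  note c = cos_bounds_0_pi[OF t]
  obtain D where D: "(P' has_real_derivative D) (at (cos t))"
    "(1 - (cos t)\<^sup>2) * D + (b - a - (a + b + 2) * cos t) * P' (cos t) + l * P (cos t) = 0"
    using ode unfolding jacobi_ode_def by blast
  have "((\<lambda>t. P' (cos t)) has_real_derivative D * (- sin t)) (at t)"
    using D(1) by (rule DERIV_chain2) (auto intro!: derivative_eq_intros)
  from DERIV_minus[OF DERIV_mult[OF DERIV_mult[OF jrho_deriv[OF t, of a b] DERIV_sin] this]]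
  have "(jv a b P' has_real_derivative - ((jg a b t * jrho a b t * sin t + cos t * jrho a b t) * P' (cos t) + D * (- sin t) * (jrho a b t * sin t))) (at t)"
    unfolding jv_def[abs_def] by simp
  moreover have "- ((jg a b t * jrho a b t * sin t + cos t * jrho a b t) * P' (cos t) + D * (- sin t) * (jrho a b t * sin t))
     = - jg a b t * jv a b P' t - l * ju a b P t"
  proof -
    have g: "2 * (jg a b t * sin t) = (a + b + 1) * cos t + (a - b)" using c by (simp add: jg_def)
    have "(sin t * sin t) * D = - (b - a - (a + b + 2) * cos t) * P' (cos t) - l * P (cos t)"
      using D(2) unfolding sin_squared_eq[symmetric] by (simp add: power2_eq_square algebra_simps)
    also have "b - a - (a + b + 2) * cos t = - (2 * (jg a b t * sin t)) - cos t" unfolding g by (simp add: algebra_simps)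
    finally have e: "(sin t * sin t) * D = (2 * (jg a b t * sin t) + cos t) * P' (cos t) - l * P (cos t)" by simp
    have "- ((jg a b t * jrho a b t * sin t + cos t * jrho a b t) * P' (cos t) + D * (- sin t) * (jrho a b t * sin t))
      = jrho a b t * ((sin t * sin t) * D - (jg a b t * sin t + cos t) * P' (cos t))"
      by (simp add: algebra_simps)
    also have "\<dots> = - jg a b t * jv a b P' t - l * ju a b P t"
      unfolding e by (simp add: jv_def ju_def algebra_simps)
    finally show ?thesis .
  qed
  ultimately show ?thesis by simp
qed

lemma jdu_deriv:
  assumes ode: "jacobi_ode a b l P P'" and t: "0 < t" "t < pi"
  shows "(jdu a b P P' has_real_derivative - jq a b l t * ju a b P t) (at t)"
  unfolding jdu_def[abs_def]
  by (rule DERIV_cong[OF DERIV_add[OF DERIV_mult[OF jg_deriv[OF t] ju_deriv[OF ode t]] jv_deriv[OF ode t]]])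
     (simp add: jq_def jdu_def power2_eq_square algebra_simps)

text \<open>The eigenvalue \<open>n * (n + a + b + 1)\<close> after completing the square with
  \<open>N = n + (a + b + 1) / 2\<close>. With a real parameter \<open>N\<close> the estimates are
  uniform in the frequency by their form.\<close>

abbreviation jeig :: "real \<Rightarrow> real \<Rightarrow> real \<Rightarrow> real" where
  "jeig a b N \<equiv> N\<^sup>2 - ((a + b + 1) / 2)\<^sup>2"

text \<open>\<open>jM\<close> bounds the numerators of \<open>jg\<close> and \<open>jg'\<close>. The
  three summands of \<open>jK\<close> come from the shift of the eigenvalue, from \<open>jg'\<close>
  and from the square of \<open>jg\<close>.\<close>

definition jM :: "real \<Rightarrow> real \<Rightarrow> real" where "jM a b = \<bar>a + b + 1\<bar> + \<bar>a - b\<bar>"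
definition jK :: "real \<Rightarrow> real \<Rightarrow> real" where "jK a b = ((a + b + 1) / 2)\<^sup>2 + jM a b / 2 + (jM a b)\<^sup>2 / 4"

lemma jK_nonneg: "jK a b \<ge> 0" and jM_nonneg: "jM a b \<ge> 0"
  by (auto simp: jK_def jM_def)

lemma jg_bound:
  assumes "0 < t" "t < pi"
  shows "\<bar>jg a b t\<bar> \<le> jM a b / (2 * sin t)"
proof -
  have "\<bar>(a + b + 1) * cos t + (a - b)\<bar> \<le> \<bar>a + b + 1\<bar> * \<bar>cos t\<bar> + \<bar>a - b\<bar>"
    by (metis abs_mult abs_triangle_ineq)
  also have "\<dots> \<le> jM a b" unfolding jM_def by (simp add: mult_left_le)
  finally show ?thesis unfolding jg_def abs_divide using cos_bounds_0_pi(3)[OF assms]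
    by (simp add: divide_right_mono)
qed

lemma jq_bound:
  assumes t: "0 < t" "t < pi"
  shows "\<bar>jq a b (jeig a b N) t - N\<^sup>2\<bar> \<le> jK a b / (sin t)\<^sup>2"
proof -
  note s = cos_bounds_0_pi(3)[OF t]
  have s1: "0 < (sin t)\<^sup>2" "(sin t)\<^sup>2 \<le> 1" using s by (auto simp: abs_square_le_1)
  have "((a + b + 1) / 2)\<^sup>2 \<le> ((a + b + 1) / 2)\<^sup>2 / (sin t)\<^sup>2"
    using s1 by (simp add: pos_le_divide_eq mult_left_le)
  moreover have "\<bar>jg' a b t\<bar> \<le> (jM a b / 2) / (sin t)\<^sup>2"
  proof -
    have "\<bar>(a + b + 1) + (a - b) * cos t\<bar> \<le> \<bar>a + b + 1\<bar> + \<bar>a - b\<bar> * \<bar>cos t\<bar>"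
      by (metis abs_mult abs_triangle_ineq)
    also have "\<dots> \<le> jM a b" unfolding jM_def by (simp add: mult_left_le)
    finally show ?thesis unfolding jg'_def abs_divide using s1
      by (simp add: divide_right_mono)
  qed
  moreover have "(jg a b t)\<^sup>2 \<le> ((jM a b)\<^sup>2 / 4) / (sin t)\<^sup>2"
  proof -
    have "\<bar>jg a b t\<bar>\<^sup>2 \<le> (jM a b / (2 * sin t))\<^sup>2" using jg_bound[OF t] by (intro power_mono) auto
    then show ?thesis by (simp add: power_divide power_mult_distrib)
  qed
  ultimately have "\<bar>jq a b (jeig a b N) t - N\<^sup>2\<bar> \<le>
     ((a + b + 1) / 2)\<^sup>2 / (sin t)\<^sup>2 + (jM a b / 2) / (sin t)\<^sup>2 + ((jM a b)\<^sup>2 / 4) / (sin t)\<^sup>2"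
    unfolding jq_def using zero_le_power2[of "jg a b t"] zero_le_power2[of "(a + b + 1) / 2"] by linarith
  then show ?thesis by (simp add: jK_def add_divide_distrib)
qed

section \<open>The energy and its growth\<close>

text \<open>The energy of an oscillator of frequency \<open>N\<close>; it would be constant if
  \<open>jq\<close> were equal to \<open>N^2\<close>.\<close>

definition jS :: "real \<Rightarrow> real \<Rightarrow> real \<Rightarrow> (real \<Rightarrow> real) \<Rightarrow> (real \<Rightarrow> real) \<Rightarrow> real \<Rightarrow> real" where
  "jS a b N P P' t = (ju a b P t)\<^sup>2 + (jdu a b P P' t / N)\<^sup>2"

lemma jS_nonneg: "jS a b N P P' t \<ge> 0" by (simp add: jS_def)

text \<open>The derivative is \<open>2 u u' (1 - q / N^2)\<close>. Here
  \<open>\<bar>2 u u'\<bar>\<close> costs a factor \<open>N\<close> and the deviation of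
  \<open>q\<close> gains \<open>N^2\<close>; the remaining \<open>1 / N\<close> is what keeps the
  growth bounded down to distance of order \<open>1 / N\<close> from the endpoints.\<close>

lemma jS_deriv:
  assumes ode: "jacobi_ode a b (jeig a b N) P P'" and N: "N \<ge> 1" and t: "0 < t" "t < pi"
  obtains D where "(jS a b N P P' has_real_derivative D) (at t)" "\<bar>D\<bar> \<le> jK a b / (N * (sin t)\<^sup>2) * jS a b N P P' t"
proof
  let ?q = "jq a b (jeig a b N) t" and ?u = "ju a b P t" and ?d = "jdu a b P P' t"
  show "(jS a b N P P' has_real_derivative (2 * ?u * ?d * (1 - ?q / N\<^sup>2))) (at t)"
    unfolding jS_def[abs_def] using N
    by (auto intro!: derivative_eq_intros ju_deriv[OF ode t] jdu_deriv[OF ode t] simp: power2_eq_square field_simps)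
  have "\<bar>1 - ?q / N\<^sup>2\<bar> = \<bar>?q - N\<^sup>2\<bar> / N\<^sup>2" using N by (simp add: field_simps abs_if)
  also have "\<dots> \<le> jK a b / (sin t)\<^sup>2 / N\<^sup>2" by (intro divide_right_mono jq_bound t) auto
  finally have 1: "\<bar>1 - ?q / N\<^sup>2\<bar> \<le> jK a b / (sin t)\<^sup>2 / N\<^sup>2" .
  have "\<bar>?u * (?d / N)\<bar> * 2 \<le> jS a b N P P' t"
    unfolding jS_def using sum_squares_bound[of "\<bar>?u\<bar>" "\<bar>?d / N\<bar>"] by (simp add: abs_mult mult_ac power_divide)
  then have 2: "\<bar>2 * ?u * ?d\<bar> \<le> N * jS a b N P P' t" using N by (simp add: abs_mult field_simps)
  have "\<bar>2 * ?u * ?d * (1 - ?q / N\<^sup>2)\<bar> = \<bar>2 * ?u * ?d\<bar> * \<bar>1 - ?q / N\<^sup>2\<bar>" by (rule abs_mult)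
  also have "\<dots> \<le> (N * jS a b N P P' t) * (jK a b / (sin t)\<^sup>2 / N\<^sup>2)"
    by (rule mult_mono[OF 2 1]) (use N jS_nonneg in auto)
  also have "\<dots> = jK a b / (N * (sin t)\<^sup>2) * jS a b N P P' t" using N by (simp add: power2_eq_square field_simps)
  finally show "\<bar>2 * ?u * ?d * (1 - ?q / N\<^sup>2)\<bar> \<le> jK a b / (N * (sin t)\<^sup>2) * jS a b N P P' t" .
qed

text \<open>Gronwall: \<open>- cot\<close> is the primitive of \<open>1 / sin\<^sup>2\<close>.\<close>
lemma jS_compare:
  assumes ode: "jacobi_ode a b (jeig a b N) P P'" and N: "N \<ge> 1"
    and st: "0 < s" "s \<le> t" "t < pi"
  shows "jS a b N P P' s \<le> jS a b N P P' t * exp (jK a b / N * (cot s - cot t))"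
    and "jS a b N P P' t \<le> jS a b N P P' s * exp (jK a b / N * (cot s - cot t))"
proof -
  let ?S = "jS a b N P P'" and ?k = "jK a b / N"
  \<comment> \<open>One derivative serves both directions: for \<open>e = -1\<close> the product is
    nondecreasing, for \<open>e = 1\<close> nonincreasing.\<close>
  have ex: "\<exists>D. ((\<lambda>x. ?S x * exp (e * ?k * cot x)) has_real_derivative (D - e * ?k / (sin x)\<^sup>2 * ?S x) * exp (e * ?k * cot x)) (at x)
      \<and> \<bar>D\<bar> \<le> ?k / (sin x)\<^sup>2 * ?S x" if x: "s \<le> x" "x \<le> t" for x e
  proof -
    have x': "0 < x" "x < pi" using x st by auto
    obtain D where D: "(?S has_real_derivative D) (at x)" "\<bar>D\<bar> \<le> jK a b / (N * (sin x)\<^sup>2) * ?S x"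
      using jS_deriv[OF ode N x'] by blast
    have s: "sin x \<noteq> 0" using cos_bounds_0_pi[OF x'] by simp
    have "((\<lambda>x. exp (c * cot x)) has_real_derivative exp (c * cot x) * (c * (- inverse ((sin x)\<^sup>2)))) (at x)" for c
      using s by (auto intro!: derivative_eq_intros DERIV_cot)
    note this[of "e * ?k"]
    have N0: "N \<noteq> 0" using N by simp
    from DERIV_mult[OF D(1) \<open>((\<lambda>x. exp (e * ?k * cot x)) has_real_derivative _) (at x)\<close>]
    have "((\<lambda>x. ?S x * exp (e * ?k * cot x)) has_real_derivative (D - e * ?k / (sin x)\<^sup>2 * ?S x) * exp (e * ?k * cot x)) (at x)"
      by (rule DERIV_cong) (use N0 s in \<open>simp add: field_simps\<close>)
    then show ?thesis using D(2) by auto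
  qed
  have "?S s * exp (-1 * ?k * cot s) \<le> ?S t * exp (-1 * ?k * cot t)"
  proof (rule DERIV_nonneg_imp_nondecreasing[OF st(2)])
    fix x assume x: "s \<le> x" "x \<le> t"
    from ex[OF x, of "-1"] obtain D where D: "((\<lambda>x. ?S x * exp (-1 * ?k * cot x)) has_real_derivative (D - (-1) * ?k / (sin x)\<^sup>2 * ?S x) * exp (-1 * ?k * cot x)) (at x)"
      "\<bar>D\<bar> \<le> ?k / (sin x)\<^sup>2 * ?S x" by blast
    have "0 \<le> (D - (-1) * ?k / (sin x)\<^sup>2 * ?S x) * exp (-1 * ?k * cot x)"
      using D(2) by (intro mult_nonneg_nonneg) auto
    then show "\<exists>y. ((\<lambda>x. ?S x * exp (-1 * ?k * cot x)) has_real_derivative y) (at x) \<and> 0 \<le> y" using D(1) by blast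
  qed
  then have "?S s * exp (-1 * ?k * cot s) * exp (?k * cot s) \<le> ?S t * exp (-1 * ?k * cot t) * exp (?k * cot s)"
    by (rule mult_right_mono) simp
  then show "?S s \<le> ?S t * exp (?k * (cot s - cot t))"
    by (simp add: mult.assoc exp_add[symmetric] algebra_simps diff_divide_distrib)
  have "?S s * exp (1 * ?k * cot s) \<ge> ?S t * exp (1 * ?k * cot t)"
  proof (rule DERIV_nonpos_imp_nonincreasing[OF st(2)])
    fix x assume x: "s \<le> x" "x \<le> t"
    from ex[OF x, of "1"] obtain D where D: "((\<lambda>x. ?S x * exp (1 * ?k * cot x)) has_real_derivative (D - 1 * ?k / (sin x)\<^sup>2 * ?S x) * exp (1 * ?k * cot x)) (at x)"
      "\<bar>D\<bar> \<le> ?k / (sin x)\<^sup>2 * ?S x" by blast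
    have "(D - 1 * ?k / (sin x)\<^sup>2 * ?S x) * exp (1 * ?k * cot x) \<le> 0"
      using D(2) by (intro mult_nonpos_nonneg) auto
    then show "\<exists>y. ((\<lambda>x. ?S x * exp (1 * ?k * cot x)) has_real_derivative y) (at x) \<and> y \<le> 0" using D(1) by blast
  qed
  then have "?S t * exp (1 * ?k * cot t) * exp (- (?k * cot t)) \<le> ?S s * exp (1 * ?k * cot s) * exp (- (?k * cot t))"
    by (rule mult_right_mono) simp
  then show "?S t \<le> ?S s * exp (?k * (cot s - cot t))"
    by (simp add: mult.assoc exp_add[symmetric] algebra_simps diff_divide_distrib)
qed

section \<open>Weighted means of the energy over a fixed interval\<close>

text \<open>The zeros at \<open>s\<close> and \<open>t\<close> are double, so the function and its
  derivative vanish there and partial integration leaves no boundary terms.\<close>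

definition bump :: "real \<Rightarrow> real \<Rightarrow> real \<Rightarrow> real" where "bump s t x = (x - s)\<^sup>2 * (t - x)\<^sup>2"
definition bump' :: "real \<Rightarrow> real \<Rightarrow> real \<Rightarrow> real" where "bump' s t x = 2 * (x - s) * (t - x)\<^sup>2 - 2 * (x - s)\<^sup>2 * (t - x)"
definition bump'' :: "real \<Rightarrow> real \<Rightarrow> real \<Rightarrow> real" where
  "bump'' s t x = 2 * (t - x)\<^sup>2 - 8 * (x - s) * (t - x) + 2 * (x - s)\<^sup>2"

lemma bump_deriv: "(bump s t has_real_derivative bump' s t x) (at x within A)"
  unfolding bump_def[abs_def] bump'_def by (auto intro!: derivative_eq_intros simp: power2_eq_square algebra_simps)

lemma bump'_deriv: "(bump' s t has_real_derivative bump'' s t x) (at x within A)"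
  unfolding bump'_def[abs_def] bump''_def by (auto intro!: derivative_eq_intros simp: power2_eq_square algebra_simps)

text \<open>The integrand is the derivative of \<open>bump u u' - bump' u^2 / 2\<close>. In the mean
  it trades \<open>u'^2\<close> for \<open>q u^2\<close>, so the norm of \<open>u\<close> in
  \<open>L^2\<close> controls the derivative as well.\<close>

lemma bump_identity:
  assumes ode: "jacobi_ode a b l P P'" and st: "0 < s" "s \<le> t" "t < pi"
  shows "((\<lambda>x. bump s t x * (jdu a b P P' x)\<^sup>2 - (jq a b l x * bump s t x + bump'' s t x / 2) * (ju a b P x)\<^sup>2) has_integral 0) {s..t}"
proof -
  define F where "F = (\<lambda>x. bump s t x * (ju a b P x * jdu a b P P' x) - bump' s t x / 2 * (ju a b P x)\<^sup>2)"
  have "((\<lambda>x. bump s t x * (jdu a b P P' x)\<^sup>2 - (jq a b l x * bump s t x + bump'' s t x / 2) * (ju a b P x)\<^sup>2) has_integral (F t - F s)) {s..t}"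
  proof (rule fundamental_theorem_of_calculus[OF st(2)])
    fix x assume x: "x \<in> {s..t}"
    then have x': "0 < x" "x < pi" using st by auto
    have "(F has_real_derivative bump s t x * (jdu a b P P' x)\<^sup>2 - (jq a b l x * bump s t x + bump'' s t x / 2) * (ju a b P x)\<^sup>2) (at x)"
      unfolding F_def
      by (auto intro!: derivative_eq_intros bump_deriv bump'_deriv ju_deriv[OF ode x'] jdu_deriv[OF ode x'] simp: power2_eq_square algebra_simps)
    then show "(F has_vector_derivative bump s t x * (jdu a b P P' x)\<^sup>2 - (jq a b l x * bump s t x + bump'' s t x / 2) * (ju a b P x)\<^sup>2) (at x within {s..t})"
      by (simp add: has_real_derivative_iff_has_vector_derivative[symmetric] has_field_derivative_at_within)
  qed
  moreover have "F t = 0" "F s = 0" by (auto simp: F_def bump_def bump'_def)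
  ultimately show ?thesis by simp
qed

lemma ju_continuous_on:
  assumes ode: "jacobi_ode a b l P P'" and A: "A \<subseteq> {0<..<pi}"
  shows "continuous_on A (ju a b P)" "continuous_on A (jdu a b P P')" "continuous_on A (jv a b P')" "continuous_on A (jg a b)" "continuous_on A (jg' a b)"
proof -
  show "continuous_on A (ju a b P)" "continuous_on A (jdu a b P P')" "continuous_on A (jv a b P')" "continuous_on A (jg a b)"
    using A by (auto intro!: continuous_at_imp_continuous_on DERIV_isCont[OF ju_deriv[OF ode]] DERIV_isCont[OF jdu_deriv[OF ode]]
      DERIV_isCont[OF jv_deriv[OF ode]] DERIV_isCont[OF jg_deriv])
  show "continuous_on A (jg' a b)"
    unfolding jg'_def[abs_def] using A cos_bounds_0_pi(3) by (intro continuous_intros) (auto simp: less_le)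
qed

text \<open>The weight and the Jacobian of \<open>x = cos t\<close> combine to the square of
  \<open>jrho\<close>. The limits stay inside \<open>(0, pi)\<close> because the weight may be
  singular at the ends.\<close>

lemma integral_ju_prod:
  assumes Pc: "continuous_on UNIV P" and Qc: "continuous_on UNIV Q" and st: "0 < s" "s \<le> t" "t < pi"
  shows "integral {s..t} (\<lambda>x. ju a b P x * ju a b Q x) = integral {cos t..cos s} (\<lambda>x. P x * Q x * jacobi_weight a b x)"
proof -
  define f where "f = (\<lambda>x. P x * Q x * jacobi_weight a b x)"
  define H where "H = (\<lambda>y. integral {cos t..y} f)"
  have ct: "cos t \<le> cos s" using st by (intro cos_monotone_0_pi_le) auto
  have bnd: "-1 < cos t" "cos s < 1" using cos_bounds_0_pi[of t] cos_bounds_0_pi[of s] st by auto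
  have fc: "continuous_on {cos t..cos s} f"
    unfolding f_def jacobi_weight_def using bnd by (intro continuous_intros continuous_on_subset[OF Pc] continuous_on_subset[OF Qc]) auto
  have Hd: "(H has_real_derivative f y) (at y within {cos t..cos s})" if "y \<in> {cos t..cos s}" for y
    unfolding H_def using integral_has_real_derivative[OF fc that] .
  have "((\<lambda>x. ju a b P x * ju a b Q x) has_integral ((- H (cos t)) - (- H (cos s)))) {s..t}"
  proof (rule fundamental_theorem_of_calculus[OF st(2)])
    fix x assume x: "x \<in> {s..t}"
    then have x': "0 < x" "x < pi" using st by auto
    have im: "cos ` {s..t} \<subseteq> {cos t..cos s}" using st by (auto intro!: cos_monotone_0_pi_le)
    have "(H has_real_derivative f (cos x)) (at (cos x) within cos ` {s..t})"
      using imageI[OF x, of cos] im by (intro has_field_derivative_subset[OF Hd]) blast+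
    then have "((H \<circ> cos) has_real_derivative f (cos x) * (- sin x)) (at x within {s..t})"
      by (rule DERIV_image_chain) (auto intro!: derivative_eq_intros)
    then have "((\<lambda>x. - H (cos x)) has_real_derivative f (cos x) * sin x) (at x within {s..t})"
      by (auto dest: DERIV_minus simp: o_def)
    moreover have "f (cos x) * sin x = ju a b P x * ju a b Q x"
    proof -
      note c = cos_bounds_0_pi[OF x']
      have "(sin x)\<^sup>2 = (1 - cos x) * (1 + cos x)"
        using sin_squared_eq[of x] by (simp add: power2_eq_square algebra_simps)
      then have "sin x = sqrt ((1 - cos x) * (1 + cos x))" using c by (metis real_sqrt_abs abs_of_pos)
      also have "\<dots> = (1 - cos x) powr (1/2) * (1 + cos x) powr (1/2)"
        using c by (simp add: powr_half_sqrt real_sqrt_mult)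
      finally have "jacobi_weight a b (cos x) * sin x = ((1 - cos x) powr a * (1 - cos x) powr (1/2)) * ((1 + cos x) powr b * (1 + cos x) powr (1/2))"
        by (simp add: jacobi_weight_def)
      also have "\<dots> = (jrho a b x)\<^sup>2"
      proof -
        have "(y powr (c/2 + 1/4))\<^sup>2 = y powr c * y powr (1/2)" for y c :: real
          by (simp add: power2_eq_square powr_add[symmetric])
        then show ?thesis by (simp add: jrho_def power_mult_distrib)
      qed
      finally have w: "jacobi_weight a b (cos x) * sin x = (jrho a b x)\<^sup>2" .
      have "f (cos x) * sin x = P (cos x) * Q (cos x) * (jacobi_weight a b (cos x) * sin x)" by (simp add: f_def)
      then show ?thesis unfolding w by (simp add: ju_def power2_eq_square mult_ac)
    qed
    ultimately show "((\<lambda>x. - H (cos x)) has_vector_derivative ju a b P x * ju a b Q x) (at x within {s..t})"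
      by (simp add: has_real_derivative_iff_has_vector_derivative[symmetric])
  qed
  then show ?thesis by (simp add: integral_unique H_def f_def)
qed

lemma jacobi_ode_continuous:
  assumes "jacobi_ode a b l P P'"
  shows "continuous_on A P" "continuous_on A P'"
proof -
  show "continuous_on A P"
    using assms by (auto simp: jacobi_ode_def intro!: continuous_at_imp_continuous_on DERIV_isCont)
  show "continuous_on A P'"
    using assms unfolding jacobi_ode_def by (intro continuous_at_imp_continuous_on) (meson DERIV_isCont)
qed

lemma integral_ju_sq:
  assumes ode: "jacobi_ode a b l P P'" and st: "0 < s" "s \<le> t" "t < pi"
  shows "integral {s..t} (\<lambda>x. (ju a b P x)\<^sup>2) = integral {cos t..cos s} (\<lambda>x. (P x)\<^sup>2 * jacobi_weight a b x)"
  unfolding power2_eq_square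
  by (rule integral_ju_prod[OF jacobi_ode_continuous(1)[OF ode] jacobi_ode_continuous(1)[OF ode] st])

text \<open>The norm enters as an upper bound on inner intervals, in a form that passes to the
  reflected polynomial. The matching lower bound of the mass is derived separately in
  \<open>jU_mass_middle\<close>.\<close>

definition jacobi_unit :: "real \<Rightarrow> real \<Rightarrow> real \<Rightarrow> (real \<Rightarrow> real) \<Rightarrow> (real \<Rightarrow> real) \<Rightarrow> bool" where
  "jacobi_unit a b N P P' \<longleftrightarrow> jacobi_ode a b (jeig a b N) P P' \<and>
     (\<forall>c d. -1 < c \<longrightarrow> c \<le> d \<longrightarrow> d < 1 \<longrightarrow> integral {c..d} (\<lambda>x. (P x)\<^sup>2 * jacobi_weight a b x) \<le> 1)"

lemma jacobi_unit_ode: "jacobi_unit a b N P P' \<Longrightarrow> jacobi_ode a b (jeig a b N) P P'"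
  by (simp add: jacobi_unit_def)

lemma jacobi_unit_integral_le:
  assumes "jacobi_unit a b N P P'" "0 < s" "s \<le> t" "t < pi"
  shows "integral {s..t} (\<lambda>x. (ju a b P x)\<^sup>2) \<le> 1"
proof -
  have "-1 < cos t" "cos s < 1" using cos_bounds_0_pi[of t] cos_bounds_0_pi[of s] assms by auto
  moreover have "cos t \<le> cos s" using assms by (intro cos_monotone_0_pi_le) auto
  ultimately show ?thesis using assms(1) unfolding integral_ju_sq[OF jacobi_unit_ode[OF assms(1)] assms(2-4)]
    by (simp add: jacobi_unit_def)
qed

lemma sin_lower_bound:
  assumes "0 < s" "s \<le> t" "t < pi"
  obtains d where "d > 0" "\<And>x. x \<in> {s..t} \<Longrightarrow> sin x \<ge> d"
proof -
  have "\<exists>x\<in>{s..t}. \<forall>y\<in>{s..t}. sin x \<le> sin y"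
    using assms by (intro continuous_attains_inf continuous_intros) auto
  then obtain x where "x \<in> {s..t}" "\<And>y. y \<in> {s..t} \<Longrightarrow> sin x \<le> sin y" by blast
  then show ?thesis using that[of "sin x"] sin_gt_zero[of x] assms by auto
qed

lemma abs_cot_le:
  assumes "0 < t" "t < pi"
  shows "\<bar>cot t\<bar> \<le> 1 / sin t"
  using cos_bounds_0_pi(3)[OF assms] by (simp add: cot_def abs_divide divide_right_mono)

lemma bump_bounds:
  obtains B where "B \<ge> 0" "\<And>x. x \<in> {s..t} \<Longrightarrow> 0 \<le> bump s t x \<and> bump s t x \<le> B \<and> \<bar>bump'' s t x\<bar> \<le> B"
proof -
  have "bounded (bump s t ` {s..t})" "bounded (bump'' s t ` {s..t})"
    unfolding bump_def[abs_def] bump''_def[abs_def]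
    by (intro compact_imp_bounded compact_continuous_image continuous_intros; simp)+
  then obtain B1 B2 where "\<And>x. x \<in> {s..t} \<Longrightarrow> \<bar>bump s t x\<bar> \<le> B1" "\<And>x. x \<in> {s..t} \<Longrightarrow> \<bar>bump'' s t x\<bar> \<le> B2"
    unfolding bounded_iff by (metis image_eqI real_norm_def)
  then show ?thesis using that[of "max 0 (max B1 B2)"] by (fastforce simp: bump_def)
qed

lemma bump_continuous: "continuous_on A (bump s t)" "continuous_on A (bump'' s t)"
  unfolding bump_def[abs_def] bump''_def[abs_def] by (intro continuous_intros)+

lemma bump_integral_pos:
  assumes "s < t"
  shows "integral {s..t} (bump s t) > 0"
proof -
  define h where "h = (t - s) / 3"
  have h: "h > 0" "s + h + h + h = t" using assms by (auto simp: h_def field_simps)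
  have "0 < h ^ 5" using h by simp
  also have "\<dots> = integral {s + h..t - h} (\<lambda>x. h\<^sup>2 * h\<^sup>2)" using h(1) by (simp add: power_numeral_reduce algebra_simps flip: h(2))
  also have "\<dots> \<le> integral {s + h..t - h} (bump s t)"
  proof (intro integral_le integrable_continuous_interval bump_continuous continuous_on_const)
    fix x assume x: "x \<in> {s + h..t - h}"
    show "h\<^sup>2 * h\<^sup>2 \<le> bump s t x"
      unfolding bump_def by (rule mult_mono[OF power_mono power_mono]) (use h x in auto)
  qed
  also have "\<dots> \<le> integral {s..t} (bump s t)"
    using h by (intro integral_subset_le integrable_continuous_interval bump_continuous) (auto simp: bump_def)
  finally show ?thesis .
qed

lemma bump_jS_integral:
  assumes ode: "jacobi_ode a b (jeig a b N) P P'" and st: "0 < s" "s \<le> t" "t < pi"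
  shows "integral {s..t} (\<lambda>x. bump s t x * jS a b N P P' x)
    = integral {s..t} (\<lambda>x. (bump s t x + (jq a b (jeig a b N) x * bump s t x + bump'' s t x / 2) / N\<^sup>2) * (ju a b P x)\<^sup>2)"
    (is "integral _ ?f = integral _ ?g")
proof -
  have sub: "{s..t} \<subseteq> {0<..<pi}" using st by auto
  note cont = ju_continuous_on[OF ode sub] bump_continuous
  have int: "?f integrable_on {s..t}" "?g integrable_on {s..t}"
    unfolding jS_def divide_inverse jq_def by (intro integrable_continuous_interval continuous_intros cont)+
  have "((\<lambda>x. (bump s t x * (jdu a b P P' x)\<^sup>2 - (jq a b (jeig a b N) x * bump s t x + bump'' s t x / 2) * (ju a b P x)\<^sup>2) / N\<^sup>2) has_integral 0 / N\<^sup>2) {s..t}"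
    by (intro has_integral_divide bump_identity[OF ode st])
  moreover have "(\<lambda>x. (bump s t x * (jdu a b P P' x)\<^sup>2 - (jq a b (jeig a b N) x * bump s t x + bump'' s t x / 2) * (ju a b P x)\<^sup>2) / N\<^sup>2) = (\<lambda>x. ?f x - ?g x)"
    by (auto simp: jS_def power_divide algebra_simps diff_divide_distrib add_divide_distrib)
  ultimately have "integral {s..t} (\<lambda>x. ?f x - ?g x) = 0" by (simp add: integral_unique)
  then show ?thesis using int by (simp add: integral_diff)
qed

text \<open>After division by \<open>N^2\<close> the weight in front of \<open>u^2\<close> contains
  \<open>q / N^2\<close>, which on a fixed inner interval is bounded uniformly in
  \<open>N \<ge> 1\<close>.\<close>

lemma bump_jS_bound:
  assumes st: "0 < s" "s \<le> t" "t < pi"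
  obtains C where "C \<ge> 0" "\<And>N P P'. N \<ge> 1 \<Longrightarrow> jacobi_unit a b N P P' \<Longrightarrow> integral {s..t} (\<lambda>x. bump s t x * jS a b N P P' x) \<le> C"
proof -
  obtain B where B: "B \<ge> 0" "\<And>x. x \<in> {s..t} \<Longrightarrow> 0 \<le> bump s t x \<and> bump s t x \<le> B \<and> \<bar>bump'' s t x\<bar> \<le> B"
    using bump_bounds by blast
  obtain d where d: "d > 0" "\<And>x. x \<in> {s..t} \<Longrightarrow> sin x \<ge> d" using sin_lower_bound[OF st] by blast
  define C where "C = B + ((1 + jK a b / d\<^sup>2) * B + B)"
  have C: "C \<ge> 0" using B jK_nonneg[of a b] by (simp add: C_def)
  have "integral {s..t} (\<lambda>x. bump s t x * jS a b N P P' x) \<le> C" if N: "N \<ge> 1" and unit: "jacobi_unit a b N P P'" for N P P'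
  proof -
    note ode = jacobi_unit_ode[OF unit]
    have sub: "{s..t} \<subseteq> {0<..<pi}" using st by auto
    note cont = ju_continuous_on[OF ode sub] bump_continuous
    let ?q = "jq a b (jeig a b N)"
    have N2: "N\<^sup>2 \<ge> 1" using N by simp
    have "integral {s..t} (\<lambda>x. (bump s t x + (?q x * bump s t x + bump'' s t x / 2) / N\<^sup>2) * (ju a b P x)\<^sup>2)
       \<le> integral {s..t} (\<lambda>x. C * (ju a b P x)\<^sup>2)"
    proof (rule integral_le)
      show "(\<lambda>x. (bump s t x + (?q x * bump s t x + bump'' s t x / 2) / N\<^sup>2) * (ju a b P x)\<^sup>2) integrable_on {s..t}"
        unfolding divide_inverse jq_def by (intro integrable_continuous_interval continuous_intros cont)
      show "(\<lambda>x. C * (ju a b P x)\<^sup>2) integrable_on {s..t}"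
        by (intro integrable_continuous_interval continuous_intros cont)
      fix x assume x: "x \<in> {s..t}"
      have x': "0 < x" "x < pi" using x st by auto
      have "jK a b / (sin x)\<^sup>2 \<le> jK a b / d\<^sup>2"
        using d d(2)[OF x] jK_nonneg[of a b] by (intro divide_left_mono power_mono) auto
      moreover have "jK a b / d\<^sup>2 \<le> N\<^sup>2 * (jK a b / d\<^sup>2)" using mult_right_mono[OF N2, of "jK a b / d\<^sup>2"] jK_nonneg[of a b] by simp
      ultimately have q: "?q x \<le> N\<^sup>2 * (1 + jK a b / d\<^sup>2)"
        using jq_bound[OF x', of a b N] by (simp add: distrib_left)
      have "?q x * bump s t x \<le> (N\<^sup>2 * (1 + jK a b / d\<^sup>2)) * bump s t x" using q B(2)[OF x] by (intro mult_right_mono) auto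
      also have "\<dots> \<le> (N\<^sup>2 * (1 + jK a b / d\<^sup>2)) * B" using B(2)[OF x] jK_nonneg[of a b] by (intro mult_left_mono) auto
      finally have 1: "?q x * bump s t x \<le> N\<^sup>2 * ((1 + jK a b / d\<^sup>2) * B)" by (simp add: mult.assoc)
      have "bump'' s t x / 2 \<le> B" using B(2)[OF x] B(1) by linarith
      also have "B \<le> N\<^sup>2 * B" using N2 B(1) by (simp add: mult_le_cancel_right1)
      finally have "(?q x * bump s t x + bump'' s t x / 2) \<le> N\<^sup>2 * ((1 + jK a b / d\<^sup>2) * B + B)"
        using 1 by (simp add: distrib_left)
      then have "(?q x * bump s t x + bump'' s t x / 2) / N\<^sup>2 \<le> (1 + jK a b / d\<^sup>2) * B + B"
        using N by (simp add: divide_le_eq mult.commute)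
      then have "bump s t x + (?q x * bump s t x + bump'' s t x / 2) / N\<^sup>2 \<le> C" using B(2)[OF x] by (simp add: C_def)
      then show "(bump s t x + (?q x * bump s t x + bump'' s t x / 2) / N\<^sup>2) * (ju a b P x)\<^sup>2 \<le> C * (ju a b P x)\<^sup>2"
        by (rule mult_right_mono) simp
    qed
    also have "\<dots> = C * integral {s..t} (\<lambda>x. (ju a b P x)\<^sup>2)" by simp
    also have "\<dots> \<le> C" using jacobi_unit_integral_le[OF unit st] C by (simp add: mult_left_le)
    finally show ?thesis unfolding bump_jS_integral[OF ode st] .
  qed
  then show ?thesis using that C by blast
qed

text \<open>The energy at \<open>t\<close> is compared with the energy at every \<open>x\<close> of
  a reference interval, and the comparison is averaged with the bump. Only the factor with
  \<open>cot t\<close> depends on \<open>t\<close>; it is bounded as long as \<open>t\<close> is at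
  least of order \<open>1 / N\<close>.\<close>

lemma jS_upper_bound:
  obtains C where "C \<ge> 0" "\<And>N P P' t. N \<ge> 1 \<Longrightarrow> jacobi_unit a b N P P' \<Longrightarrow> 0 < t \<Longrightarrow> t \<le> pi / 2 \<Longrightarrow>
     jS a b N P P' t \<le> C * exp (jK a b / N * cot t)"
proof -
  \<comment> \<open>The reference interval lies to the right of every admissible \<open>t\<close>,
    so the energy is always transported in the same direction.\<close>
  define s e where "s = pi / 2" and "e = 3 * pi / 4"
  have se: "0 < s" "s < e" "e < pi" by (auto simp: s_def e_def)
  obtain C where C: "C \<ge> 0" "\<And>N P P'. N \<ge> 1 \<Longrightarrow> jacobi_unit a b N P P' \<Longrightarrow> integral {s..e} (\<lambda>x. bump s e x * jS a b N P P' x) \<le> C"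
    using bump_jS_bound[of s e a b] se by (auto simp: less_imp_le)
  obtain d where d: "d > 0" "\<And>x. x \<in> {s..e} \<Longrightarrow> sin x \<ge> d" using sin_lower_bound[of s e] se by (auto simp: less_imp_le)
  define I where "I = integral {s..e} (bump s e)"
  have I: "I > 0" unfolding I_def by (rule bump_integral_pos[OF se(2)])
  define E where "E = exp (jK a b / d)"
  have "jS a b N P P' t \<le> (C * E / I) * exp (jK a b / N * cot t)"
    if N: "N \<ge> 1" and unit: "jacobi_unit a b N P P'" and t: "0 < t" "t \<le> pi / 2" for N P P' t
  proof -
    note ode = jacobi_unit_ode[OF unit]
    have sub: "{s..e} \<subseteq> {0<..<pi}" using se by auto
    note cont = ju_continuous_on[OF ode sub] bump_continuous
    have "jS a b N P P' t * I = integral {s..e} (\<lambda>x. jS a b N P P' t * bump s e x)" by (simp add: I_def)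
    also have "\<dots> \<le> integral {s..e} (\<lambda>x. (E * exp (jK a b / N * cot t)) * (bump s e x * jS a b N P P' x))"
    proof (rule integral_le)
      show "(\<lambda>x. jS a b N P P' t * bump s e x) integrable_on {s..e}"
        by (intro integrable_continuous_interval continuous_intros cont)
      show "(\<lambda>x. (E * exp (jK a b / N * cot t)) * (bump s e x * jS a b N P P' x)) integrable_on {s..e}"
        unfolding jS_def divide_inverse by (intro integrable_continuous_interval continuous_intros cont)
      fix x assume x: "x \<in> {s..e}"
      have x': "0 < x" "x < pi" "t \<le> x" using x se t by (auto simp: s_def)
      have "jS a b N P P' t \<le> jS a b N P P' x * exp (jK a b / N * (cot t - cot x))"
        by (rule jS_compare(1)[OF ode N t(1) x'(3,2)])
      also have "\<dots> \<le> jS a b N P P' x * (E * exp (jK a b / N * cot t))"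
      proof (intro mult_left_mono jS_nonneg)
        have "- cot x \<le> 1 / sin x" using abs_cot_le[OF x'(1,2)] by linarith
        also have "\<dots> \<le> 1 / d" using d d(2)[OF x] by (intro divide_left_mono) auto
        finally have "jK a b / N * (- cot x) \<le> jK a b / N * (1 / d)"
          using N jK_nonneg by (intro mult_left_mono) auto
        also have "\<dots> \<le> jK a b / 1 * (1 / d)"
          using N d jK_nonneg by (intro mult_right_mono divide_left_mono) auto
        finally have "jK a b / N * (cot t - cot x) \<le> jK a b / d + jK a b / N * cot t" by (simp add: algebra_simps diff_divide_distrib)
        then show "exp (jK a b / N * (cot t - cot x)) \<le> E * exp (jK a b / N * cot t)"
          unfolding E_def exp_add[symmetric] by simp
      qed
      finally have "jS a b N P P' t * bump s e x \<le> (jS a b N P P' x * (E * exp (jK a b / N * cot t))) * bump s e x"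
        by (rule mult_right_mono) (simp add: bump_def)
      then show "jS a b N P P' t * bump s e x \<le> (E * exp (jK a b / N * cot t)) * (bump s e x * jS a b N P P' x)"
        by (simp add: mult_ac)
    qed
    also have "\<dots> = (E * exp (jK a b / N * cot t)) * integral {s..e} (\<lambda>x. bump s e x * jS a b N P P' x)"
      by (rule integral_mult_right)
    also have "\<dots> \<le> (E * exp (jK a b / N * cot t)) * C"
      using C(2)[OF N unit] by (intro mult_left_mono) (auto simp: E_def)
    finally show ?thesis using I by (simp add: field_simps)
  qed
  moreover have "C * E / I \<ge> 0" using C I by (simp add: E_def)
  ultimately show ?thesis using that by blast
qed

section \<open>The caps next to the endpoints\<close>

text \<open>Integrating \<open>((1 - x\<^sup>2) w P')' = - l w P\<close> from \<open>x\<close> to \<open>1\<close>, where the left factor vanishes.\<close>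
lemma jacobi_deriv_bound:
  assumes ode: "jacobi_ode a b l P P'" and ab: "a > -1" "b > -1" and l: "l \<ge> 0"
    and x0: "0 \<le> x0" and M: "\<And>x. x0 \<le> x \<Longrightarrow> x \<le> 1 \<Longrightarrow> \<bar>P x\<bar> \<le> M" and x: "x0 \<le> x" "x < 1"
  shows "\<bar>P' x\<bar> \<le> l * M * (2 powr \<bar>b\<bar> / (a + 1))"
proof -
  define B where "B = 2 powr \<bar>b\<bar>"
  define W where "W = (\<lambda>y. (1 - y) powr (a + 1) * (1 + y) powr (b + 1))"
  note P'c = jacobi_ode_continuous(2)[OF ode]
  have p1: "continuous_on {x..1} (\<lambda>y. (1 - y) powr (a + 1))"
    using ab by (intro continuous_on_powr' continuous_intros) auto
  have Wc: "continuous_on {x..1} W"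
    unfolding W_def using ab x x0 by (intro continuous_on_mult p1 continuous_on_powr' continuous_intros) auto
  have Wd: "((\<lambda>y. W y * P' y) has_real_derivative - l * (jacobi_weight a b y * P y)) (at y)" if y: "x < y" "y < 1" for y
  proof -
    have y': "0 < 1 - y" "0 < 1 + y" using y x x0 by auto
    obtain D where D: "(P' has_real_derivative D) (at y)"
      "(1 - y\<^sup>2) * D + (b - a - (a + b + 2) * y) * P' y + l * P y = 0"
      using ode unfolding jacobi_ode_def by blast
    have pw: "(1 - y) powr (a + 1) = (1 - y) powr a * (1 - y)" "(1 + y) powr (b + 1) = (1 + y) powr b * (1 + y)"
      using y' by (simp_all add: powr_add)
    have "(W has_real_derivative ((- (a + 1) * (1 - y) powr a) * (1 + y) powr (b + 1) + ((b + 1) * (1 + y) powr b) * (1 - y) powr (a + 1))) (at y)"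
      unfolding W_def
    proof (rule DERIV_mult)
      show "((\<lambda>y. (1 - y) powr (a + 1)) has_real_derivative - (a + 1) * (1 - y) powr a) (at y)"
        using y' by (auto intro!: derivative_eq_intros simp: powr_diff algebra_simps pw)
      show "((\<lambda>y. (1 + y) powr (b + 1)) has_real_derivative (b + 1) * (1 + y) powr b) (at y)"
        using y' by (auto intro!: derivative_eq_intros simp: powr_diff algebra_simps pw)
    qed
    then have "((\<lambda>y. W y * P' y) has_real_derivative ((- (a + 1) * (1 - y) powr a) * (1 + y) powr (b + 1) + ((b + 1) * (1 + y) powr b) * (1 - y) powr (a + 1)) * P' y + D * W y) (at y)"
      using D(1) by (rule DERIV_mult)
    moreover have "((- (a + 1) * (1 - y) powr a) * (1 + y) powr (b + 1) + ((b + 1) * (1 + y) powr b) * (1 - y) powr (a + 1)) * P' y + D * W y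
       = jacobi_weight a b y * ((1 - y\<^sup>2) * D + (b - a - (a + b + 2) * y) * P' y)"
      unfolding W_def jacobi_weight_def pw by (simp add: power2_eq_square algebra_simps)
    moreover have "(1 - y\<^sup>2) * D + (b - a - (a + b + 2) * y) * P' y = - l * P y" using D(2) by linarith
    ultimately show ?thesis by (simp add: mult_ac)
  qed
  have w: "jacobi_weight a b y \<le> B * (1 - y) powr a" if y: "x < y" "y < 1" for y
  proof -
    have "(1 + y) powr b \<le> (1 + y) powr \<bar>b\<bar>" using y x x0 by (intro powr_mono) auto
    also have "\<dots> \<le> B" unfolding B_def using y x x0 by (intro powr_mono2) auto
    finally show ?thesis unfolding jacobi_weight_def by (simp add: mult.commute[of B] mult_left_mono)
  qed
  have M0: "M \<ge> 0" using M[of 1] x by (simp add: order.trans[OF abs_ge_zero])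
  \<comment> \<open>The signs \<open>e = 1\<close> and \<open>e = -1\<close> give the two halves of
    the absolute value. The function \<open>h\<close> subtracts \<open>e * W * P'\<close> from a
    multiple of \<open>(1 - y) powr (a + 1)\<close>; it decreases and vanishes at \<open>1\<close>.
    Its derivative is used only inside \<open>(x, 1)\<close>, as \<open>jacobi_weight\<close> may
    blow up at \<open>1\<close>.\<close>
  have key: "e * (W x * P' x) \<le> (l * M * B / (a + 1)) * (1 - x) powr (a + 1)" if e: "\<bar>e\<bar> = 1" for e :: real
  proof -
    define h where "h = (\<lambda>y. (l * M * B / (a + 1)) * (1 - y) powr (a + 1) - e * (W y * P' y))"
    have "h 1 \<le> h x"
    proof (rule DERIV_nonpos_imp_decreasing_open[OF less_imp_le[OF x(2)]])
      show "continuous_on {x..1} h" unfolding h_def by (intro continuous_intros p1 Wc P'c)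
      fix y assume y: "x < y" "y < 1"
      have "((\<lambda>y. (1 - y) powr (a + 1)) has_real_derivative - (a + 1) * (1 - y) powr a) (at y)"
      proof -
        have y': "0 < 1 - y" using y by simp
        then have "(1 - y) powr (a + 1) = (1 - y) powr a * (1 - y)" by (simp add: powr_add)
        then show ?thesis using y' by (auto intro!: derivative_eq_intros simp: powr_diff algebra_simps)
      qed
      from DERIV_diff[OF DERIV_cmult[OF this, of "l * M * B / (a + 1)"] DERIV_cmult[OF Wd[OF y], of e]]
      have "(h has_real_derivative (l * M * B / (a + 1)) * (- (a + 1) * (1 - y) powr a) - e * (- l * (jacobi_weight a b y * P y))) (at y)"
        unfolding h_def .
      moreover have "(l * M * B / (a + 1)) * (- (a + 1) * (1 - y) powr a) - e * (- l * (jacobi_weight a b y * P y))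
          = l * (jacobi_weight a b y * (e * P y) - M * (B * (1 - y) powr a))" using ab by (simp add: field_simps)
      moreover have "jacobi_weight a b y * (e * P y) \<le> M * (B * (1 - y) powr a)"
      proof -
        have "e * P y \<le> \<bar>e * P y\<bar>" by simp
        also have "\<dots> \<le> M" using M[of y] y x e by (simp add: abs_mult)
        finally have "jacobi_weight a b y * (e * P y) \<le> jacobi_weight a b y * M" by (intro mult_left_mono jacobi_weight_nonneg)
        also have "\<dots> \<le> (B * (1 - y) powr a) * M" using w[OF y] M0 by (rule mult_right_mono)
        finally show ?thesis by (simp add: mult.commute)
      qed
      then have "l * (jacobi_weight a b y * (e * P y) - M * (B * (1 - y) powr a)) \<le> 0"
        using l by (intro mult_nonneg_nonpos) auto
      ultimately show "\<exists>d. (h has_real_derivative d) (at y) \<and> d \<le> 0" by metis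
    qed
    moreover have "h 1 = 0" using ab by (simp add: h_def W_def)
    ultimately have "0 \<le> h x" by simp
    then show ?thesis by (simp add: h_def)
  qed
  have pos: "(1 - x) powr (a + 1) > 0" using x by simp
  have "(1 - x) powr (a + 1) * 1 \<le> W x" unfolding W_def
    using ab x x0 by (intro mult_left_mono ge_one_powr_ge_zero) auto
  then have "(1 - x) powr (a + 1) * \<bar>P' x\<bar> \<le> W x * \<bar>P' x\<bar>" by (intro mult_right_mono) auto
  also have "\<dots> \<le> (1 - x) powr (a + 1) * (l * M * B / (a + 1))"
    unfolding mult.commute[of "(1 - x) powr (a + 1)"]
    using key[of 1] key[of "-1"] by (cases "P' x \<ge> 0") auto
  finally have "\<bar>P' x\<bar> \<le> l * M * B / (a + 1)" using pos by (rule mult_left_le_imp_le)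
  then show ?thesis by (simp add: B_def)
qed

text \<open>A bound that improves itself: if \<open>M\<close> is the maximum of
  \<open>\<bar>P\<bar>\<close> on the cap, \<open>jacobi_deriv_bound\<close> limits the variation of
  \<open>P\<close> over the cap to \<open>M / 2\<close>, hence
  \<open>M \<le> 2 * \<bar>P x0\<bar>\<close>. The condition \<open>small\<close> lets the cap have
  width of order \<open>1 / l\<close> in \<open>x\<close>, that is, about \<open>1 / N\<close> in
  \<open>t\<close>.\<close>

lemma jacobi_inner_bound:
  assumes ode: "jacobi_ode a b l P P'" and ab: "a > -1" "b > -1" and l: "l \<ge> 0"
    and x0: "0 \<le> x0" "x0 < 1" and small: "l * (1 - x0) * (2 powr \<bar>b\<bar> / (a + 1)) \<le> 1/2" and x: "x0 \<le> x" "x < 1"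
  shows "\<bar>P x\<bar> \<le> 2 * \<bar>P x0\<bar>" "\<bar>P' x\<bar> \<le> l * (2 * \<bar>P x0\<bar>) * (2 powr \<bar>b\<bar> / (a + 1))"
proof -
  define c where "c = 2 powr \<bar>b\<bar> / (a + 1)"
  have Pd: "(P has_real_derivative P' y) (at y)" for y using ode by (simp add: jacobi_ode_def)
  have "continuous_on {x0..1} (\<lambda>x. \<bar>P x\<bar>)"
    by (intro continuous_intros continuous_at_imp_continuous_on ballI DERIV_isCont[OF Pd])
  then have "\<exists>m\<in>{x0..1}. \<forall>y\<in>{x0..1}. \<bar>P y\<bar> \<le> \<bar>P m\<bar>"
    using x0 by (intro continuous_attains_sup) auto
  then obtain m where m: "x0 \<le> m" "m \<le> 1" "\<And>y. x0 \<le> y \<Longrightarrow> y \<le> 1 \<Longrightarrow> \<bar>P y\<bar> \<le> \<bar>P m\<bar>" by auto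
  have d: "\<bar>P' y\<bar> \<le> l * \<bar>P m\<bar> * c" if "x0 \<le> y" "y < 1" for y
    unfolding c_def by (rule jacobi_deriv_bound[OF ode ab l x0(1) m(3) that])
  have "\<bar>P m\<bar> \<le> 2 * \<bar>P x0\<bar>"
  proof (cases "m = x0")
    case False
    then have "x0 < m" using m by simp
    then have "\<exists>z. x0 < z \<and> z < m \<and> P m - P x0 = (m - x0) * P' z"
      by (rule MVT2) (rule Pd)
    then obtain z where z: "x0 < z" "z < m" "P m - P x0 = (m - x0) * P' z" by auto
    have "\<bar>P m - P x0\<bar> = (m - x0) * \<bar>P' z\<bar>" using z m by (simp add: abs_mult)
    also have "\<dots> \<le> (1 - x0) * (l * \<bar>P m\<bar> * c)" using z m x0 d[of z] by (intro mult_mono) auto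
    also have "\<dots> = (l * (1 - x0) * c) * \<bar>P m\<bar>" by simp
    also have "\<dots> \<le> 1/2 * \<bar>P m\<bar>" using small unfolding c_def by (intro mult_right_mono) auto
    finally show ?thesis by linarith
  qed simp
  moreover have "c > 0" using ab by (simp add: c_def)
  ultimately show "\<bar>P x\<bar> \<le> 2 * \<bar>P x0\<bar>" "\<bar>P' x\<bar> \<le> l * (2 * \<bar>P x0\<bar>) * (2 powr \<bar>b\<bar> / (a + 1))"
    using m(3)[of x] d[OF x] x l unfolding c_def[symmetric]
    by (auto intro: order.trans[OF d[OF x]] intro!: mult_right_mono mult_left_mono)
qed

text \<open>Outside the cap \<open>cos t > 1 - k / N^2\<close> one has
  \<open>sin t \<ge> sqrt k / N\<close>, and the exponential in \<open>jS_upper_bound\<close> is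
  bounded. Inside, \<open>P\<close> is controlled by its value at the rim of the cap, and the
  vanishing factor of \<open>jrho\<close> is largest at the rim because
  \<open>a \<ge> -1/2\<close>.\<close>

lemma jacobi_unit_bound_half:
  assumes ab: "a \<ge> -1/2" "b \<ge> -1/2"
  obtains C where "C \<ge> 0" "\<And>N P P' t. N \<ge> 1 \<Longrightarrow> N\<^sup>2 \<ge> ((a + b + 1) / 2)\<^sup>2 \<Longrightarrow> jacobi_unit a b N P P' \<Longrightarrow> 0 < t \<Longrightarrow> t \<le> pi / 2 \<Longrightarrow>
     \<bar>ju a b P t\<bar> \<le> C \<and> \<bar>jv a b P' t\<bar> \<le> C * N"
proof -
  obtain C0 where C0: "C0 \<ge> 0" "\<And>N P P' t. N \<ge> 1 \<Longrightarrow> jacobi_unit a b N P P' \<Longrightarrow> 0 < t \<Longrightarrow> t \<le> pi / 2 \<Longrightarrow>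
     jS a b N P P' t \<le> C0 * exp (jK a b / N * cot t)"
    using jS_upper_bound by blast
  define c where "c = 2 powr \<bar>b\<bar> / (a + 1)"
  have c: "c > 0" using ab by (simp add: c_def)
  \<comment> \<open>\<open>k * c \<le> 1/2\<close> is the smallness condition of
    \<open>jacobi_inner_bound\<close>, and \<open>k \<le> 1\<close> keeps the rim
    \<open>1 - k / N^2\<close> nonnegative.\<close>
  define k where "k = min 1 (1 / (2 * c))"
  have k: "k > 0" "k \<le> 1" "k * c \<le> 1/2"
  proof -
    show "k > 0" "k \<le> 1" using c by (auto simp: k_def)
    have "k * c \<le> 1 / (2 * c) * c" using c by (intro mult_right_mono) (auto simp: k_def)
    then show "k * c \<le> 1/2" using c by simp
  qed
  define D where "D = sqrt (C0 * exp (jK a b / sqrt k))"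
  have D: "D \<ge> 0" using C0 by (simp add: D_def)
  define G where "G = jM a b / (2 * sqrt k)"
  have G: "G \<ge> 0" using k jM_nonneg by (simp add: G_def)
  define H where "H = 2 powr (b/2 + 1/4) * 2"
  have H: "H \<ge> 0" by (simp add: H_def)
  \<comment> \<open>The four summands bound \<open>u\<close> and \<open>v / N\<close> outside the
    cap, then \<open>u\<close> and \<open>v / N\<close> inside it.\<close>
  define C where "C = D + D * (1 + G) + H * D + H * D * c * 2"
  have Cge: "C \<ge> 0" "D \<le> C" "D * (1 + G) \<le> C" "H * D \<le> C" "H * D * c * 2 \<le> C"
    using D G H c by (auto simp: C_def intro!: add_nonneg_nonneg)
  have "\<bar>ju a b P t\<bar> \<le> C \<and> \<bar>jv a b P' t\<bar> \<le> C * N"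
    if N: "N \<ge> 1" and lam: "N\<^sup>2 \<ge> ((a + b + 1) / 2)\<^sup>2" and unit: "jacobi_unit a b N P P'" and t: "0 < t" "t \<le> pi / 2" for N P P' t
  proof -
    note ode = jacobi_unit_ode[OF unit]
    have outer: "\<bar>ju a b P s\<bar> \<le> D \<and> \<bar>jv a b P' s\<bar> \<le> D * (1 + G) * N" if s: "0 < s" "s \<le> pi / 2" "cos s \<le> 1 - k / N\<^sup>2" for s
    proof -
      have s': "0 < s" "s < pi" using s by auto
      note cb = cos_bounds_0_pi[OF s']
      have "cos s \<ge> 0" using s by (intro cos_ge_zero) auto
      then have "(1 - cos s) * 1 \<le> (1 - cos s) * (1 + cos s)" using cb by (intro mult_left_mono) auto
      also have "\<dots> = (sin s)\<^sup>2" unfolding sin_squared_eq by (simp add: power2_eq_square algebra_simps)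
      finally have "(sin s)\<^sup>2 \<ge> 1 - cos s" by simp
      then have "(sin s)\<^sup>2 \<ge> k / N\<^sup>2" using s by linarith
      then have "sqrt ((sin s)\<^sup>2) \<ge> sqrt (k / N\<^sup>2)" by (rule real_sqrt_le_mono)
      then have sn: "sin s \<ge> sqrt k / N" using cb N by (simp add: real_sqrt_divide)
      have kn: "sqrt k / N > 0" using k N by simp
      have inv: "1 / sin s \<le> N / sqrt k"
        using divide_left_mono[OF sn _ mult_pos_pos[OF cb(3) kn], of 1] by simp
      have "jK a b / N * cot s \<le> jK a b / N * (N / sqrt k)"
        using abs_cot_le[OF s'] inv N jK_nonneg by (intro mult_left_mono) auto
      also have "\<dots> = jK a b / sqrt k" using N by simp
      finally have "C0 * exp (jK a b / N * cot s) \<le> C0 * exp (jK a b / sqrt k)" using C0 by (intro mult_left_mono) auto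
      then have S: "jS a b N P P' s \<le> D\<^sup>2" using C0(2)[OF N unit s(1,2)] C0(1) by (simp add: D_def)
      then have "(ju a b P s)\<^sup>2 \<le> D\<^sup>2" "(jdu a b P P' s / N)\<^sup>2 \<le> D\<^sup>2" unfolding jS_def
        using zero_le_power2[of "ju a b P s"] zero_le_power2[of "jdu a b P P' s / N"] by linarith+
      then have 1: "\<bar>ju a b P s\<bar> \<le> D" "\<bar>jdu a b P P' s / N\<bar> \<le> D" using D by (simp_all add: abs_le_square_iff[symmetric])
      then have du: "\<bar>jdu a b P P' s\<bar> \<le> D * N" using N by (simp add: field_simps)
      have "\<bar>jg a b s\<bar> \<le> jM a b / 2 * (1 / sin s)" using jg_bound[OF s', of a b] by simp
      also have "\<dots> \<le> jM a b / 2 * (N / sqrt k)" using inv jM_nonneg by (intro mult_left_mono) auto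
      also have "\<dots> = G * N" by (simp add: G_def)
      finally have "\<bar>jg a b s\<bar> * \<bar>ju a b P s\<bar> \<le> (G * N) * D" using 1 G N by (intro mult_mono) auto
      then have "\<bar>jv a b P' s\<bar> \<le> D * N + G * N * D"
        using du unfolding jdu_def abs_mult[symmetric] by linarith
      then show ?thesis using 1 by (simp add: algebra_simps)
    qed
    show ?thesis
    proof (cases "cos t \<le> 1 - k / N\<^sup>2")
      case True
      then show ?thesis using outer[OF t True] Cge N by (meson mult_right_mono order.trans zero_le_one)
    next
      case False
      define x0 where "x0 = 1 - k / N\<^sup>2"
      define l where "l = N\<^sup>2 - ((a + b + 1) / 2)\<^sup>2"
      have l: "l \<ge> 0" "l \<le> N\<^sup>2" using lam by (auto simp: l_def)
      have N2: "N\<^sup>2 \<ge> 1" using N by simp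
      have kN: "k / N\<^sup>2 \<le> 1" "k / N\<^sup>2 > 0" using order.trans[OF k(2) N2] k N by (auto simp: divide_le_eq_1 intro!: divide_pos_pos zero_less_power)
      then have x0: "0 \<le> x0" "x0 < 1" by (auto simp: x0_def)
      have x: "x0 \<le> cos t" "cos t < 1" using False cos_bounds_0_pi[of t] t by (auto simp: x0_def)
      have "l * (1 - x0) * c \<le> N\<^sup>2 * (k / N\<^sup>2) * c"
        unfolding x0_def using l k N c by (intro mult_right_mono mult_mono) auto
      also have "\<dots> \<le> 1/2" using k N by simp
      finally have small: "l * (1 - x0) * (2 powr \<bar>b\<bar> / (a + 1)) \<le> 1/2" by (simp add: c_def)
      have ab': "a > -1" "b > -1" using ab by auto
      note inner = jacobi_inner_bound[OF ode[folded l_def] ab' l(1) x0 small x, folded c_def]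
      define s where "s = arccos x0"
      have s: "cos s = x0" "0 < s" "s \<le> pi / 2"
      proof -
        show "cos s = x0" using x0 by (simp add: s_def cos_arccos)
        show "s \<le> pi / 2" unfolding s_def using x0 arccos_le_pi2 by auto
        have "s \<noteq> 0" using \<open>cos s = x0\<close> x0 by auto
        moreover have "0 \<le> s" unfolding s_def using x0 by (intro arccos_lbound) auto
        ultimately show "0 < s" by simp
      qed
      define R where "R = (1 - x0) powr (a/2 + 1/4)"
      have R: "R \<ge> 0" by (simp add: R_def)
      \<comment> \<open>The factor \<open>(1 + x0) powr (b/2 + 1/4)\<close> is at least 1, so the
        outer bound at the rim controls \<open>R * \<bar>P x0\<bar>\<close>, the combination that
        occurs inside the cap.\<close>
      have "R * 1 * \<bar>P x0\<bar> \<le> \<bar>ju a b P s\<bar>"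
        unfolding ju_def jrho_def s(1) abs_mult R_def using ab x0
        by (intro mult_right_mono) (auto simp: intro!: mult_left_mono ge_one_powr_ge_zero)
      also have "\<dots> \<le> D" using outer[OF s(2,3)] s(1) by (simp add: x0_def)
      finally have RP: "R * \<bar>P x0\<bar> \<le> D" by simp
      have rho: "jrho a b t \<le> R * 2 powr (b/2 + 1/4)" "0 \<le> jrho a b t"
        unfolding jrho_def R_def using ab x x0 by (auto intro!: mult_mono powr_mono2)
      have "\<bar>ju a b P t\<bar> = jrho a b t * \<bar>P (cos t)\<bar>" using rho by (simp add: ju_def abs_mult)
      also have "\<dots> \<le> (R * 2 powr (b/2 + 1/4)) * (2 * \<bar>P x0\<bar>)"
        using rho inner(1) R by (intro mult_mono) auto
      also have "\<dots> = H * (R * \<bar>P x0\<bar>)" by (simp add: H_def)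
      also have "\<dots> \<le> H * D" using RP H by (rule mult_left_mono)
      finally have u: "\<bar>ju a b P t\<bar> \<le> C" using Cge by linarith
      have st: "0 < sin t" using t by (intro sin_gt_zero) auto
      have "(sin t)\<^sup>2 = (1 - cos t) * (1 + cos t)" by (simp add: sin_squared_eq power2_eq_square algebra_simps)
      also have "\<dots> \<le> (1 / N\<^sup>2) * 2"
      proof (rule mult_mono)
        show "1 - cos t \<le> 1 / N\<^sup>2" using x k(2) N2 unfolding x0_def
          by (smt (verit) divide_right_mono)
      qed (use x x0 in auto)
      also have "\<dots> \<le> (2 / N)\<^sup>2" using N by (simp add: power_divide field_simps)
      finally have sn: "sin t \<le> 2 / N" using st N by (simp add: abs_le_square_iff[symmetric])
      have "\<bar>jv a b P' t\<bar> = jrho a b t * sin t * \<bar>P' (cos t)\<bar>" using rho st by (simp add: jv_def abs_mult)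
      also have "\<dots> \<le> (R * 2 powr (b/2 + 1/4)) * (2 / N) * (l * (2 * \<bar>P x0\<bar>) * c)"
        using rho inner(2) R sn st N by (intro mult_mono) auto
      also have "\<dots> \<le> (R * 2 powr (b/2 + 1/4)) * (2 / N) * (N\<^sup>2 * (2 * \<bar>P x0\<bar>) * c)"
        using l R N c by (intro mult_left_mono mult_right_mono) auto
      also have "\<dots> = H * (R * \<bar>P x0\<bar>) * c * 2 * N" using N by (simp add: H_def power2_eq_square)
      also have "\<dots> \<le> H * D * c * 2 * N" using RP H c N by (intro mult_right_mono mult_left_mono) auto
      also have "\<dots> \<le> C * N" using Cge N by (intro mult_right_mono) auto
      finally show ?thesis using u by blast
    qed
  qed
  then show ?thesis using that Cge by blast
qed

lemma jacobi_unit_reflect: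
  assumes "jacobi_unit a b N P P'"
  shows "jacobi_unit b a N (\<lambda>x. P (- x)) (\<lambda>x. - P' (- x))"
  unfolding jacobi_unit_def
proof (intro conjI allI impI)
  have "jacobi_ode a b (N\<^sup>2 - ((b + a + 1) / 2)\<^sup>2) P P'" using jacobi_unit_ode[OF assms] by (simp add: add.commute[of b a])
  then show "jacobi_ode b a (N\<^sup>2 - ((b + a + 1) / 2)\<^sup>2) (\<lambda>x. P (- x)) (\<lambda>x. - P' (- x))"
    by (rule jacobi_ode_reflect)
  fix c d :: real assume cd: "-1 < c" "c \<le> d" "d < 1"
  have "integral {c..d} (\<lambda>x. (P (- x))\<^sup>2 * jacobi_weight b a x) = integral {- (- c).. - (- d)} (\<lambda>x. (P (- x))\<^sup>2 * jacobi_weight a b (- x))"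
    by (simp add: jacobi_weight_def mult.commute)
  also have "\<dots> = integral {- d..- c} (\<lambda>x. (P x)\<^sup>2 * jacobi_weight a b x)"
    using Henstock_Kurzweil_Integration.integral_reflect_real[of "- c" "- d" "\<lambda>x. (P x)\<^sup>2 * jacobi_weight a b x"] by simp
  also have "\<dots> \<le> 1" using assms cd by (simp add: jacobi_unit_def)
  finally show "integral {c..d} (\<lambda>x. (P (- x))\<^sup>2 * jacobi_weight b a x) \<le> 1" .
qed

lemma jacobi_unit_bound:
  assumes ab: "a \<ge> -1/2" "b \<ge> -1/2"
  obtains C where "C \<ge> 0" "\<And>N P P' t. N \<ge> 1 \<Longrightarrow> N\<^sup>2 \<ge> ((a + b + 1) / 2)\<^sup>2 \<Longrightarrow> jacobi_unit a b N P P' \<Longrightarrow> 0 < t \<Longrightarrow> t < pi \<Longrightarrow>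
     \<bar>ju a b P t\<bar> \<le> C \<and> \<bar>jv a b P' t\<bar> \<le> C * N"
proof -
  obtain C1 where C1: "C1 \<ge> 0" "\<And>N P P' t. N \<ge> 1 \<Longrightarrow> N\<^sup>2 \<ge> ((a + b + 1) / 2)\<^sup>2 \<Longrightarrow> jacobi_unit a b N P P' \<Longrightarrow> 0 < t \<Longrightarrow> t \<le> pi / 2 \<Longrightarrow>
     \<bar>ju a b P t\<bar> \<le> C1 \<and> \<bar>jv a b P' t\<bar> \<le> C1 * N" using jacobi_unit_bound_half[OF ab] by blast
  obtain C2 where C2: "C2 \<ge> 0" "\<And>N P P' t. N \<ge> 1 \<Longrightarrow> N\<^sup>2 \<ge> ((b + a + 1) / 2)\<^sup>2 \<Longrightarrow> jacobi_unit b a N P P' \<Longrightarrow> 0 < t \<Longrightarrow> t \<le> pi / 2 \<Longrightarrow>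
     \<bar>ju b a P t\<bar> \<le> C2 \<and> \<bar>jv b a P' t\<bar> \<le> C2 * N" using jacobi_unit_bound_half[OF ab(2,1)] by blast
  have "\<bar>ju a b P t\<bar> \<le> max C1 C2 \<and> \<bar>jv a b P' t\<bar> \<le> max C1 C2 * N"
    if N: "N \<ge> 1" and lam: "N\<^sup>2 \<ge> ((a + b + 1) / 2)\<^sup>2" and unit: "jacobi_unit a b N P P'" and t: "0 < t" "t < pi" for N P P' t
  proof (cases "t \<le> pi / 2")
    case True
    have "C1 * N \<le> max C1 C2 * N" using N by (intro mult_right_mono) auto
    then show ?thesis using C1(2)[OF N lam unit t(1) True] by auto
  next
    case False
    have "\<bar>ju b a (\<lambda>x. P (- x)) (pi - t)\<bar> \<le> C2 \<and> \<bar>jv b a (\<lambda>x. - P' (- x)) (pi - t)\<bar> \<le> C2 * N"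
      using False t lam by (intro C2(2)[OF N _ jacobi_unit_reflect[OF unit]]) (auto simp: add.commute)
    moreover have "ju b a (\<lambda>x. P (- x)) (pi - t) = ju a b P t" "jv b a (\<lambda>x. - P' (- x)) (pi - t) = - jv a b P' t"
      by (auto simp: ju_def jv_def jrho_def)
    moreover have "C2 * N \<le> max C1 C2 * N" using N by (intro mult_right_mono) auto
    ultimately show ?thesis by auto
  qed
  then show ?thesis using that[of "max C1 C2"] C1(1) by auto
qed

section \<open>The kernel of the partial sum operators\<close>

lemma jacobi_wronskian:
  assumes P: "jacobi_ode a b l P P'" and Q: "jacobi_ode a b k Q Q'" and st: "0 < s" "s \<le> t" "t < pi"
  shows "(k - l) * integral {s..t} (\<lambda>x. ju a b P x * ju a b Q x)
    = (ju a b Q t * jv a b P' t - ju a b P t * jv a b Q' t) - (ju a b Q s * jv a b P' s - ju a b P s * jv a b Q' s)"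
proof -
  let ?F = "\<lambda>x. ju a b Q x * jv a b P' x - ju a b P x * jv a b Q' x"
  have "((\<lambda>x. (k - l) * (ju a b P x * ju a b Q x)) has_integral (?F t - ?F s)) {s..t}"
  proof (rule fundamental_theorem_of_calculus[OF st(2)])
    fix x assume "x \<in> {s..t}"
    then have x: "0 < x" "x < pi" using st by auto
    have "(?F has_real_derivative (k - l) * (ju a b P x * ju a b Q x)) (at x)"
      by (rule DERIV_cong[OF DERIV_diff[OF DERIV_mult[OF ju_deriv[OF Q x] jv_deriv[OF P x]] DERIV_mult[OF ju_deriv[OF P x] jv_deriv[OF Q x]]]])
        (simp add: jdu_def algebra_simps)
    then show "(?F has_vector_derivative (k - l) * (ju a b P x * ju a b Q x)) (at x within {s..t})"
      by (simp add: has_real_derivative_iff_has_vector_derivative[symmetric] has_field_derivative_at_within)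
  qed
  then have "integral {s..t} (\<lambda>x. (k - l) * (ju a b P x * ju a b Q x)) = ?F t - ?F s" by (rule integral_unique)
  then show ?thesis by simp
qed

section \<open>The orthonormal system in the angular variable\<close>

definition jfreq :: "real \<Rightarrow> real \<Rightarrow> nat \<Rightarrow> real" where
  "jfreq a b n = real n + (a + b + 1) / 2"

definition jU :: "real \<Rightarrow> real \<Rightarrow> nat \<Rightarrow> real \<Rightarrow> real" where
  "jU a b n = ju a b (jacobi_p a b n)"

definition jV :: "real \<Rightarrow> real \<Rightarrow> nat \<Rightarrow> real \<Rightarrow> real" where
  "jV a b n = jv a b (deriv (jacobi_p a b n))"

lemma jacobi_p_ode_freq:
  "jacobi_ode a b (jeig a b (jfreq a b n)) (jacobi_p a b n) (deriv (jacobi_p a b n))"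
proof -
  obtain P' where ode: "jacobi_ode a b (real n * (real n + a + b + 1)) (jacobi_p a b n) P'"
    using jacobi_p_ode by blast
  have "deriv (jacobi_p a b n) = P'"
    using ode by (auto simp: jacobi_ode_def intro!: DERIV_imp_deriv)
  moreover have "real n * (real n + a + b + 1) = (jfreq a b n)\<^sup>2 - ((a + b + 1) / 2)\<^sup>2"
    by (simp add: jfreq_def power2_eq_square field_simps)
  ultimately show ?thesis using ode by simp
qed

lemma jacobi_kernel_eq_integral:
  assumes "a > -1" "b > -1" "-1 \<le> c" "c \<le> d" "d \<le> 1"
  shows "jacobi_kernel a b c d m n = integral {c..d} (\<lambda>x. jacobi_p a b m x * jacobi_p a b n x * jacobi_weight a b x)"
    and "(\<lambda>x. jacobi_p a b m x * jacobi_p a b n x * jacobi_weight a b x) integrable_on {c..d}"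
proof -
  have "set_integrable lborel {-1..1} (\<lambda>x. (jacobi_p a b m x * jacobi_p a b n x) * jacobi_weight a b x)"
    by (intro continuous_weight_set_integrable assms continuous_intros jacobi_p_continuous)
  then have "set_integrable lborel {c..d} (\<lambda>x. jacobi_p a b m x * jacobi_p a b n x * jacobi_weight a b x)"
    using assms by (rule_tac set_integrable_subset) auto
  from set_borel_integral_eq_integral[OF this]
  show "jacobi_kernel a b c d m n = integral {c..d} (\<lambda>x. jacobi_p a b m x * jacobi_p a b n x * jacobi_weight a b x)"
    and "(\<lambda>x. jacobi_p a b m x * jacobi_p a b n x * jacobi_weight a b x) integrable_on {c..d}"
    by (simp_all add: jacobi_kernel_def)
qed

lemma jacobi_kernel_full:
  assumes "a > -1" "b > -1"
  shows "jacobi_kernel a b (-1) 1 n n = 1"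
  using jacobi_p_normalized[OF assms, of n] by (simp add: jacobi_kernel_def power2_eq_square)

lemma jacobi_kernel_diag:
  assumes "a > -1" "b > -1" "-1 \<le> c" "c \<le> d" "d \<le> 1"
  shows "0 \<le> jacobi_kernel a b c d n n" "jacobi_kernel a b c d n n \<le> 1"
proof -
  let ?f = "\<lambda>x. jacobi_p a b n x * jacobi_p a b n x * jacobi_weight a b x"
  have nn: "?f x \<ge> 0" for x by (simp add: jacobi_weight_nonneg)
  show "0 \<le> jacobi_kernel a b c d n n"
    unfolding jacobi_kernel_eq_integral(1)[OF assms]
    by (intro Henstock_Kurzweil_Integration.integral_nonneg jacobi_kernel_eq_integral(2)[OF assms] nn)
  have "jacobi_kernel a b c d n n \<le> jacobi_kernel a b (-1) 1 n n"
    unfolding jacobi_kernel_eq_integral(1)[OF assms]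
    using assms by (subst jacobi_kernel_eq_integral(1)) (auto intro!: integral_subset_le jacobi_kernel_eq_integral(2) nn)
  then show "jacobi_kernel a b c d n n \<le> 1" by (simp add: jacobi_kernel_full[OF assms(1,2)])
qed

lemma jacobi_p_unit:
  assumes "a > -1" "b > -1"
  shows "jacobi_unit a b (jfreq a b n) (jacobi_p a b n) (deriv (jacobi_p a b n))"
  unfolding jacobi_unit_def
proof (intro conjI allI impI jacobi_p_ode_freq)
  fix c d :: real assume "-1 < c" "c \<le> d" "d < 1"
  then show "integral {c..d} (\<lambda>x. (jacobi_p a b n x)\<^sup>2 * jacobi_weight a b x) \<le> 1"
    using jacobi_kernel_diag(2)[OF assms, of c d n] jacobi_kernel_eq_integral(1)[OF assms, of c d n n]
    by (simp add: power2_eq_square)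
qed

lemma jrho_bound:
  assumes "a \<ge> -1/2" "b \<ge> -1/2" "0 < t" "t < pi"
  shows "0 \<le> jrho a b t" "jrho a b t \<le> 2 powr (a/2 + 1/4) * 2 powr (b/2 + 1/4)"
  unfolding jrho_def using assms cos_bounds_0_pi[OF assms(3,4)]
  by (auto intro!: mult_mono powr_mono2)

lemma jUV_bound:
  assumes ab: "a \<ge> -1/2" "b \<ge> -1/2"
  obtains C where "C \<ge> 0" "\<And>n t. 0 < t \<Longrightarrow> t < pi \<Longrightarrow> \<bar>jU a b n t\<bar> \<le> C \<and> \<bar>jV a b n t\<bar> \<le> C * jfreq a b n"
proof -
  have ab': "a > -1" "b > -1" using ab by auto
  obtain C where C: "C \<ge> 0" "\<And>N P P' t. N \<ge> 1 \<Longrightarrow> N\<^sup>2 \<ge> ((a + b + 1) / 2)\<^sup>2 \<Longrightarrow> jacobi_unit a b N P P' \<Longrightarrow> 0 < t \<Longrightarrow> t < pi \<Longrightarrow>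
     \<bar>ju a b P t\<bar> \<le> C \<and> \<bar>jv a b P' t\<bar> \<le> C * N" using jacobi_unit_bound[OF ab] by blast
  obtain c where c: "c > 0" "\<And>x. jacobi_p a b 0 x = c" using jacobi_p_0[OF ab'] by blast
  define D where "D = max C (2 powr (a/2 + 1/4) * 2 powr (b/2 + 1/4) * c)"
  have "\<bar>jU a b n t\<bar> \<le> D \<and> \<bar>jV a b n t\<bar> \<le> D * jfreq a b n" if t: "0 < t" "t < pi" for n t
  proof (cases "n = 0")
    \<comment> \<open>For \<open>n = 0\<close> the frequency can be below 1, and it is 0 if
      \<open>a = b = -1/2\<close>, so the general estimate does not apply. Instead
      \<open>jacobi_p a b 0\<close> is constant, whence \<open>jV\<close> vanishes.\<close>
    case True
    have "deriv (jacobi_p a b 0) = (\<lambda>x. 0)" using c by (auto intro!: DERIV_imp_deriv simp: c(2)[abs_def])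
    then have "jV a b 0 t = 0" by (simp add: jV_def jv_def)
    moreover have "\<bar>jU a b 0 t\<bar> \<le> D"
      using jrho_bound[OF ab t] c by (simp add: jU_def ju_def abs_mult D_def mult_right_mono le_max_iff_disj)
    moreover have "D \<ge> 0" "jfreq a b 0 \<ge> 0" using ab C(1) by (auto simp: jfreq_def D_def)
    ultimately show ?thesis using True by simp
  next
    case False
    then have n: "real n \<ge> 1" by simp
    have A: "(a + b + 1) / 2 \<ge> 0" using ab by simp
    then have "jfreq a b n \<ge> 1" "(a + b + 1) / 2 \<le> jfreq a b n"
      using n unfolding jfreq_def by linarith+
    then have N: "jfreq a b n \<ge> 1" "(jfreq a b n)\<^sup>2 \<ge> ((a + b + 1) / 2)\<^sup>2"
      using A by (auto intro!: power_mono)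
    have "\<bar>jU a b n t\<bar> \<le> C \<and> \<bar>jV a b n t\<bar> \<le> C * jfreq a b n"
      unfolding jU_def jV_def by (rule C(2)[OF N jacobi_p_unit[OF ab'] t])
    moreover have "C * jfreq a b n \<le> D * jfreq a b n" using N by (intro mult_right_mono) (auto simp: D_def)
    ultimately show ?thesis by (auto simp: D_def)
  qed
  moreover have "D \<ge> 0" using C by (simp add: D_def)
  ultimately show ?thesis using that by blast
qed

abbreviation jker :: "real \<Rightarrow> real \<Rightarrow> real \<Rightarrow> nat \<Rightarrow> nat \<Rightarrow> real" where
  "jker a b r \<equiv> jacobi_kernel a b (- r) r"

lemma arccos_Ioo_half:
  assumes "0 < r" "r < 1"
  shows "0 < arccos r" "arccos r < pi / 2" "cos (arccos r) = r" "cos (pi - arccos r) = - r"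
  using assms arccos_lt_bounded[of r] arccos_less_arccos[of 0 r] by auto

lemma jker_eq_jU_integral:
  assumes ab: "a > -1" "b > -1" and r: "0 < r" "r < 1"
  shows "jker a b r m n = integral {arccos r..pi - arccos r} (\<lambda>x. jU a b m x * jU a b n x)"
proof -
  note th = arccos_Ioo_half[OF r]
  have "integral {arccos r..pi - arccos r} (\<lambda>x. jU a b m x * jU a b n x)
    = integral {cos (pi - arccos r)..cos (arccos r)} (\<lambda>x. jacobi_p a b m x * jacobi_p a b n x * jacobi_weight a b x)"
    unfolding jU_def using th by (intro integral_ju_prod jacobi_p_continuous) auto
  also have "\<dots> = jker a b r m n"
    using ab r th by (subst jacobi_kernel_eq_integral(1)) auto
  finally show ?thesis by simp
qed

definition jW :: "real \<Rightarrow> real \<Rightarrow> nat \<Rightarrow> nat \<Rightarrow> real \<Rightarrow> real" where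
  "jW a b m n t = jU a b n t * jV a b m t - jU a b m t * jV a b n t"

lemma jker_wronskian:
  assumes ab: "a > -1" "b > -1" and r: "0 < r" "r < 1"
  shows "((jfreq a b n)\<^sup>2 - (jfreq a b m)\<^sup>2) * jker a b r m n = jW a b m n (pi - arccos r) - jW a b m n (arccos r)"
  using arccos_Ioo_half[OF r] jacobi_wronskian[OF jacobi_p_ode_freq[of a b m] jacobi_p_ode_freq[of a b n], of "arccos r" "pi - arccos r"]
  by (simp add: jker_eq_jU_integral[OF assms] jU_def jV_def jW_def)

lemma jfreq_diff_squares:
  "(jfreq a b n)\<^sup>2 - (jfreq a b m)\<^sup>2 = (real n - real m) * (jfreq a b n + jfreq a b m)"
  by (simp add: jfreq_def power2_eq_square algebra_simps)

lemma jfreq_nonneg: "a \<ge> -1/2 \<Longrightarrow> b \<ge> -1/2 \<Longrightarrow> jfreq a b n \<ge> 0"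
  by (simp add: jfreq_def)

lemma jfreq_add_pos:
  assumes "a \<ge> -1/2" "b \<ge> -1/2" "m \<noteq> n"
  shows "jfreq a b n + jfreq a b m > 0"
proof -
  have "real n + real m \<ge> 1" using assms(3) by linarith
  then show ?thesis using assms by (simp add: jfreq_def)
qed

lemma jker_commute: "jker a b r m n = jker a b r n m"
  by (simp add: jacobi_kernel_def mult.commute)

section \<open>Bounds of the kernel uniform in the cut-off radius\<close>

text \<open>For fixed \<open>m\<close> this is of size \<open>1 / n\<close>, which is
  \<open>q\<close>-summable for every \<open>q > 1\<close>. It justifies the series defining
  \<open>T_r\<close> and serves as the majorant in \<open>T_r_finite_tendsto\<close>.\<close>

lemma jker_decay:
  assumes ab: "a \<ge> -1/2" "b \<ge> -1/2"
  obtains C where "C \<ge> 0" "\<And>r m n. 0 < r \<Longrightarrow> r < 1 \<Longrightarrow> \<bar>jker a b r m n\<bar> \<le> C * (real m + 2) / (real n + 1)"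
proof -
  have ab': "a > -1" "b > -1" using ab by auto
  obtain C where C: "C \<ge> 0" "\<And>n t. 0 < t \<Longrightarrow> t < pi \<Longrightarrow> \<bar>jU a b n t\<bar> \<le> C \<and> \<bar>jV a b n t\<bar> \<le> C * jfreq a b n"
    using jUV_bound[OF ab] by blast
  have W: "\<bar>jW a b m n t\<bar> \<le> C\<^sup>2 * (jfreq a b n + jfreq a b m)" if t: "0 < t" "t < pi" for m n t
  proof -
    have "\<bar>jU a b n t * jV a b m t\<bar> \<le> C * (C * jfreq a b m)" "\<bar>jU a b m t * jV a b n t\<bar> \<le> C * (C * jfreq a b n)"
      unfolding abs_mult using C(1) C(2)[OF t] by (intro mult_mono; simp)+
    then show ?thesis unfolding jW_def by (simp add: power2_eq_square algebra_simps)
  qed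
  have off: "\<bar>jker a b r m n\<bar> \<le> 2 * C\<^sup>2 / \<bar>real n - real m\<bar>" if r: "0 < r" "r < 1" and mn: "m \<noteq> n" for r m n
  proof -
    note th = arccos_Ioo_half[OF r]
    define S where "S = jfreq a b n + jfreq a b m"
    have S: "S > 0" unfolding S_def by (rule jfreq_add_pos[OF ab mn])
    have "\<bar>real n - real m\<bar> * S * \<bar>jker a b r m n\<bar> = \<bar>jW a b m n (pi - arccos r) - jW a b m n (arccos r)\<bar>"
      using jker_wronskian[OF ab' r, of n m] S unfolding jfreq_diff_squares S_def[symmetric]
      by (metis abs_mult abs_of_pos)
    also have "\<dots> \<le> \<bar>jW a b m n (pi - arccos r)\<bar> + \<bar>jW a b m n (arccos r)\<bar>" by simp
    also have "\<dots> \<le> C\<^sup>2 * S + C\<^sup>2 * S" unfolding S_def using th by (intro add_mono W) auto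
    finally have "S * (\<bar>real n - real m\<bar> * \<bar>jker a b r m n\<bar>) \<le> S * (2 * C\<^sup>2)" by (simp add: algebra_simps)
    then have "\<bar>real n - real m\<bar> * \<bar>jker a b r m n\<bar> \<le> 2 * C\<^sup>2" using S by simp
    then show ?thesis using mn by (simp add: field_simps)
  qed
  define D where "D = max 1 (2 * C\<^sup>2)"
  have D: "D \<ge> 1" "2 * C\<^sup>2 \<le> D" by (auto simp: D_def)
  have bound: "\<bar>jker a b r m n\<bar> \<le> D * (x + 2) / (y + 1)"
    if r: "0 < r" "r < 1" and xy: "x \<ge> 0" "y \<ge> 0" "\<bar>x - y\<bar> = \<bar>real n - real m\<bar>" for r m n and x y :: real
  proof (cases "m = n")
    case True
    have "\<bar>jker a b r m n\<bar> \<le> 1" using True jacobi_kernel_diag[OF ab', of "-r" r n] r by auto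
    also have "1 \<le> D * ((x + 2) / (y + 1))"
      using D xy True by (intro mult_ge1_I) auto
    finally show ?thesis by simp
  next
    case False
    then have d1: "\<bar>real n - real m\<bar> \<ge> 1" by linarith
    have "y \<le> \<bar>x - y\<bar> + x" by simp
    then have "y + 1 \<le> \<bar>x - y\<bar> * 1 + 1 * (x + 1)" unfolding mult_1_left mult_1_right by linarith
    also have "\<dots> \<le> \<bar>x - y\<bar> * 1 + \<bar>x - y\<bar> * (x + 1)" using d1 xy by (intro add_mono mult_right_mono) auto
    finally have "y + 1 \<le> \<bar>real n - real m\<bar> * (x + 2)" using xy by (simp add: algebra_simps)
    then have "1 / \<bar>real n - real m\<bar> \<le> (x + 2) / (y + 1)" using d1 xy by (simp add: field_simps)
    then have "2 * C\<^sup>2 * (1 / \<bar>real n - real m\<bar>) \<le> D * ((x + 2) / (y + 1))"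
      using D by (intro mult_mono) auto
    then show ?thesis using off[OF r False] by simp
  qed
  show ?thesis
  proof (rule that[of D])
    show "D \<ge> 0" using D by simp
  qed (auto intro!: bound)
qed

text \<open>With frequencies \<open>N\<close>, \<open>M\<close> of \<open>n\<close>,
  \<open>m\<close> and \<open>w = jV / jfreq\<close> bounded, the boundary terms contain
  \<open>M / (N^2 - M^2)\<close> and \<open>N / (N^2 - M^2)\<close>. Partial fractions write these
  as half the difference and half the sum of \<open>1 / (N - M)\<close> and
  \<open>1 / (N + M)\<close>, where \<open>N - M = n - m\<close> and
  \<open>N + M = n + m + A\<close>.\<close>

lemma jker_lp_bounded:
  assumes ab: "a \<ge> -1/2" "b \<ge> -1/2" and p: "1 < p"
  obtains C where "C \<ge> 0" "\<And>r. 0 < r \<Longrightarrow> r < 1 \<Longrightarrow> lp_bounded p C (jker a b r)"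
proof -
  have ab': "a > -1" "b > -1" using ab by auto
  define A where "A = a + b + 1"
  have A: "A \<ge> 0" using ab by (simp add: A_def)
  obtain C where C: "C \<ge> 0" "\<And>n t. 0 < t \<Longrightarrow> t < pi \<Longrightarrow> \<bar>jU a b n t\<bar> \<le> C \<and> \<bar>jV a b n t\<bar> \<le> C * jfreq a b n"
    using jUV_bound[OF ab] by blast
  obtain H where H: "H \<ge> 0" "lp_bounded p H (\<lambda>m n. 1 / (real n - real m))"
    "\<And>s. s \<ge> 0 \<Longrightarrow> lp_bounded p H (\<lambda>m n. if m = n then 0 else 1 / (real n + real m + s))"
    using lp_bounded_hilbert[OF p] by blast
  define h1 h2 :: "nat \<Rightarrow> nat \<Rightarrow> real" where "h1 = (\<lambda>m n. 1 / (real n - real m))"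
    and "h2 = (\<lambda>m n. if m = n then 0 else 1 / (real n + real m + A))"
  have h: "lp_bounded p H h1" "lp_bounded p H h2" unfolding h1_def h2_def using H A by auto
  \<comment> \<open>\<open>E1\<close> belongs to a single product of multipliers with a Hilbert-type
    kernel, \<open>E3\<close> to the four products at one endpoint, \<open>E4\<close> to both
    endpoints, and \<open>E5\<close> adds the diagonal.\<close>
  define E1 where "E1 = C powr p * C powr p * H"
  define E2 where "E2 = 2 powr p * (E1 + E1)"
  define E3 where "E3 = 2 powr p * (E2 + E2)"
  define E4 where "E4 = 2 powr p * (E3 + E3)"
  define E5 where "E5 = 2 powr p * (1 powr p + E4)"
  have E5: "E5 \<ge> 0" using H by (simp add: E1_def E2_def E3_def E4_def E5_def)
  have p0: "p \<ge> 0" using p by simp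
  have "lp_bounded p E5 (jker a b r)" if r: "0 < r" "r < 1" for r
  proof -
    \<comment> \<open>If the frequency is 0, the quotient is 0 by convention; since
      \<open>jV\<close> is then 0 by its own bound, \<open>w * jfreq = jV\<close> remains
      true.\<close>
    define w where "w = (\<lambda>t n. jV a b n t / jfreq a b n)"
    have wV: "w t n * jfreq a b n = jV a b n t" and w: "\<bar>w t n\<bar> \<le> C" if t: "0 < t" "t < pi" for t n
    proof -
      show "w t n * jfreq a b n = jV a b n t" using C(2)[OF t, of n] by (cases "jfreq a b n = 0") (auto simp: w_def)
      show "\<bar>w t n\<bar> \<le> C"
        using C(2)[OF t, of n] C(1) jfreq_nonneg[OF ab, of n] by (cases "jfreq a b n = 0") (auto simp: w_def abs_divide pos_divide_le_eq)
    qed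
    define k where "k = (\<lambda>e t m n.
         ((e * w t m / 2) * jU a b n t * h1 m n + (- e * w t m / 2) * jU a b n t * h2 m n)
       + ((- e * jU a b m t / 2) * w t n * h1 m n + (- e * jU a b m t / 2) * w t n * h2 m n))"
    have k: "lp_bounded p E3 (k e t)" if t: "0 < t" "t < pi" and e: "\<bar>e\<bar> = 1" for e t
    proof -
      have e1: "\<bar>e * x / 2\<bar> \<le> C" "\<bar>- e * x / 2\<bar> \<le> C" if "\<bar>x\<bar> \<le> C" for x
        using that e C(1) by (auto simp: abs_mult)
      note b = C(2)[OF t, THEN conjunct1] w[OF t]
      note m = lp_bounded_mult[OF _ H(1) p0, of _ _ C _ C, folded E1_def]
      show ?thesis unfolding k_def E3_def
        unfolding E2_def by (intro lp_bounded_add p0 m h e1 b)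
    qed
    have eq: "jker a b r m n = (if m = n then jker a b r n n else 0) + (k 1 (pi - arccos r) m n + k (-1) (arccos r) m n)" for m n
    proof (cases "m = n")
      \<comment> \<open>Both kernels vanish on the diagonal, \<open>h2\<close> by definition and
        \<open>h1\<close> because \<open>1 / 0 = 0\<close>.\<close>
      case True
      then show ?thesis by (simp add: k_def h1_def h2_def)
    next
      case False
      note th = arccos_Ioo_half[OF r]
      define N M where "N = jfreq a b n" and "M = jfreq a b m"
      have NM: "N + M > 0" "N - M \<noteq> 0" using jfreq_add_pos[OF ab False] False by (auto simp: N_def M_def jfreq_def)
      have hh: "h1 m n = 1 / (N - M)" "h2 m n = 1 / (N + M)"
        using False by (auto simp: h1_def h2_def N_def M_def jfreq_def A_def algebra_simps)
      have ke: "k e t m n = e * jW a b m n t / ((N - M) * (N + M))" if t: "0 < t" "t < pi" for e t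
      proof -
        have W: "jW a b m n t = jU a b n t * (w t m * M) - jU a b m t * (w t n * N)"
          unfolding jW_def N_def M_def wV[OF t] ..
        have MN: "(1 / (N - M) - 1 / (N + M)) / 2 = M / ((N - M) * (N + M))"
          "(1 / (N - M) + 1 / (N + M)) / 2 = N / ((N - M) * (N + M))"
          using NM by (simp_all add: diff_frac_eq add_frac_eq)
        have "k e t m n = e * (w t m * jU a b n t * ((h1 m n - h2 m n) / 2) - jU a b m t * w t n * ((h1 m n + h2 m n) / 2))"
          by (simp add: k_def algebra_simps diff_divide_distrib add_divide_distrib)
        also have "\<dots> = e * (w t m * jU a b n t * (M / ((N - M) * (N + M))) - jU a b m t * w t n * (N / ((N - M) * (N + M))))"
          unfolding hh MN ..
        also have "\<dots> = e * (jU a b n t * (w t m * M) - jU a b m t * (w t n * N)) / ((N - M) * (N + M))"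
          by (simp add: diff_divide_distrib right_diff_distrib mult_ac)
        finally show ?thesis unfolding W .
      qed
      have "((N - M) * (N + M)) * jker a b r m n = jW a b m n (pi - arccos r) - jW a b m n (arccos r)"
        using jker_wronskian[OF ab' r, of n m] by (simp add: N_def M_def power2_eq_square algebra_simps)
      then have "jker a b r m n = (jW a b m n (pi - arccos r) - jW a b m n (arccos r)) / ((N - M) * (N + M))"
        using NM by (simp add: eq_divide_eq mult.commute)
      then show ?thesis using False th by (simp add: ke diff_divide_distrib)
    qed
    have "lp_bounded p E5 (\<lambda>m n. (if m = n then jker a b r n n else 0) + (k 1 (pi - arccos r) m n + k (-1) (arccos r) m n))"
      unfolding E5_def
    proof (intro lp_bounded_add p0)
      show "lp_bounded p (1 powr p) (\<lambda>m n. if m = n then jker a b r n n else 0)"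
        using jacobi_kernel_diag[OF ab', of "-r" r] r by (intro lp_bounded_diag p0) auto
      show "lp_bounded p E4 (\<lambda>m n. k 1 (pi - arccos r) m n + k (- 1) (arccos r) m n)"
        unfolding E4_def using arccos_Ioo_half[OF r] by (intro lp_bounded_add p0 k) auto
    qed
    then show ?thesis unfolding eq[symmetric] .
  qed
  then show ?thesis using that E5 by blast
qed

section \<open>The limit of the kernel as the radius tends to 1\<close>

text \<open>In contrast to \<open>jUV_bound\<close> the constant depends on \<open>n\<close>; in
  return the boundary terms of a fixed pair \<open>m\<close>, \<open>n\<close> vanish at the ends of
  \<open>(0, pi)\<close>.\<close>

lemma jV_le_sin:
  assumes ab: "a \<ge> -1/2" "b \<ge> -1/2"
  obtains B where "B \<ge> 0" "\<And>t. 0 < t \<Longrightarrow> t < pi \<Longrightarrow> \<bar>jV a b n t\<bar> \<le> B * sin t"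
proof -
  have "continuous_on {-1..1} (deriv (jacobi_p a b n))" by (rule jacobi_ode_continuous(2)[OF jacobi_p_ode_freq])
  then have "bounded (deriv (jacobi_p a b n) ` {-1..1})" by (intro compact_imp_bounded compact_continuous_image) auto
  then obtain D where D: "\<And>x. x \<in> {-1..1} \<Longrightarrow> \<bar>deriv (jacobi_p a b n) x\<bar> \<le> D"
    unfolding bounded_iff by (metis image_eqI real_norm_def)
  define R where "R = 2 powr (a/2 + 1/4) * 2 powr (b/2 + 1/4)"
  have D0: "D \<ge> 0" using D[of 0] by simp
  have "\<bar>jV a b n t\<bar> \<le> R * D * sin t" if t: "0 < t" "t < pi" for t
  proof -
    have "\<bar>jV a b n t\<bar> = jrho a b t * \<bar>deriv (jacobi_p a b n) (cos t)\<bar> * sin t"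
      using jrho_bound[OF ab t] cos_bounds_0_pi[OF t] by (simp add: jV_def jv_def abs_mult)
    also have "\<dots> \<le> R * D * sin t"
      using jrho_bound[OF ab t] cos_bounds_0_pi[OF t] D[of "cos t"] D0
      by (intro mult_right_mono mult_mono) (auto simp: R_def)
    finally show ?thesis .
  qed
  then show ?thesis using that[of "R * D"] D0 by (simp add: R_def)
qed

text \<open>The case \<open>m \<noteq> n\<close> is the orthogonality of the Jacobi polynomials,
  obtained here from the Wronskian, whose boundary terms are of order \<open>sin (arccos r)\<close>.
  The case \<open>m = n\<close> is the normalisation together with continuity of the indefinite
  integral.\<close>

lemma jker_tendsto:
  assumes ab: "a \<ge> -1/2" "b \<ge> -1/2"
  shows "((\<lambda>r. jker a b r m n) \<longlongrightarrow> (if m = n then 1 else 0)) (at_left 1)"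
proof (cases "m = n")
  case True
  have ab': "a > -1" "b > -1" using ab by auto
  define f where "f = (\<lambda>x. jacobi_p a b n x * jacobi_p a b n x * jacobi_weight a b x)"
  have int: "f integrable_on {c..d}" if "-1 \<le> c" "c \<le> d" "d \<le> 1" for c d
    unfolding f_def by (rule jacobi_kernel_eq_integral(2)[OF ab' that])
  define F where "F = (\<lambda>x. integral {-1..x} f)"
  have cont: "continuous_on {-1..1} F"
    unfolding F_def by (intro indefinite_integral_continuous_1 int) auto
  have K: "jker a b r n n = F r - F (- r)" if r: "0 < r" "r < 1" for r
  proof -
    have "F (-r) + integral {-r..r} f = F r" unfolding F_def
      using r by (intro Henstock_Kurzweil_Integration.integral_combine int) auto
    then show ?thesis using jacobi_kernel_eq_integral(1)[OF ab', of "-r" r n n] r by (simp add: f_def)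
  qed
  have "continuous_on {0..1} (\<lambda>r. F r - F (- r))"
    by (intro continuous_intros continuous_on_compose2[OF cont]) auto
  then have "((\<lambda>r. F r - F (- r)) \<longlongrightarrow> F 1 - F (-1)) (at_left 1)"
    by (rule continuous_on_Icc_at_leftD) simp
  moreover have "F 1 - F (-1) = 1"
    using jacobi_kernel_full[OF ab', of n] jacobi_kernel_eq_integral(1)[OF ab', of "-1" 1 n n] by (simp add: F_def f_def)
  moreover have "\<forall>\<^sub>F r in at_left 1. F r - F (- r) = jker a b r n n"
    using eventually_at_left_real[of 0 1] by (auto elim!: eventually_mono simp: K)
  ultimately show ?thesis using True tendsto_cong[of "\<lambda>r. F r - F (- r)"] by auto
next
  case False
  have ab': "a > -1" "b > -1" using ab by auto
  obtain C where C: "C \<ge> 0" "\<And>n t. 0 < t \<Longrightarrow> t < pi \<Longrightarrow> \<bar>jU a b n t\<bar> \<le> C \<and> \<bar>jV a b n t\<bar> \<le> C * jfreq a b n"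
    using jUV_bound[OF ab] by blast
  obtain B1 B2 where B: "B1 \<ge> 0" "\<And>t. 0 < t \<Longrightarrow> t < pi \<Longrightarrow> \<bar>jV a b n t\<bar> \<le> B1 * sin t"
     "B2 \<ge> 0" "\<And>t. 0 < t \<Longrightarrow> t < pi \<Longrightarrow> \<bar>jV a b m t\<bar> \<le> B2 * sin t"
    using jV_le_sin[OF ab, of n] jV_le_sin[OF ab, of m] by metis
  define d where "d = \<bar>(jfreq a b n)\<^sup>2 - (jfreq a b m)\<^sup>2\<bar>"
  have d: "d > 0" using jfreq_add_pos[OF ab False] False by (simp add: d_def jfreq_diff_squares)
  have W: "\<bar>jW a b m n t\<bar> \<le> C * (B1 + B2) * sin t" if t: "0 < t" "t < pi" for t
  proof -
    have "\<bar>jU a b n t * jV a b m t\<bar> \<le> C * (B2 * sin t)" "\<bar>jU a b m t * jV a b n t\<bar> \<le> C * (B1 * sin t)"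
      unfolding abs_mult using C(1) C(2)[OF t] B(2,4)[OF t] by (intro mult_mono; simp)+
    then show ?thesis unfolding jW_def by (simp add: algebra_simps)
  qed
  have bound: "\<bar>jker a b r m n\<bar> \<le> 2 * (C * (B1 + B2)) / d * sqrt (1 - r\<^sup>2)" if r: "0 < r" "r < 1" for r
  proof -
    note th = arccos_Ioo_half[OF r]
    have sn: "sin (arccos r) = sqrt (1 - r\<^sup>2)" using r by (simp add: sin_arccos)
    have "d * \<bar>jker a b r m n\<bar> = \<bar>jW a b m n (pi - arccos r) - jW a b m n (arccos r)\<bar>"
      unfolding d_def abs_mult[symmetric] jker_wronskian[OF ab' r] ..
    also have "\<dots> \<le> \<bar>jW a b m n (pi - arccos r)\<bar> + \<bar>jW a b m n (arccos r)\<bar>" by simp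
    also have "\<dots> \<le> C * (B1 + B2) * sin (pi - arccos r) + C * (B1 + B2) * sin (arccos r)"
      using th by (intro add_mono W) auto
    finally have "d * \<bar>jker a b r m n\<bar> \<le> 2 * (C * (B1 + B2)) * sqrt (1 - r\<^sup>2)" by (simp add: sn)
    then show ?thesis using d by (simp add: pos_le_divide_eq mult.commute)
  qed
  have "((\<lambda>r::real. 2 * (C * (B1 + B2)) / d * sqrt (1 - r\<^sup>2)) \<longlongrightarrow> 2 * (C * (B1 + B2)) / d * sqrt (1 - 1\<^sup>2)) (at_left 1)"
    by (intro tendsto_intros)
  then have "((\<lambda>r::real. 2 * (C * (B1 + B2)) / d * sqrt (1 - r\<^sup>2)) \<longlongrightarrow> 0) (at_left 1)" by simp
  moreover have "\<forall>\<^sub>F r in at_left 1. norm (jker a b r m n) \<le> 2 * (C * (B1 + B2)) / d * sqrt (1 - r\<^sup>2)"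
    using bound by (intro eventually_mono[OF eventually_at_left_real[of 0 1]]) simp_all
  ultimately have "((\<lambda>r. jker a b r m n) \<longlongrightarrow> 0) (at_left 1)" by (rule Lim_null_comparison[rotated])
  then show ?thesis using False by simp
qed

section \<open>Convergence for \<open>p > 1\<close>\<close>

text \<open>For fixed \<open>L\<close> only finitely many series in \<open>m\<close> are involved,
  so \<open>M\<close> can tend to infinity inside the finite sum; afterwards \<open>L\<close> is
  released by monotonicity.\<close>

lemma lp_bounded_in_lp:
  assumes k: "lp_bounded p C k" and C: "C \<ge> 0" and p: "p > 0" and f: "in_lp p f" and sm: "\<And>n. summable (\<lambda>m. f m * k m n)"
  shows "in_lp p (\<lambda>n. \<Sum>m. f m * k m n)"
    and "(\<Sum>n. \<bar>\<Sum>m. f m * k m n\<bar> powr p) \<le> C * (\<Sum>m. \<bar>f m\<bar> powr p)"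
proof -
  let ?T = "\<lambda>n. \<Sum>m. f m * k m n"
  have fs: "summable (\<lambda>m. \<bar>f m\<bar> powr p)" using f by (simp add: in_lp_def)
  have part: "(\<Sum>n<L. \<bar>?T n\<bar> powr p) \<le> C * (\<Sum>m. \<bar>f m\<bar> powr p)" for L
  proof (rule LIMSEQ_le_const2)
    show "(\<lambda>M. \<Sum>n<L. \<bar>\<Sum>m<M. f m * k m n\<bar> powr p) \<longlonglongrightarrow> (\<Sum>n<L. \<bar>?T n\<bar> powr p)"
      using p by (intro tendsto_sum tendsto_powr' tendsto_rabs summable_LIMSEQ sm tendsto_const) auto
    show "\<exists>N. \<forall>M\<ge>N. (\<Sum>n<L. \<bar>\<Sum>m<M. f m * k m n\<bar> powr p) \<le> C * (\<Sum>m. \<bar>f m\<bar> powr p)"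
    proof (intro exI allI impI)
      fix M :: nat
      have "(\<Sum>n<L. \<bar>\<Sum>m<M. f m * k m n\<bar> powr p) \<le> C * (\<Sum>m<M. \<bar>f m\<bar> powr p)" by (rule lp_boundedD[OF k])
      also have "\<dots> \<le> C * (\<Sum>m. \<bar>f m\<bar> powr p)" using C fs by (intro mult_left_mono sum_le_suminf) auto
      finally show "(\<Sum>n<L. \<bar>\<Sum>m<M. f m * k m n\<bar> powr p) \<le> C * (\<Sum>m. \<bar>f m\<bar> powr p)" .
    qed
  qed
  show sT: "in_lp p ?T"
    unfolding in_lp_def by (rule summableI_nonneg_bounded[OF _ part]) auto
  show "(\<Sum>n. \<bar>?T n\<bar> powr p) \<le> C * (\<Sum>m. \<bar>f m\<bar> powr p)"
    using sT part by (intro suminf_le_const) (auto simp: in_lp_def)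
qed

lemma in_lp_add:
  assumes "in_lp p f" "in_lp p g" "p \<ge> 0"
  shows "in_lp p (\<lambda>n. f n + g n)"
    and "(\<Sum>n. \<bar>f n + g n\<bar> powr p) \<le> 2 powr p * ((\<Sum>n. \<bar>f n\<bar> powr p) + (\<Sum>n. \<bar>g n\<bar> powr p))"
proof -
  have s: "summable (\<lambda>n. \<bar>f n\<bar> powr p)" "summable (\<lambda>n. \<bar>g n\<bar> powr p)" using assms by (auto simp: in_lp_def)
  have s2: "summable (\<lambda>n. 2 powr p * (\<bar>f n\<bar> powr p + \<bar>g n\<bar> powr p))" by (intro summable_mult summable_add s)
  have le: "\<bar>f n + g n\<bar> powr p \<le> 2 powr p * (\<bar>f n\<bar> powr p + \<bar>g n\<bar> powr p)" for n by (rule abs_add_powr_le[OF assms(3)])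
  show s3: "in_lp p (\<lambda>n. f n + g n)"
    unfolding in_lp_def by (rule summable_comparison_test'[OF s2, of 0]) (use le in auto)
  have "(\<Sum>n. \<bar>f n + g n\<bar> powr p) \<le> (\<Sum>n. 2 powr p * (\<bar>f n\<bar> powr p + \<bar>g n\<bar> powr p))"
    using s3 by (intro suminf_le le s2) (auto simp: in_lp_def)
  also have "\<dots> = 2 powr p * ((\<Sum>n. \<bar>f n\<bar> powr p) + (\<Sum>n. \<bar>g n\<bar> powr p))"
    by (simp add: suminf_mult summable_add s suminf_add)
  finally show "(\<Sum>n. \<bar>f n + g n\<bar> powr p) \<le> 2 powr p * ((\<Sum>n. \<bar>f n\<bar> powr p) + (\<Sum>n. \<bar>g n\<bar> powr p))" .
qed

lemma in_lp_uminus: "in_lp p f \<Longrightarrow> in_lp p (\<lambda>n. - f n)" by (simp add: in_lp_def)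

lemma summable_inverse_Suc_powr:
  assumes "q > 1" "C \<ge> 0"
  shows "summable (\<lambda>n. (C / (real n + 1)) powr q)"
proof -
  have "summable (\<lambda>n. real n powr (- q))" using assms by (simp add: summable_real_powr_iff)
  then have "summable (\<lambda>n. real (Suc n) powr (- q))" by (subst summable_Suc_iff)
  then have "summable (\<lambda>n. C powr q * real (Suc n) powr (- q))" by (rule summable_mult)
  then show ?thesis using assms by (simp add: powr_divide powr_minus_divide add.commute)
qed

text \<open>By symmetry the kernel decays like \<open>1 / m\<close> for fixed \<open>n\<close>, and
  Young's inequality dominates the terms by the \<open>p\<close>-th powers of \<open>f\<close> and
  the \<open>q\<close>-th powers of that decay.\<close>

lemma jker_summable:
  assumes ab: "a \<ge> -1/2" "b \<ge> -1/2" and p: "p > 1" and r: "0 < r" "r < 1" and f: "in_lp p f"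
  shows "summable (\<lambda>m. f m * jker a b r m n)"
proof -
  obtain C where C: "C \<ge> 0" "\<And>r m n. 0 < r \<Longrightarrow> r < 1 \<Longrightarrow> \<bar>jker a b r m n\<bar> \<le> C * (real m + 2) / (real n + 1)"
    using jker_decay[OF ab] by blast
  define q where "q = p / (p - 1)"
  have q: "q > 1" "1/p + 1/q = 1" using p by (auto simp: q_def field_simps)
  have s: "summable (\<lambda>m. \<bar>f m\<bar> powr p / p + (C * (real n + 2) / (real m + 1)) powr q / q)"
    using f C(1) by (intro summable_add summable_divide summable_inverse_Suc_powr q) (auto simp: in_lp_def)
  show ?thesis
  proof (rule summable_comparison_test'[OF s, of 0])
    fix m
    have "norm (f m * jker a b r m n) \<le> \<bar>f m\<bar> * (C * (real n + 2) / (real m + 1))"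
      using mult_left_mono[OF C(2)[OF r, of n m, unfolded jker_commute[of a b r n m]] abs_ge_zero[of "f m"]] by (simp add: abs_mult)
    also have "\<dots> \<le> \<bar>f m\<bar> powr p / p + (C * (real n + 2) / (real m + 1)) powr q / q"
      using p q C(1) by (intro Youngs_inequality) auto
    finally show "norm (f m * jker a b r m n) \<le> \<bar>f m\<bar> powr p / p + (C * (real n + 2) / (real m + 1)) powr q / q" .
  qed
qed

lemma T_r_eq: "T_r a b r f n = (\<Sum>m. f m * jker a b r m n)"
  by (simp add: T_r_def T_interval_def)

text \<open>\<open>g f M r\<close> is the error \<open>T_r f - f\<close> for \<open>f\<close>
  truncated to its first \<open>M\<close> entries. It is at most \<open>H / (n + 1)\<close>
  uniformly in \<open>r\<close>, and \<open>p > 1\<close> makes this majorant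
  \<open>p\<close>-summable, so the limit may be taken in each entry.\<close>

lemma T_r_finite_tendsto:
  assumes ab: "a \<ge> -1/2" "b \<ge> -1/2" and p: "p > 1"
  defines "g \<equiv> (\<lambda>f M r n. \<Sum>m<M. f m * (jker a b r m n - (if m = n then 1 else 0)))"
  shows "0 < r \<Longrightarrow> r < 1 \<Longrightarrow> in_lp p (g f M r)"
    and "((\<lambda>r. \<Sum>n. \<bar>g f M r n\<bar> powr p) \<longlongrightarrow> 0) (at_left 1)"
proof -
  obtain C where C: "C \<ge> 0" "\<And>r m n. 0 < r \<Longrightarrow> r < 1 \<Longrightarrow> \<bar>jker a b r m n\<bar> \<le> C * (real m + 2) / (real n + 1)"
    using jker_decay[OF ab] by blast
  define H where "H = (\<Sum>m<M. \<bar>f m\<bar> * ((C + 1) * (real m + 2)))"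
  have bound: "\<bar>g f M r n\<bar> \<le> H / (real n + 1)" if r: "0 < r" "r < 1" for r n
  proof -
    have "\<bar>jker a b r m n - (if m = n then 1 else 0)\<bar> \<le> (C + 1) * (real m + 2) / (real n + 1)" for m
    proof -
      have "\<bar>if m = n then 1 else 0\<bar> \<le> (real m + 2) / (real n + 1)" by auto
      then have "\<bar>jker a b r m n - (if m = n then 1 else 0)\<bar> \<le> C * (real m + 2) / (real n + 1) + (real m + 2) / (real n + 1)"
        using C(2)[OF r, of m n] abs_triangle_ineq4[of "jker a b r m n" "if m = n then 1 else 0"] by linarith
      also have "\<dots> = (C + 1) * (real m + 2) / (real n + 1)" by (simp add: add_divide_distrib[symmetric] algebra_simps)
      finally show ?thesis .
    qed
    then have "\<bar>g f M r n\<bar> \<le> (\<Sum>m<M. \<bar>f m\<bar> * ((C + 1) * (real m + 2) / (real n + 1)))"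
      unfolding g_def by (intro order.trans[OF sum_abs sum_mono]) (simp only: abs_mult mult_left_mono abs_ge_zero)
    also have "\<dots> = H / (real n + 1)" by (simp add: H_def sum_divide_distrib)
    finally show ?thesis .
  qed
  have sH: "summable (\<lambda>n. (H / (real n + 1)) powr p)" using C(1) by (intro summable_inverse_Suc_powr p) (auto simp: H_def intro!: sum_nonneg)
  have bp: "norm (\<bar>g f M r n\<bar> powr p) \<le> (H / (real n + 1)) powr p" if "0 < r" "r < 1" for r n
    using bound[OF that, of n] p by (simp add: powr_mono2)
  show "in_lp p (g f M r)" if "0 < r" "r < 1"
    unfolding in_lp_def by (rule summable_comparison_test'[OF sH, of 0]) (use bp[OF that] in auto)
  have "((\<lambda>r. \<Sum>n. \<bar>g f M r n\<bar> powr p) \<longlongrightarrow> (\<Sum>n::nat. 0)) (at_left 1)"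
  proof (rule tannerys_theorem[OF _ _ sH, THEN conjunct2, THEN conjunct2])
    fix n
    have "((\<lambda>r. g f M r n) \<longlongrightarrow> (\<Sum>m<M. f m * ((if m = n then 1 else 0) - (if m = n then 1 else 0)))) (at_left 1)"
      unfolding g_def by (intro tendsto_intros jker_tendsto[OF ab])
    then have "((\<lambda>r. g f M r n) \<longlongrightarrow> 0) (at_left 1)" by simp
    then have "((\<lambda>r. \<bar>g f M r n\<bar> powr p) \<longlongrightarrow> \<bar>0\<bar> powr p) (at_left 1)"
      using p by (intro tendsto_powr' tendsto_rabs tendsto_const) auto
    then show "((\<lambda>r. \<bar>g f M r n\<bar> powr p) \<longlongrightarrow> 0) (at_left 1)" by simp
  next
    have "\<forall>\<^sub>F r in at_left (1::real). 0 < r \<and> r < 1"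
      using eventually_at_left_real[of 0 1] by simp
    then show "\<forall>\<^sub>F (n, r) in at_top \<times>\<^sub>F at_left 1. norm (\<bar>g f M r n\<bar> powr p) \<le> (H / (real n + 1)) powr p"
      unfolding eventually_prod_filter using bp
      by (intro exI[of _ "\<lambda>_. True"] exI[of _ "\<lambda>r. 0 < r \<and> r < 1"]) auto
  qed (simp add: trivial_limit_at_left_real)
  then show "((\<lambda>r. \<Sum>n. \<bar>g f M r n\<bar> powr p) \<longlongrightarrow> 0) (at_left 1)" by simp
qed

text \<open>The truncation converges, and the tail is controlled uniformly in \<open>r\<close> by
  \<open>jker_lp_bounded\<close>. All estimates concern \<open>p\<close>-th powers of norms, with
  \<open>abs_add_powr_le\<close> in place of the triangle inequality; the root is taken at the
  end.\<close>

lemma T_r_convergence: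
  assumes ab: "a \<ge> -1/2" "b \<ge> -1/2" and p: "p > 1" and f: "in_lp p f"
  shows "0 < r \<Longrightarrow> r < 1 \<Longrightarrow> in_lp p (\<lambda>n. T_r a b r f n - f n)"
    and "((\<lambda>r. lp_norm p (\<lambda>n. T_r a b r f n - f n)) \<longlongrightarrow> 0) (at_left 1)"
proof -
  have p0: "p \<ge> 0" "p > 0" using p by auto
  obtain C where C: "C \<ge> 0" "\<And>r. 0 < r \<Longrightarrow> r < 1 \<Longrightarrow> lp_bounded p C (jker a b r)"
    using jker_lp_bounded[OF ab p] by blast
  have fs: "summable (\<lambda>n. \<bar>f n\<bar> powr p)" using f by (simp add: in_lp_def)
  define g where "g = (\<lambda>M r n. \<Sum>m<M. f m * (jker a b r m n - (if m = n then 1 else 0)))"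
  define t where "t = (\<lambda>M m. if m < M then 0 else f m)"
  have tl: "in_lp p (t M)" for M
    unfolding in_lp_def by (rule summable_comparison_test'[OF fs, of 0]) (auto simp: t_def)
  have T: "in_lp p (\<lambda>n. T_r a b r h n)" "(\<Sum>n. \<bar>T_r a b r h n\<bar> powr p) \<le> C * (\<Sum>n. \<bar>h n\<bar> powr p)"
    if "0 < r" "r < 1" "in_lp p h" for r h
    unfolding T_r_eq by (rule lp_bounded_in_lp[OF C(2)[OF that(1,2)] C(1) p0(2) that(3) jker_summable[OF ab p that]])+
  show main1: "in_lp p (\<lambda>n. T_r a b r f n - f n)" if r: "0 < r" "r < 1" for r
    using in_lp_add(1)[OF T(1)[OF r f] in_lp_uminus[OF f] p0(1)] by simp
  have split: "T_r a b r f n - f n = g M r n + (T_r a b r (t M) n - t M n)" if r: "0 < r" "r < 1" for r n M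
  proof -
    have s1: "summable (\<lambda>m. (f m - t M m) * jker a b r m n)"
      by (rule summable_finite[of "{..<M}"]) (auto simp: t_def)
    have "T_r a b r f n = (\<Sum>m. (f m - t M m) * jker a b r m n + t M m * jker a b r m n)"
      unfolding T_r_eq by (simp add: algebra_simps)
    also have "\<dots> = (\<Sum>m. (f m - t M m) * jker a b r m n) + T_r a b r (t M) n"
      unfolding T_r_eq by (rule suminf_add[symmetric, OF s1 jker_summable[OF ab p r tl]])
    also have "(\<Sum>m. (f m - t M m) * jker a b r m n) = (\<Sum>m<M. f m * jker a b r m n)"
      by (subst suminf_finite[of "{..<M}"]) (auto simp: t_def intro!: sum.cong)
    finally have "T_r a b r f n = (\<Sum>m<M. f m * jker a b r m n) + T_r a b r (t M) n" .
    moreover have "g M r n = (\<Sum>m<M. f m * jker a b r m n) - (\<Sum>m<M. f m * (if m = n then 1 else 0))"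
      unfolding g_def by (simp only: right_diff_distrib sum_subtractf)
    moreover have "(\<Sum>m<M. f m * (if m = n then 1 else 0)) = f n - t M n"
      by (simp add: if_distrib[of "\<lambda>x. _ * x"] t_def cong: if_cong)
    ultimately show ?thesis by simp
  qed
  have X: "(\<Sum>n. \<bar>T_r a b r f n - f n\<bar> powr p)
      \<le> 2 powr p * ((\<Sum>n. \<bar>g M r n\<bar> powr p) + 2 powr p * ((C + 1) * (\<Sum>n. \<bar>t M n\<bar> powr p)))"
    if r: "0 < r" "r < 1" for r M
  proof -
    have "(\<Sum>n. \<bar>T_r a b r f n - f n\<bar> powr p) \<le> 2 powr p * ((\<Sum>n. \<bar>g M r n\<bar> powr p) + (\<Sum>n. \<bar>T_r a b r (t M) n - t M n\<bar> powr p))"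
      unfolding split[OF r, of _ M]
      using in_lp_add(1)[OF T(1)[OF r tl] in_lp_uminus[OF tl] p0(1)]
      by (intro in_lp_add(2) p0(1)) (auto simp: g_def intro!: T_r_finite_tendsto(1)[OF ab p r])
    also have "\<dots> \<le> 2 powr p * ((\<Sum>n. \<bar>g M r n\<bar> powr p) + 2 powr p * ((C + 1) * (\<Sum>n. \<bar>t M n\<bar> powr p)))"
    proof (intro mult_left_mono add_left_mono)
      have "(\<Sum>n. \<bar>T_r a b r (t M) n - t M n\<bar> powr p) \<le> 2 powr p * ((\<Sum>n. \<bar>T_r a b r (t M) n\<bar> powr p) + (\<Sum>n. \<bar>t M n\<bar> powr p))"
        using in_lp_add(2)[OF T(1)[OF r tl[of M]] in_lp_uminus[OF tl[of M]] p0(1)] by simp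
      also have "\<dots> \<le> 2 powr p * (C * (\<Sum>n. \<bar>t M n\<bar> powr p) + (\<Sum>n. \<bar>t M n\<bar> powr p))"
        using T(2)[OF r tl[of M]] by (intro mult_left_mono add_right_mono) auto
      also have "\<dots> = 2 powr p * ((C + 1) * (\<Sum>n. \<bar>t M n\<bar> powr p))" by (simp add: algebra_simps)
      finally show "(\<Sum>n. \<bar>T_r a b r (t M) n - t M n\<bar> powr p) \<le> 2 powr p * ((C + 1) * (\<Sum>n. \<bar>t M n\<bar> powr p))" .
    qed simp
    finally show ?thesis .
  qed
  have tail: "(\<lambda>M. \<Sum>n. \<bar>t M n\<bar> powr p) \<longlonglongrightarrow> 0"
  proof -
    have "(\<Sum>n. \<bar>t M n\<bar> powr p) = (\<Sum>n. \<bar>f (n + M)\<bar> powr p)" for M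
    proof -
      have "(\<Sum>n. \<bar>t M n\<bar> powr p) = (\<Sum>n. \<bar>t M (n + M)\<bar> powr p) + (\<Sum>n<M. \<bar>t M n\<bar> powr p)"
        using tl[of M] by (intro suminf_split_initial_segment) (simp add: in_lp_def)
      then show ?thesis by (simp add: t_def)
    qed
    then show ?thesis using suminf_exist_split2[OF fs] by simp
  qed
  have lim: "((\<lambda>r. \<Sum>n. \<bar>T_r a b r f n - f n\<bar> powr p) \<longlongrightarrow> 0) (at_left 1)"
  proof (rule tendstoI)
    fix e :: real assume e: "e > 0"
    define K where "K = 2 powr p * (2 powr p * (C + 1)) + 1"
    have K: "K > 0" using C(1) by (simp add: K_def add_nonneg_pos)
    have "\<forall>\<^sub>F M in sequentially. (\<Sum>n. \<bar>t M n\<bar> powr p) < e / (2 * K)"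
      using e K by (intro order_tendstoD(2)[OF tail]) auto
    then obtain M where M: "(\<Sum>n. \<bar>t M n\<bar> powr p) < e / (2 * K)" by (auto simp: eventually_sequentially)
    have tn: "(\<Sum>n. \<bar>t M n\<bar> powr p) \<ge> 0" using tl[of M] by (intro suminf_nonneg) (auto simp: in_lp_def)
    have "\<forall>\<^sub>F r in at_left 1. (\<Sum>n. \<bar>g M r n\<bar> powr p) < e / (2 * 2 powr p)"
      unfolding g_def using e by (intro order_tendstoD(2)[OF T_r_finite_tendsto(2)[OF ab p]]) auto
    moreover have "\<forall>\<^sub>F r in at_left (1::real). r \<in> {0<..<1}" by (rule eventually_at_left_real) simp
    ultimately show "\<forall>\<^sub>F r in at_left 1. dist (\<Sum>n. \<bar>T_r a b r f n - f n\<bar> powr p) 0 < e"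
    proof eventually_elim
      case (elim r)
      then have r: "0 < r" "r < 1" by auto
      have "2 powr p * (\<Sum>n. \<bar>g M r n\<bar> powr p) < e / 2" using elim(1) by (simp add: field_simps)
      moreover have "2 powr p * (2 powr p * ((C + 1) * (\<Sum>n. \<bar>t M n\<bar> powr p))) \<le> K * (\<Sum>n. \<bar>t M n\<bar> powr p)"
        using tn by (simp add: K_def algebra_simps)
      moreover have "K * (\<Sum>n. \<bar>t M n\<bar> powr p) < e / 2" using M K by (simp add: field_simps)
      ultimately have "(\<Sum>n. \<bar>T_r a b r f n - f n\<bar> powr p) < e"
        using X[OF r, of M] by (simp add: distrib_left)
      moreover have "(\<Sum>n. \<bar>T_r a b r f n - f n\<bar> powr p) \<ge> 0"
        using main1[OF r] by (intro suminf_nonneg) (auto simp: in_lp_def)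
      ultimately show ?case by (simp add: dist_real_def)
    qed
  qed
  have "((\<lambda>r. lp_norm p (\<lambda>n. T_r a b r f n - f n)) \<longlongrightarrow> 0 powr (1 / p)) (at_left 1)"
    unfolding lp_norm_def
  proof (rule tendsto_powr'[OF lim tendsto_const], rule disjI2, rule conjI)
    show "\<forall>\<^sub>F r in at_left 1. 0 \<le> (\<Sum>n. \<bar>T_r a b r f n - f n\<bar> powr p)"
      using eventually_at_left_real[of 0 "1::real"]
      by (auto elim!: eventually_mono intro!: suminf_nonneg main1[unfolded in_lp_def])
  qed (use p in simp)
  then show "((\<lambda>r. lp_norm p (\<lambda>n. T_r a b r f n - f n)) \<longlongrightarrow> 0) (at_left 1)" by simp
qed

section \<open>Divergence for \<open>p = 1\<close>\<close>

text \<open>The uniform bound of \<open>jU\<close> lets two caps of width \<open>t0\<close> carry at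
  most \<open>2 * C^2 * t0\<close> of the total mass 1. The total mass is read off from
  \<open>jker_tendsto\<close> as a limit of integrals over inner intervals.\<close>

lemma jU_mass_middle:
  assumes ab: "a \<ge> -1/2" "b \<ge> -1/2"
  obtains t0 where "0 < t0" "t0 < pi / 2" "\<And>n. integral {t0..pi - t0} (\<lambda>x. (jU a b n x)\<^sup>2) \<ge> 1/2"
proof -
  have ab': "a > -1" "b > -1" using ab by auto
  obtain C where C: "C \<ge> 0" "\<And>n t. 0 < t \<Longrightarrow> t < pi \<Longrightarrow> \<bar>jU a b n t\<bar> \<le> C \<and> \<bar>jV a b n t\<bar> \<le> C * jfreq a b n"
    using jUV_bound[OF ab] by blast
  \<comment> \<open>Chosen such that \<open>2 * C^2 * t0 \<le> 1/2\<close>; the summand 1 excludes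
    division by zero, and \<open>t0 \<le> 1\<close> keeps \<open>t0\<close> below
    \<open>pi / 2\<close>.\<close>
  define t0 where "t0 = min 1 (1 / (4 * C\<^sup>2 + 1))"
  have D: "4 * C\<^sup>2 + 1 > 0" by (rule add_nonneg_pos) auto
  then have t0: "0 < t0" "t0 \<le> 1" by (auto simp: t0_def)
  have "2 * C\<^sup>2 * t0 \<le> 2 * C\<^sup>2 * (1 / (4 * C\<^sup>2 + 1))" by (intro mult_left_mono) (auto simp: t0_def)
  also have "\<dots> \<le> 1/2" using D by (simp add: divide_le_eq)
  finally have small: "2 * C\<^sup>2 * t0 \<le> 1/2" .
  have pi: "t0 < pi / 2" using t0 pi_gt3 by linarith
  have "integral {t0..pi - t0} (\<lambda>x. (jU a b n x)\<^sup>2) \<ge> 1/2" for n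
  proof -
    let ?u = "\<lambda>x. (jU a b n x)\<^sup>2"
    have cont: "continuous_on {s..t} ?u" if "0 < s" "t < pi" for s t
      unfolding jU_def using that by (intro continuous_intros ju_continuous_on(1)[OF jacobi_p_ode_freq]) auto
    have int: "?u integrable_on {s..t}" if "0 < s" "t < pi" for s t
      by (intro integrable_continuous_interval cont that)
    have part: "integral {s..t} ?u \<le> C\<^sup>2 * (t - s)" if st: "0 < s" "s \<le> t" "t < pi" for s t
    proof -
      have "integral {s..t} ?u \<le> integral {s..t} (\<lambda>x. C\<^sup>2)"
      proof (rule integral_le[OF int[OF st(1,3)]])
        fix x assume "x \<in> {s..t}"
        then have "\<bar>jU a b n x\<bar> \<le> C" using C(2)[of x n] st by auto
        then show "?u x \<le> C\<^sup>2" using C(1) by (simp add: abs_le_square_iff[symmetric])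
      qed auto
      then show ?thesis using st by (simp add: mult.commute)
    qed
    have "\<forall>\<^sub>F r in at_left 1. jker a b r n n \<le> integral {t0..pi - t0} ?u + 1/2"
    proof (rule eventually_mono[OF eventually_at_left_real])
      show "max 0 (cos t0) < 1" using cos_bounds_0_pi[of t0] t0 pi by auto
      fix r assume "r \<in> {max 0 (cos t0)<..<1}"
      then have r: "0 < r" "r < 1" "cos t0 < r" by auto
      note th = arccos_Ioo_half[OF r(1,2)]
      have "arccos r \<le> t0"
        using r t0 pi arccos_le_arccos[of "cos t0" r] by (simp add: arccos_cos)
      then have le: "0 < arccos r" "arccos r \<le> t0" "t0 \<le> pi - t0" "pi - t0 \<le> pi - arccos r" "pi - arccos r < pi"
        using th pi by auto
      have "integral {arccos r..t0} ?u + integral {t0..pi - arccos r} ?u = integral {arccos r..pi - arccos r} ?u"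
        using le by (intro Henstock_Kurzweil_Integration.integral_combine int) auto
      moreover have "integral {t0..pi - t0} ?u + integral {pi - t0..pi - arccos r} ?u = integral {t0..pi - arccos r} ?u"
        using le t0 by (intro Henstock_Kurzweil_Integration.integral_combine int) auto
      moreover have "integral {arccos r..t0} ?u \<le> C\<^sup>2 * (t0 - arccos r)" using le by (intro part) auto
      moreover have "integral {pi - t0..pi - arccos r} ?u \<le> C\<^sup>2 * (t0 - arccos r)"
        using part[of "pi - t0" "pi - arccos r"] le pi by simp
      moreover have "C\<^sup>2 * (t0 - arccos r) \<le> C\<^sup>2 * t0" using le by (intro mult_left_mono) auto
      moreover have "jker a b r n n = integral {arccos r..pi - arccos r} ?u"
        by (simp add: jker_eq_jU_integral[OF ab' r(1,2)] power2_eq_square)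
      ultimately show "jker a b r n n \<le> integral {t0..pi - t0} ?u + 1/2" using small by linarith
    qed
    then have "1 \<le> integral {t0..pi - t0} ?u + 1/2"
      using tendsto_upperbound[OF jker_tendsto[OF ab, of n n]] by (simp add: trivial_limit_at_left_real)
    then show ?thesis by simp
  qed
  then show ?thesis using that t0 pi by blast
qed

lemma jfreq_ge_1:
  assumes "a \<ge> -1/2" "b \<ge> -1/2" "n \<ge> 1"
  shows "jfreq a b n \<ge> 1"
  using assms by (simp add: jfreq_def field_simps)

abbreviation jSn :: "real \<Rightarrow> real \<Rightarrow> nat \<Rightarrow> real \<Rightarrow> real" where
  "jSn a b n \<equiv> jS a b (jfreq a b n) (jacobi_p a b n) (deriv (jacobi_p a b n))"

text \<open>Mass \<open>1/2\<close> on an interval shorter than \<open>pi\<close> forces a point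
  where \<open>u^2\<close> exceeds \<open>1 / (4 * pi)\<close>. That point depends on
  \<open>n\<close>, but the energy there is carried to every \<open>x\<close> at a bounded cost, in
  both directions of \<open>jS_compare\<close>.\<close>

lemma jSn_lower_bound:
  assumes ab: "a \<ge> -1/2" "b \<ge> -1/2" and st: "0 < s" "s \<le> t" "t < pi"
  obtains c where "c > 0" "\<And>n x. n \<ge> 1 \<Longrightarrow> x \<in> {s..t} \<Longrightarrow> jSn a b n x \<ge> c"
proof -
  obtain t0 where t0: "0 < t0" "t0 < pi / 2" "\<And>n. integral {t0..pi - t0} (\<lambda>x. (jU a b n x)\<^sup>2) \<ge> 1/2"
    using jU_mass_middle[OF ab] by blast
  \<comment> \<open>An interval containing both the given one and the one carrying the mass, so that
    \<open>cot\<close> is bounded along every comparison.\<close>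
  define s' t' where "s' = min s t0" and "t' = max t (pi - t0)"
  have st': "0 < s'" "s' \<le> t'" "t' < pi" using st t0 by (auto simp: s'_def t'_def)
  obtain d where d: "d > 0" "\<And>x. x \<in> {s'..t'} \<Longrightarrow> sin x \<ge> d" using sin_lower_bound[OF st'] by blast
  define E where "E = exp (jK a b * (2 / d))"
  have "jSn a b n x \<ge> 1 / (4 * pi) / E" if n: "n \<ge> 1" and x: "x \<in> {s..t}" for n x
  proof -
    note ode = jacobi_p_ode_freq[of a b n]
    have N: "jfreq a b n \<ge> 1" by (rule jfreq_ge_1[OF ab n])
    have "\<exists>y\<in>{t0..pi - t0}. (jU a b n y)\<^sup>2 > 1 / (4 * pi)"
    proof (rule ccontr)
      assume "\<not> ?thesis"
      then have "integral {t0..pi - t0} (\<lambda>x. (jU a b n x)\<^sup>2) \<le> integral {t0..pi - t0} (\<lambda>x. 1 / (4 * pi))"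
        unfolding jU_def using t0 by (intro integral_le integrable_continuous_interval continuous_intros ju_continuous_on(1)[OF ode])
          (auto simp: not_less)
      also have "\<dots> = (pi - 2 * t0) / (4 * pi)" using t0 by simp
      also have "\<dots> \<le> pi / (4 * pi)" using t0 by (intro divide_right_mono) auto
      finally show False using t0(3)[of n] by simp
    qed
    then obtain y where y: "t0 \<le> y" "y \<le> pi - t0" "(jU a b n y)\<^sup>2 > 1 / (4 * pi)" by auto
    have Sy: "jSn a b n y \<ge> 1 / (4 * pi)"
      using y(3) zero_le_power2[of "jdu a b (jacobi_p a b n) (deriv (jacobi_p a b n)) y / jfreq a b n"]
      unfolding jS_def jU_def by linarith
    have xy: "x \<in> {s'..t'}" "y \<in> {s'..t'}" using x y by (auto simp: s'_def t'_def)
    then have xy0: "0 < x" "x < pi" "0 < y" "y < pi" using st' by auto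
    have cot: "\<bar>cot z\<bar> \<le> 1 / d" if "z \<in> {s'..t'}" for z
    proof -
      have "\<bar>cot z\<bar> \<le> 1 / sin z" using that st' by (intro abs_cot_le) auto
      also have "\<dots> \<le> 1 / d" using d(1) d(2)[OF that] by (intro divide_left_mono) auto
      finally show ?thesis .
    qed
    have ex: "exp (jK a b / jfreq a b n * (cot v - cot w)) \<le> E" if "v \<in> {s'..t'}" "w \<in> {s'..t'}" for v w
    proof -
      have "cot v - cot w \<le> 1 / d + 1 / d" using cot[OF that(1)] cot[OF that(2)] by linarith
      then have "jK a b / jfreq a b n * (cot v - cot w) \<le> jK a b / jfreq a b n * (2 / d)"
        using N jK_nonneg by (intro mult_left_mono) auto
      also have "\<dots> \<le> jK a b / 1 * (2 / d)"
        using N d jK_nonneg by (intro mult_right_mono divide_left_mono) auto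
      finally show ?thesis by (simp add: E_def)
    qed
    have "jSn a b n y \<le> jSn a b n x * E"
    proof (cases "x \<le> y")
      case True
      have "jSn a b n y \<le> jSn a b n x * exp (jK a b / jfreq a b n * (cot x - cot y))"
        by (rule jS_compare(2)[OF ode N xy0(1) True xy0(4)])
      also have "\<dots> \<le> jSn a b n x * E" using ex[OF xy] by (intro mult_left_mono jS_nonneg) auto
      finally show ?thesis .
    next
      case False
      then have "y \<le> x" by simp
      have "jSn a b n y \<le> jSn a b n x * exp (jK a b / jfreq a b n * (cot y - cot x))"
        by (rule jS_compare(1)[OF ode N xy0(3) \<open>y \<le> x\<close> xy0(2)])
      also have "\<dots> \<le> jSn a b n x * E" using ex[OF xy(2,1)] by (intro mult_left_mono jS_nonneg) auto
      finally show ?thesis .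
    qed
    then have "1 / (4 * pi) \<le> jSn a b n x * E" using Sy by linarith
    then show ?thesis by (simp add: E_def pos_divide_le_eq mult_ac)
  qed
  then show ?thesis using that[of "1 / (4 * pi) / E"] by (simp add: E_def)
qed

text \<open>The energy could be concentrated in \<open>u\<close> at a single point, but in the bump
  mean \<open>u'^2\<close> is at least \<open>N^2 u^2\<close> up to a constant, so the derivative
  has its full share. Passing from \<open>u'\<close> to \<open>v\<close> costs the term
  \<open>g u\<close>, which is bounded away from the endpoints.\<close>

lemma jV_bump_lower:
  assumes ab: "a \<ge> -1/2" "b \<ge> -1/2" and st: "0 < s" "s < t" "t < pi"
  obtains c D where "c > 0" "\<And>n. n \<ge> 1 \<Longrightarrow> integral {s..t} (\<lambda>x. bump s t x * (jV a b n x)\<^sup>2) \<ge> c * (jfreq a b n)\<^sup>2 - D"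
proof -
  have ab': "a > -1" "b > -1" using ab by auto
  have st': "s \<le> t" using st by simp
  obtain c where c: "c > 0" "\<And>n x. n \<ge> 1 \<Longrightarrow> x \<in> {s..t} \<Longrightarrow> jSn a b n x \<ge> c"
    using jSn_lower_bound[OF ab st(1) st' st(3)] by blast
  obtain B where B: "B \<ge> 0" "\<And>x. x \<in> {s..t} \<Longrightarrow> 0 \<le> bump s t x \<and> bump s t x \<le> B \<and> \<bar>bump'' s t x\<bar> \<le> B"
    using bump_bounds by blast
  obtain d where d: "d > 0" "\<And>x. x \<in> {s..t} \<Longrightarrow> sin x \<ge> d" using sin_lower_bound[OF st(1) st' st(3)] by blast
  define I where "I = integral {s..t} (bump s t)"
  have I: "I > 0" unfolding I_def by (rule bump_integral_pos[OF st(2)])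
  define D2 where "D2 = jK a b / d\<^sup>2 * B + B"
  define D1 where "D1 = B * (jM a b / (2 * d))\<^sup>2"
  have D: "D1 \<ge> 0" "D2 \<ge> 0" using B jK_nonneg[of a b] by (auto simp: D1_def D2_def)
  have "integral {s..t} (\<lambda>x. bump s t x * (jV a b n x)\<^sup>2) \<ge> (c * I / 4) * (jfreq a b n)\<^sup>2 - (D2 / 4 + D1)" if n: "n \<ge> 1" for n
  proof -
    note ode = jacobi_p_ode_freq[of a b n]
    define N where "N = jfreq a b n"
    have N: "N \<ge> 1" unfolding N_def by (rule jfreq_ge_1[OF ab n])
    let ?u = "ju a b (jacobi_p a b n)" and ?v = "jv a b (deriv (jacobi_p a b n))"
      and ?du = "jdu a b (jacobi_p a b n) (deriv (jacobi_p a b n))" and ?q = "jq a b (jeig a b N)"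
    have sub: "{s..t} \<subseteq> {0<..<pi}" using st by auto
    note cont = ju_continuous_on[OF ode sub] bump_continuous
    have int: "(\<lambda>x. bump s t x * (?u x)\<^sup>2) integrable_on {s..t}" "(\<lambda>x. bump s t x * (?du x)\<^sup>2) integrable_on {s..t}"
      "(\<lambda>x. bump s t x * (?v x)\<^sup>2) integrable_on {s..t}" "(\<lambda>x. (?u x)\<^sup>2) integrable_on {s..t}"
      "(\<lambda>x. (?q x * bump s t x + bump'' s t x / 2) * (?u x)\<^sup>2) integrable_on {s..t}" "bump s t integrable_on {s..t}"
      unfolding divide_inverse jq_def by (intro integrable_continuous_interval continuous_intros cont)+
    define XU XD XV where "XU = integral {s..t} (\<lambda>x. bump s t x * (?u x)\<^sup>2)"
      and "XD = integral {s..t} (\<lambda>x. bump s t x * (?du x)\<^sup>2)" and "XV = integral {s..t} (\<lambda>x. bump s t x * (?v x)\<^sup>2)"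
    have U1: "integral {s..t} (\<lambda>x. (?u x)\<^sup>2) \<le> 1"
      by (rule jacobi_unit_integral_le[OF jacobi_p_unit[OF ab'] st(1) st' st(3)])
    have XD: "XD \<ge> N\<^sup>2 * XU - D2"
    proof -
      have "integral {s..t} (\<lambda>x. bump s t x * (?du x)\<^sup>2 - (?q x * bump s t x + bump'' s t x / 2) * (?u x)\<^sup>2) = 0"
        unfolding N_def by (rule integral_unique[OF bump_identity[OF ode st(1) st' st(3)]])
      then have "XD = integral {s..t} (\<lambda>x. (?q x * bump s t x + bump'' s t x / 2) * (?u x)\<^sup>2)"
        unfolding XD_def using integral_diff[OF int(2,5)] by simp
      also have "\<dots> \<ge> integral {s..t} (\<lambda>x. N\<^sup>2 * (bump s t x * (?u x)\<^sup>2) - D2 * (?u x)\<^sup>2)"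
      proof (intro integral_le int integrable_diff integrable_on_mult_right)
        fix x assume x: "x \<in> {s..t}"
        then have x': "0 < x" "x < pi" using st by auto
        have "jK a b / (sin x)\<^sup>2 \<le> jK a b / d\<^sup>2"
          using d d(2)[OF x] jK_nonneg[of a b] by (intro divide_left_mono power_mono) auto
        then have "N\<^sup>2 - jK a b / d\<^sup>2 \<le> ?q x" using jq_bound[OF x', of a b N] by linarith
        then have "(N\<^sup>2 - jK a b / d\<^sup>2) * bump s t x \<le> ?q x * bump s t x" using B(2)[OF x] by (intro mult_right_mono) auto
        moreover have "jK a b / d\<^sup>2 * bump s t x \<le> jK a b / d\<^sup>2 * B" using B(2)[OF x] jK_nonneg[of a b] by (intro mult_left_mono) auto
        moreover have "- B \<le> bump'' s t x / 2" using B(2)[OF x] B(1) by linarith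
        ultimately have "N\<^sup>2 * bump s t x - D2 \<le> ?q x * bump s t x + bump'' s t x / 2"
          unfolding D2_def left_diff_distrib by linarith
        then have "(N\<^sup>2 * bump s t x - D2) * (?u x)\<^sup>2 \<le> (?q x * bump s t x + bump'' s t x / 2) * (?u x)\<^sup>2"
          by (rule mult_right_mono) simp
        then show "N\<^sup>2 * (bump s t x * (?u x)\<^sup>2) - D2 * (?u x)\<^sup>2 \<le> (?q x * bump s t x + bump'' s t x / 2) * (?u x)\<^sup>2"
          by (simp add: left_diff_distrib mult.assoc)
      qed
      moreover have "integral {s..t} (\<lambda>x. N\<^sup>2 * (bump s t x * (?u x)\<^sup>2) - D2 * (?u x)\<^sup>2) = N\<^sup>2 * XU - D2 * integral {s..t} (\<lambda>x. (?u x)\<^sup>2)"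
        unfolding XU_def using int by (subst integral_diff) (auto intro!: integrable_on_mult_right)
      moreover have "D2 * integral {s..t} (\<lambda>x. (?u x)\<^sup>2) \<le> D2" using U1 D by (simp add: mult_left_le)
      ultimately show ?thesis by linarith
    qed
    have XS: "c * I \<le> XU + XD / N\<^sup>2"
    proof -
      have "c * I = integral {s..t} (\<lambda>x. c * bump s t x)" by (simp add: I_def)
      also have "\<dots> \<le> integral {s..t} (\<lambda>x. bump s t x * (?u x)\<^sup>2 + bump s t x * (?du x)\<^sup>2 / N\<^sup>2)"
      proof (intro integral_le integrable_add int integrable_on_mult_right integrable_on_divide)
        fix x assume x: "x \<in> {s..t}"
        have "c * bump s t x \<le> jSn a b n x * bump s t x" using c(2)[OF n x] B(2)[OF x] by (intro mult_right_mono) auto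
        then show "c * bump s t x \<le> bump s t x * (?u x)\<^sup>2 + bump s t x * (?du x)\<^sup>2 / N\<^sup>2"
          by (simp add: jS_def N_def power_divide algebra_simps)
      qed
      also have "\<dots> = XU + XD / N\<^sup>2"
        unfolding XU_def XD_def using int by (subst integral_add) (auto intro!: integrable_on_divide)
      finally show ?thesis .
    qed
    have XV: "XD \<le> 2 * XV + 2 * D1"
    proof -
      have "XD \<le> integral {s..t} (\<lambda>x. 2 * (bump s t x * (?v x)\<^sup>2) + (2 * D1) * (?u x)\<^sup>2)"
        unfolding XD_def
      proof (intro integral_le integrable_add int integrable_on_mult_right)
        fix x assume x: "x \<in> {s..t}"
        then have x': "0 < x" "x < pi" using st by auto
        have "\<bar>jg a b x\<bar> \<le> jM a b / (2 * sin x)" by (rule jg_bound[OF x'])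
        also have "\<dots> \<le> jM a b / (2 * d)" using d d(2)[OF x] jM_nonneg by (intro divide_left_mono mult_left_mono) auto
        finally have "\<bar>jg a b x\<bar>\<^sup>2 \<le> (jM a b / (2 * d))\<^sup>2" by (intro power_mono) auto
        then have "bump s t x * (jg a b x)\<^sup>2 \<le> D1" unfolding D1_def using B(1) B(2)[OF x] by (intro mult_mono) auto
        then have g: "bump s t x * (jg a b x)\<^sup>2 * (?u x)\<^sup>2 \<le> D1 * (?u x)\<^sup>2" by (rule mult_right_mono) simp
        have "(?du x)\<^sup>2 \<le> 2 * (?v x)\<^sup>2 + 2 * ((jg a b x)\<^sup>2 * (?u x)\<^sup>2)"
          unfolding jdu_def using zero_le_power2[of "jg a b x * ?u x - ?v x"] by (simp add: power2_eq_square algebra_simps)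
        then have "bump s t x * (?du x)\<^sup>2 \<le> bump s t x * (2 * (?v x)\<^sup>2 + 2 * ((jg a b x)\<^sup>2 * (?u x)\<^sup>2))"
          using B(2)[OF x] by (intro mult_left_mono) auto
        then show "bump s t x * (?du x)\<^sup>2 \<le> 2 * (bump s t x * (?v x)\<^sup>2) + (2 * D1) * (?u x)\<^sup>2"
          using g by (simp add: algebra_simps)
      qed
      also have "\<dots> = 2 * XV + 2 * D1 * integral {s..t} (\<lambda>x. (?u x)\<^sup>2)"
        unfolding XV_def using int by (subst integral_add) (auto intro!: integrable_on_mult_right)
      also have "\<dots> \<le> 2 * XV + 2 * D1" using U1 D by (simp add: mult_left_le)
      finally show ?thesis .
    qed
    have N2: "N\<^sup>2 > 0" using N by simp
    have "N\<^sup>2 * (c * I) \<le> N\<^sup>2 * (XU + XD / N\<^sup>2)" using XS by (rule mult_left_mono) simp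
    also have "\<dots> = N\<^sup>2 * XU + XD" using N2 by (simp add: distrib_left)
    finally have "N\<^sup>2 * (c * I) \<le> 2 * XD + D2" using XD by linarith
    then have "(c * I / 4) * N\<^sup>2 - (D2 / 4 + D1) \<le> XV" using XV by (simp add: algebra_simps)
    then show ?thesis by (simp add: XV_def jV_def N_def)
  qed
  then show ?thesis using that[of "c * I / 4" "D2 / 4 + D1"] c I by simp
qed

text \<open>The lower bound in \<open>L^2\<close> becomes one in \<open>L^1\<close> because
  \<open>v^2 \<le> C N \<bar>v\<bar>\<close>. From \<open>n0\<close> on, half of the quadratic term
  absorbs the constant \<open>D\<close>.\<close>

lemma jV_abs_integral_lower:
  assumes ab: "a \<ge> -1/2" "b \<ge> -1/2" and st: "0 < s" "s < t" "t < pi"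
  obtains c n0 where "c > 0" "\<And>n. n \<ge> n0 \<Longrightarrow> integral {s..t} (\<lambda>x. \<bar>jV a b n x\<bar>) \<ge> c * (real n + 1)"
proof -
  obtain c D where c: "c > 0" "\<And>n. n \<ge> 1 \<Longrightarrow> integral {s..t} (\<lambda>x. bump s t x * (jV a b n x)\<^sup>2) \<ge> c * (jfreq a b n)\<^sup>2 - D"
    using jV_bump_lower[OF ab st] by blast
  obtain C where C: "C \<ge> 0" "\<And>n t. 0 < t \<Longrightarrow> t < pi \<Longrightarrow> \<bar>jU a b n t\<bar> \<le> C \<and> \<bar>jV a b n t\<bar> \<le> C * jfreq a b n"
    using jUV_bound[OF ab] by blast
  obtain B where B: "B \<ge> 0" "\<And>x. x \<in> {s..t} \<Longrightarrow> 0 \<le> bump s t x \<and> bump s t x \<le> B \<and> \<bar>bump'' s t x\<bar> \<le> B"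
    using bump_bounds by blast
  define E where "E = B * C + 1"
  have E: "E > 0" using B C by (simp add: E_def add_nonneg_pos)
  obtain n1 :: nat where n1: "real n1 \<ge> 2 * \<bar>D\<bar> / c" using real_arch_simple by blast
  define n0 where "n0 = max 1 n1"
  have "integral {s..t} (\<lambda>x. \<bar>jV a b n x\<bar>) \<ge> (c / (4 * E)) * (real n + 1)" if n: "n \<ge> n0" for n
  proof -
    define N where "N = jfreq a b n"
    have n': "n \<ge> 1" "real n \<ge> 2 * \<bar>D\<bar> / c" using n n1 by (auto simp: n0_def)
    have N: "N \<ge> 1" "N \<ge> real n" using jfreq_ge_1[OF ab n'(1)] ab by (auto simp: N_def jfreq_def)
    note cont = ju_continuous_on[OF jacobi_p_ode_freq[of a b n]] bump_continuous
    have sub: "{s..t} \<subseteq> {0<..<pi}" using st by auto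
    have "2 * \<bar>D\<bar> / c \<le> N" using n' N by linarith
    also have "N \<le> N\<^sup>2" using N by (simp add: power2_eq_square)
    finally have "2 * \<bar>D\<bar> \<le> c * N\<^sup>2" using c(1) by (simp add: pos_divide_le_eq mult.commute)
    then have "c / 2 * N\<^sup>2 \<le> integral {s..t} (\<lambda>x. bump s t x * (jV a b n x)\<^sup>2)"
      using c(2)[OF n'(1)] unfolding N_def[symmetric] by linarith
    also have "\<dots> \<le> integral {s..t} (\<lambda>x. (E * N) * \<bar>jV a b n x\<bar>)"
    proof (rule integral_le)
      show "(\<lambda>x. bump s t x * (jV a b n x)\<^sup>2) integrable_on {s..t}" "(\<lambda>x. (E * N) * \<bar>jV a b n x\<bar>) integrable_on {s..t}"
        unfolding jV_def by (intro integrable_continuous_interval continuous_intros cont sub)+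
      fix x assume x: "x \<in> {s..t}"
      then have x': "0 < x" "x < pi" using st by auto
      have "bump s t x * (jV a b n x)\<^sup>2 = bump s t x * \<bar>jV a b n x\<bar> * \<bar>jV a b n x\<bar>" by (simp add: power2_eq_square)
      also have "\<dots> \<le> B * (C * N) * \<bar>jV a b n x\<bar>"
        using B(1) B(2)[OF x] C(2)[OF x', of n] C(1) N by (intro mult_mono) (auto simp: N_def)
      also have "\<dots> \<le> (E * N) * \<bar>jV a b n x\<bar>"
        unfolding E_def using N by (intro mult_right_mono) (auto simp: algebra_simps)
      finally show "bump s t x * (jV a b n x)\<^sup>2 \<le> (E * N) * \<bar>jV a b n x\<bar>" .
    qed
    also have "\<dots> = N * (E * integral {s..t} (\<lambda>x. \<bar>jV a b n x\<bar>))" by simp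
    finally have "N * (c / 2 * N) \<le> N * (E * integral {s..t} (\<lambda>x. \<bar>jV a b n x\<bar>))" by (simp add: power2_eq_square mult_ac)
    then have "c / 2 * N \<le> E * integral {s..t} (\<lambda>x. \<bar>jV a b n x\<bar>)" using N by simp
    then have "c / 2 * N / E \<le> integral {s..t} (\<lambda>x. \<bar>jV a b n x\<bar>)" using E by (simp add: pos_divide_le_eq mult.commute)
    moreover have "(c / (4 * E)) * (real n + 1) \<le> (c / (4 * E)) * (2 * N)"
      using N n' c E by (intro mult_left_mono) auto
    moreover have "(c / (4 * E)) * (2 * N) = c / 2 * N / E" by simp
    ultimately show ?thesis by linarith
  qed
  then show ?thesis using that[of "c / (4 * E)" n0] c E by simp
qed

text \<open>Both endpoints \<open>\<plusminus>r\<close> contribute to the kernel; the two test sequences \<open>m = 0, 1\<close> separate them because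
  \<open>p\<^sub>1(r) \<noteq> p\<^sub>1(-r)\<close>.\<close>
lemma jV_summable:
  assumes ab: "a \<ge> -1/2" "b \<ge> -1/2" and r: "0 < r" "r < 1"
    and s0: "summable (\<lambda>n. \<bar>jker a b r 0 n\<bar>)" and s1: "summable (\<lambda>n. \<bar>jker a b r 1 n\<bar>)"
  shows "summable (\<lambda>n. \<bar>jV a b n (arccos r)\<bar> / (real n + 1)\<^sup>2)"
proof -
  have ab': "a > -1" "b > -1" using ab by auto
  note th = arccos_Ioo_half[OF r]
  define t where "t = arccos r"
  have t: "0 < t" "t < pi" "0 < pi - t" "pi - t < pi" using th by (auto simp: t_def)
  obtain C where C: "C \<ge> 0" "\<And>n t. 0 < t \<Longrightarrow> t < pi \<Longrightarrow> \<bar>jU a b n t\<bar> \<le> C \<and> \<bar>jV a b n t\<bar> \<le> C * jfreq a b n"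
    using jUV_bound[OF ab] by blast
  obtain c where c: "c > 0" "\<And>x. jacobi_p a b 0 x = c" using jacobi_p_0[OF ab'] by blast
  define x y where "x = jacobi_p a b 1 (- r)" and "y = jacobi_p a b 1 r"
  have xy: "y - x > 0" using jacobi_p_1_less[OF ab', of "-r" r] r by (simp add: x_def y_def)
  define X Y where "X = (\<lambda>n. jrho a b (pi - t) * jV a b n (pi - t))" and "Y = (\<lambda>n. jrho a b t * jV a b n t)"
  have rho: "jrho a b t > 0" using cos_bounds_0_pi[OF t(1,2)] by (simp add: jrho_def)
  have "deriv (jacobi_p a b 0) = (\<lambda>x. 0)" using c by (auto intro!: DERIV_imp_deriv simp: c(2)[abs_def])
  then have V0: "jV a b 0 s = 0" for s by (simp add: jV_def jv_def)
  \<comment> \<open>The terms containing \<open>jV\<close> of index 1 stay bounded in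
    \<open>n\<close>; \<open>X\<close> and \<open>Y\<close> collect those containing
    \<open>jV\<close> of index \<open>n\<close>, which may grow like \<open>n\<close>.\<close>
  define E where "E = (\<lambda>n. jU a b n (pi - t) * jV a b 1 (pi - t) - jU a b n t * jV a b 1 t)"
  define Q where "Q = (\<lambda>m n. (jfreq a b n)\<^sup>2 - (jfreq a b m)\<^sup>2)"
  have e0: "Q 0 n * jker a b r 0 n = - c * (X n - Y n)" for n
    unfolding Q_def jker_wronskian[OF ab' r] t_def[symmetric]
    by (simp add: jW_def V0 X_def Y_def jU_def ju_def c algebra_simps)
  have e1: "Q 1 n * jker a b r 1 n = E n - (x * X n - y * Y n)" for n
    unfolding Q_def jker_wronskian[OF ab' r] t_def[symmetric]
    using th by (simp add: jW_def E_def X_def Y_def jU_def ju_def x_def y_def t_def algebra_simps)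
  define A where "A = 1 + \<bar>a + b + 1\<bar>"
  have Qb: "\<bar>Q m n\<bar> \<le> A * (real n + 1)\<^sup>2" if "m \<le> 1" for m n
  proof -
    have "\<bar>real n - real m\<bar> \<le> real n + 1" using that by linarith
    moreover have "\<bar>jfreq a b n + jfreq a b m\<bar> \<le> A * (real n + 1)"
    proof -
      have "jfreq a b n + jfreq a b m = real n + real m + (a + b + 1)" by (simp add: jfreq_def)
      then have "\<bar>jfreq a b n + jfreq a b m\<bar> \<le> (real n + 1) + \<bar>a + b + 1\<bar> * 1" using that by simp
      also have "\<dots> \<le> (real n + 1) + \<bar>a + b + 1\<bar> * (real n + 1)" by (intro add_left_mono mult_left_mono) auto
      finally show ?thesis by (simp add: A_def algebra_simps)
    qed
    ultimately have "\<bar>Q m n\<bar> \<le> (real n + 1) * (A * (real n + 1))"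
      unfolding Q_def jfreq_diff_squares abs_mult by (intro mult_mono) auto
    then show ?thesis by (simp add: power2_eq_square algebra_simps)
  qed
  define F where "F = 2 * (C * (C * jfreq a b 1))"
  have Eb: "\<bar>E n\<bar> \<le> F" for n
  proof -
    have "\<bar>jU a b n s * jV a b 1 s\<bar> \<le> C * (C * jfreq a b 1)" if "0 < s" "s < pi" for s
      unfolding abs_mult using C(1) C(2)[OF that] by (intro mult_mono) auto
    from this[of t] this[of "pi - t"] show ?thesis unfolding E_def F_def using t by simp
  qed
  \<comment> \<open>Subtracting \<open>x / c\<close> times \<open>e0\<close> from \<open>e1\<close>
    eliminates \<open>X\<close>, the contribution of the endpoint \<open>- r\<close>.\<close>
  have key: "(y - x) * Y n = Q 1 n * jker a b r 1 n - E n - x / c * (Q 0 n * jker a b r 0 n)" for n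
    unfolding e0 e1 using c(1) by (simp add: field_simps)
  have bound: "\<bar>jV a b n t\<bar> / (real n + 1)\<^sup>2 \<le> (A * \<bar>jker a b r 1 n\<bar> + F / (real n + 1) powr 2 + \<bar>x / c\<bar> * (A * \<bar>jker a b r 0 n\<bar>)) / ((y - x) * jrho a b t)" for n
  proof -
    define G where "G = (real n + 1)\<^sup>2"
    have G: "G > 0" by (simp add: G_def)
    have "(y - x) * jrho a b t * \<bar>jV a b n t\<bar> = \<bar>(y - x) * Y n\<bar>" using xy rho by (simp add: Y_def abs_mult)
    also have "\<dots> \<le> \<bar>Q 1 n * jker a b r 1 n\<bar> + \<bar>E n\<bar> + \<bar>x / c * (Q 0 n * jker a b r 0 n)\<bar>"
    proof -
      have "\<bar>p - q - s\<bar> \<le> \<bar>p\<bar> + \<bar>q\<bar> + \<bar>s\<bar>" for p q s :: real by linarith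
      then show ?thesis unfolding key .
    qed
    also have "\<dots> \<le> A * G * \<bar>jker a b r 1 n\<bar> + F + \<bar>x / c\<bar> * (A * G * \<bar>jker a b r 0 n\<bar>)"
      unfolding abs_mult G_def using Qb[of 1 n] Qb[of 0 n] Eb by (intro add_mono mult_left_mono mult_right_mono) auto
    also have "\<dots> = G * (A * \<bar>jker a b r 1 n\<bar> + F / G + \<bar>x / c\<bar> * (A * \<bar>jker a b r 0 n\<bar>))" using G by (simp add: distrib_left)
    finally have "(y - x) * jrho a b t * (\<bar>jV a b n t\<bar> / G) \<le> A * \<bar>jker a b r 1 n\<bar> + F / G + \<bar>x / c\<bar> * (A * \<bar>jker a b r 0 n\<bar>)"
      using G by (simp add: pos_divide_le_eq mult.commute)
    then have "\<bar>jV a b n t\<bar> / G \<le> (A * \<bar>jker a b r 1 n\<bar> + F / G + \<bar>x / c\<bar> * (A * \<bar>jker a b r 0 n\<bar>)) / ((y - x) * jrho a b t)"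
      using xy rho by (simp add: pos_le_divide_eq mult.commute)
    then show ?thesis by (simp add: G_def)
  qed
  have "summable (\<lambda>n. F * (1 / (real n + 1)) powr 2)" by (intro summable_mult summable_inverse_Suc_powr) auto
  then have "summable (\<lambda>n. F / (real n + 1) powr 2)" by (simp add: powr_divide)
  then have "summable (\<lambda>n. (A * \<bar>jker a b r 1 n\<bar> + F / (real n + 1) powr 2 + \<bar>x / c\<bar> * (A * \<bar>jker a b r 0 n\<bar>)) / ((y - x) * jrho a b t))"
    by (intro summable_divide summable_add summable_mult s0 s1)
  then show ?thesis unfolding t_def[symmetric]
    by (rule summable_comparison_test'[of _ 0]) (use bound in auto)
qed

lemma not_summable_jV:
  assumes ab: "a \<ge> -1/2" "b \<ge> -1/2" and st: "0 < s" "s < t" "t < pi"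
  shows "\<exists>x\<in>{s..t}. \<not> summable (\<lambda>n. \<bar>jV a b n x\<bar> / (real n + 1)\<^sup>2)"
proof (rule ccontr)
  assume "\<not> ?thesis"
  then have sm: "summable (\<lambda>n. \<bar>jV a b n x\<bar> / (real n + 1)\<^sup>2)" if "x \<in> {s..t}" for x using that by blast
  obtain c n0 where c: "c > 0" "\<And>n. n \<ge> n0 \<Longrightarrow> integral {s..t} (\<lambda>x. \<bar>jV a b n x\<bar>) \<ge> c * (real n + 1)"
    using jV_abs_integral_lower[OF ab st] by blast
  obtain C where C: "C \<ge> 0" "\<And>n t. 0 < t \<Longrightarrow> t < pi \<Longrightarrow> \<bar>jU a b n t\<bar> \<le> C \<and> \<bar>jV a b n t\<bar> \<le> C * jfreq a b n"
    using jUV_bound[OF ab] by blast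
  define D where "D = C * (1 + \<bar>a + b + 1\<bar>)"
  have D: "D \<ge> 0" using C by (simp add: D_def)
  define H where "H = (\<lambda>L. \<Sum>n<L. 1 / (real n + 1))"
  have H0: "H L \<ge> 0" for L unfolding H_def by (intro sum_nonneg) auto
  have Htop: "filterlim H at_top sequentially"
  proof -
    have "\<not> summable (\<lambda>n. 1 / (real n + 1))"
    proof
      assume "summable (\<lambda>n. 1 / (real n + 1))"
      then have "summable (\<lambda>n. 1 / real (Suc n))" by (simp add: add.commute)
      then have "summable (\<lambda>n. inverse (real n))" by (subst (asm) summable_Suc_iff) (simp add: inverse_eq_divide)
      then show False using not_summable_harmonic by blast
    qed
    then have "\<exists>L. H L > Z" for Z
      using summableI_nonneg_bounded[of "\<lambda>n. 1 / (real n + 1)" Z] unfolding H_def by (force simp: not_less)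
    moreover have "H L \<le> H L'" if "L \<le> L'" for L L'
      unfolding H_def using that by (intro sum_mono2) auto
    ultimately show ?thesis
      unfolding filterlim_at_top eventually_sequentially by (meson less_imp_le order.trans)
  qed
  define v where "v = (\<lambda>n x. \<bar>jV a b n x\<bar> / (real n + 1)\<^sup>2)"
  \<comment> \<open>As \<open>v n x\<close> is at most \<open>D / (n + 1)\<close>, the quotient is
    dominated by \<open>D\<close>, whereas a convergent numerator over \<open>H L\<close> tends to
    0.\<close>
  define h where "h = (\<lambda>L x. (\<Sum>n<L. v n x) / H L)"
  have sub: "{s..t} \<subseteq> {0<..<pi}" using st by auto
  have vint: "v n integrable_on {s..t}" for n
    unfolding v_def jV_def divide_inverse
    by (intro integrable_continuous_interval continuous_intros ju_continuous_on(3)[OF jacobi_p_ode_freq sub])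
  have hint: "h L integrable_on {s..t}" for L
    unfolding h_def by (intro integrable_on_divide integrable_sum vint) auto
  have vb: "v n x \<le> D * (1 / (real n + 1))" if x: "x \<in> {s..t}" for n x
  proof -
    have "jfreq a b n \<le> (1 + \<bar>a + b + 1\<bar>) * (real n + 1)"
    proof -
      have "x / 2 \<le> 1 + \<bar>x\<bar>" for x :: real by (cases "x \<ge> 0") auto
      from this[of "a + b + 1"] have "jfreq a b n \<le> (real n + 1) + \<bar>a + b + 1\<bar> * 1"
        unfolding jfreq_def by simp
      also have "\<dots> \<le> (real n + 1) + \<bar>a + b + 1\<bar> * (real n + 1)" by (intro add_left_mono mult_left_mono) auto
      finally show ?thesis by (simp add: algebra_simps)
    qed
    then have "C * jfreq a b n \<le> D * (real n + 1)" using C(1) unfolding D_def mult.assoc by (rule mult_left_mono)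
    then have "\<bar>jV a b n x\<bar> \<le> D * (real n + 1)" using C(2)[of x n] x st by fastforce
    then have "v n x \<le> D * (real n + 1) / (real n + 1)\<^sup>2" unfolding v_def by (intro divide_right_mono) auto
    then show ?thesis by (simp add: power2_eq_square)
  qed
  have "(\<lambda>L. integral {s..t} (h L)) \<longlonglongrightarrow> integral {s..t} (\<lambda>x. 0)"
  proof (rule dominated_convergence(2)[where h = "\<lambda>x. D"])
    show "norm (h L x) \<le> D" if x: "x \<in> {s..t}" for L x
    proof (cases "H L = 0")
      case True
      then show ?thesis using D by (simp add: h_def)
    next
      case False
      then have "H L > 0" using H0[of L] by simp
      moreover have "(\<Sum>n<L. v n x) \<le> D * H L"
        unfolding H_def sum_distrib_left by (intro sum_mono vb x)
      moreover have "(\<Sum>n<L. v n x) \<ge> 0" unfolding v_def by (intro sum_nonneg) auto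
      ultimately show ?thesis by (simp add: h_def pos_divide_le_eq)
    qed
    show "(\<lambda>L. h L x) \<longlonglongrightarrow> 0" if x: "x \<in> {s..t}" for x
    proof -
      have "summable (\<lambda>n. v n x)" using sm[OF x] by (simp add: v_def)
      from real_tendsto_divide_at_top[OF summable_LIMSEQ[OF this] Htop] show ?thesis by (simp add: h_def)
    qed
  qed (auto intro: hint)
  then have lim: "(\<lambda>L. integral {s..t} (h L)) \<longlonglongrightarrow> 0" by simp
  have lower: "c * (H L - H n0) / H L \<le> integral {s..t} (h L)" if L: "L \<ge> n0" for L
  proof -
    have vn: "integral {s..t} (v n) \<ge> 0" for n
      by (intro Henstock_Kurzweil_Integration.integral_nonneg vint) (simp add: v_def)
    have "c * (H L - H n0) = (\<Sum>n\<in>{n0..<L}. c * (1 / (real n + 1)))"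
    proof -
      have "H L = H n0 + (\<Sum>n\<in>{n0..<L}. 1 / (real n + 1))"
        unfolding H_def using L by (metis atLeast0LessThan sum.atLeastLessThan_concat zero_le)
      then show ?thesis by (simp add: sum_distrib_left)
    qed
    also have "\<dots> \<le> (\<Sum>n\<in>{n0..<L}. integral {s..t} (v n))"
    proof (rule sum_mono)
      fix n assume "n \<in> {n0..<L}"
      then have "c * (real n + 1) / (real n + 1)\<^sup>2 \<le> integral {s..t} (\<lambda>x. \<bar>jV a b n x\<bar>) / (real n + 1)\<^sup>2"
        by (intro divide_right_mono c(2)) auto
      then show "c * (1 / (real n + 1)) \<le> integral {s..t} (v n)" by (simp add: v_def power2_eq_square)
    qed
    also have "\<dots> \<le> (\<Sum>n<L. integral {s..t} (v n))" by (intro sum_mono2 vn) auto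
    also have "\<dots> = integral {s..t} (\<lambda>x. \<Sum>n<L. v n x)" by (intro integral_sum[symmetric] vint) auto
    finally have "c * (H L - H n0) / H L \<le> integral {s..t} (\<lambda>x. \<Sum>n<L. v n x) / H L" using H0 by (rule divide_right_mono)
    then show ?thesis by (simp add: h_def)
  qed
  have "(\<lambda>L. c * (1 - H n0 / H L)) \<longlonglongrightarrow> c * (1 - 0)"
    by (intro tendsto_intros real_tendsto_divide_at_top[OF tendsto_const Htop])
  moreover have "\<forall>\<^sub>F L in sequentially. c * (1 - H n0 / H L) \<le> integral {s..t} (h L)"
    using eventually_ge_at_top[of n0] filterlim_at_top_dense[THEN iffD1, OF Htop, rule_format, of 0]
  proof eventually_elim
    case (elim L)
    then show ?case using lower[of L] by (simp add: diff_divide_distrib right_diff_distrib)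
  qed
  ultimately have "c * (1 - 0) \<le> 0" using lim by (intro tendsto_le[OF _ lim]) auto
  then show False using c by simp
qed

lemma T_r_unit:
  "T_r a b r (\<lambda>k. if k = m then 1 else 0) n = jker a b r m n"
  unfolding T_r_eq by (subst suminf_finite[of "{m}"]) auto

text \<open>A divergent sum has no meaningful \<open>suminf\<close>, so the failure is expressed by
  membership: for the unit vector at \<open>0\<close> or at \<open>1\<close> the error leaves
  \<open>l^1\<close> for radii arbitrarily close to 1.\<close>

lemma l1_divergence:
  assumes ab: "a \<ge> -1/2" "b \<ge> -1/2"
  shows "\<exists>f. in_lp 1 f \<and> \<not> (\<forall>\<^sub>F r in at_left 1. in_lp 1 (\<lambda>n. T_r a b r f n - f n))"
proof (rule ccontr)
  assume contra: "\<not> ?thesis"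
  define e where "e = (\<lambda>m k :: nat. if k = m then 1 else 0 :: real)"
  have es: "summable (\<lambda>k. \<bar>e m k\<bar>)" for m
    by (rule summable_finite[of "{m}"]) (auto simp: e_def)
  then have e: "in_lp 1 (e m)" for m by (simp add: in_lp_def)
  have "\<forall>\<^sub>F r in at_left 1. in_lp 1 (\<lambda>n. T_r a b r (e m) n - e m n)" for m
    using contra e[of m] by blast
  then have ev: "\<forall>\<^sub>F r in at_left 1. summable (\<lambda>n. \<bar>jker a b r m n\<bar>)" for m
  proof (rule eventually_mono)
    fix r assume "in_lp 1 (\<lambda>n. T_r a b r (e m) n - e m n)"
    then have "summable (\<lambda>n. \<bar>jker a b r m n - e m n\<bar>)" by (simp add: in_lp_def e_def T_r_unit)
    then have "summable (\<lambda>n. \<bar>jker a b r m n - e m n\<bar> + \<bar>e m n\<bar>)" by (intro summable_add es)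
    then show "summable (\<lambda>n. \<bar>jker a b r m n\<bar>)"
      by (rule summable_comparison_test'[of _ 0]) auto
  qed
  have "\<forall>\<^sub>F r in at_left 1. summable (\<lambda>n. \<bar>jker a b r 0 n\<bar>) \<and> summable (\<lambda>n. \<bar>jker a b r 1 n\<bar>)"
    by (intro eventually_conj ev)
  then obtain r0 where r0: "r0 < 1" "\<And>r. r0 < r \<Longrightarrow> r < 1 \<Longrightarrow> summable (\<lambda>n. \<bar>jker a b r 0 n\<bar>) \<and> summable (\<lambda>n. \<bar>jker a b r 1 n\<bar>)"
    unfolding eventually_at_left_field by blast
  define R where "R = max r0 0"
  have R: "0 \<le> R" "R < 1" "r0 \<le> R" using r0 by (auto simp: R_def)
  \<comment> \<open>A radius strictly between \<open>R\<close> and \<open>1\<close>; every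
    \<open>x\<close> in \<open>[t/2, t]\<close> then has \<open>r0 < cos x < 1\<close>, so the
    assumed summability holds on a whole interval.\<close>
  define t where "t = arccos ((R + 1) / 2)"
  note th = arccos_Ioo_half[of "(R + 1) / 2"]
  have t: "0 < t" "t < pi / 2" "cos t = (R + 1) / 2" using th R by (auto simp: t_def)
  have "summable (\<lambda>n. \<bar>jV a b n x\<bar> / (real n + 1)\<^sup>2)" if x: "x \<in> {t/2..t}" for x
  proof -
    have x': "0 < x" "x \<le> t" "x < pi" using x t by auto
    have "cos t \<le> cos x" using x' t by (intro cos_monotone_0_pi_le) auto
    then have "0 < cos x" "cos x < 1" "r0 < cos x" using cos_bounds_0_pi[OF x'(1,3)] t R by auto
    then have "summable (\<lambda>n. \<bar>jV a b n (arccos (cos x))\<bar> / (real n + 1)\<^sup>2)"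
      using r0(2)[of "cos x"] by (intro jV_summable ab) auto
    then show ?thesis using x' by (simp add: arccos_cos)
  qed
  moreover have "\<exists>x\<in>{t/2..t}. \<not> summable (\<lambda>n. \<bar>jV a b n x\<bar> / (real n + 1)\<^sup>2)"
    using t by (intro not_summable_jV ab) auto
  ultimately show False by blast
qed

theorem theorem1p3:
  fixes a b p :: real
  assumes "a \<ge> -1/2" and "b \<ge> -1/2" and "1 \<le> p"
  shows "(\<forall>f. in_lp p f \<longrightarrow>
            ((\<forall>\<^sub>F r in at_left 1. in_lp p (\<lambda>n. T_r a b r f n - f n)) \<and>
             ((\<lambda>r. lp_norm p (\<lambda>n. T_r a b r f n - f n)) \<longlongrightarrow> 0) (at_left 1)))
         \<longleftrightarrow> 1 < p"
proof
  assume *: "\<forall>f. in_lp p f \<longrightarrow>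
            ((\<forall>\<^sub>F r in at_left 1. in_lp p (\<lambda>n. T_r a b r f n - f n)) \<and>
             ((\<lambda>r. lp_norm p (\<lambda>n. T_r a b r f n - f n)) \<longlongrightarrow> 0) (at_left 1))"
  have "p \<noteq> 1" using * l1_divergence[OF assms(1,2)] by metis
  then show "1 < p" using assms(3) by simp
next
  assume p: "1 < p"
  show "\<forall>f. in_lp p f \<longrightarrow>
            ((\<forall>\<^sub>F r in at_left 1. in_lp p (\<lambda>n. T_r a b r f n - f n)) \<and>
             ((\<lambda>r. lp_norm p (\<lambda>n. T_r a b r f n - f n)) \<longlongrightarrow> 0) (at_left 1))"
  proof (intro allI impI conjI)
    fix f assume f: "in_lp p f"
    show "\<forall>\<^sub>F r in at_left 1. in_lp p (\<lambda>n. T_r a b r f n - f n)"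
      using T_r_convergence(1)[OF assms(1,2) p f]
      by (intro eventually_mono[OF eventually_at_left_real[of 0 1]]) simp_all
    show "((\<lambda>r. lp_norm p (\<lambda>n. T_r a b r f n - f n)) \<longlongrightarrow> 0) (at_left 1)"
      by (rule T_r_convergence(2)[OF assms(1,2) p f])
  qed
qed

end
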